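(* Let $\Sigma$ be a totally ordered alphabet. For deterministic algorithms in the (standard) streaming model with $R$ passes that compute a $(1+\varepsilon)$-approximation of $\mathsf{LNST}(x,t)$ for a string $x\in\Sigma^n$, the following space lower bounds hold: (1) $\Omega(\min(\sqrt{n},|\Sigma|)/R)$ for any constant $t$, when $\varepsilon$ is any constant; (2) $\Omega(|\Sigma|\log(1/\varepsilon)/R)$ for $t\ge n/|\Sigma|$, when $|\Sigma|^2/\varepsilon=O(n)$; (3) $\Omega\!\left(\frac{\sqrt{|\Sigma|}}{\varepsilon}/R\right)$ for $t=\Theta(1/\varepsilon)$, when $|\Sigma|/\varepsilon=O(n)$.
   Context: For a string $x\in\Sigma^n$ over a totally ordered alphabet and a threshold $t\le n$, $\mathsf{LNST}(x,t)$ (longest non-decreasing subsequence with threshold) is the maximum length of a subsequence $x_{i_1}x_{i_2}\cdots x_{i_m}$ ($i_1<\dots<i_m$) with $x_{i_1}\le x_{i_2}\le\cdots\le x_{i_m}$ in which each symbol appears at most $t$ times. (The case $t=1$ is the longest increasing subsequence, the case $t=n$ the longest non-decreasing subsequence.) A $(1+\varepsilon)$-approximation means outputting $\lambda$ with $\mathsf{LNST}(x,t)\le\lambda\le(1+\varepsilon)\mathsf{LNST}(x,t)$. In the streaming model the algorithm reads $x$ from left to right once per pass; space is its working memory. *)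

theory Defs
  imports Complex_Main "HOL-Library.Sublist"
begin

definition LNST :: "'a::linorder list \<Rightarrow> nat \<Rightarrow> nat" where
  "LNST x t = Max {length y | y. subseq y x \<and> sorted y \<and> (\<forall>a. count_list y a \<le> t)}"

text \<open>
  A deterministic streaming algorithm is given by its working memory, a string of bits, and by
  how the memory changes when one symbol is read and when the end of a pass is reached.
  The memory persists between passes, and the output is a function of the final memory.
  Computation on a single symbol is unrestricted and only the memory kept between two symbols
  is charged, so lower bounds in this model also hold if scratch memory is charged as well.
\<close>

record 'a streaming_alg =
  start :: "bool list"
  read_symbol :: "bool list \<Rightarrow> 'a \<Rightarrow> bool list"
  end_pass :: "bool list \<Rightarrow> bool list"
  answer :: "bool list \<Rightarrow> real"

definition uses_space :: "'a streaming_alg \<Rightarrow> 'a set \<Rightarrow> nat \<Rightarrow> bool" where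
  "uses_space A S s \<longleftrightarrow>
     length (start A) = s \<and>
     (\<forall>m. length m = s \<longrightarrow>
        length (end_pass A m) = s \<and> (\<forall>a\<in>S. length (read_symbol A m a) = s))"

definition run_pass :: "'a streaming_alg \<Rightarrow> 'a list \<Rightarrow> bool list \<Rightarrow> bool list" where
  "run_pass A x m = end_pass A (foldl (read_symbol A) m x)"

definition run :: "'a streaming_alg \<Rightarrow> nat \<Rightarrow> 'a list \<Rightarrow> real" where
  "run A R x = answer A ((run_pass A x ^^ R) (start A))"

definition approximates_LNST ::
  "'a::linorder streaming_alg \<Rightarrow> 'a set \<Rightarrow> nat \<Rightarrow> nat \<Rightarrow> real \<Rightarrow> nat \<Rightarrow> bool" where
  "approximates_LNST A S n t \<epsilon> R \<longleftrightarrow>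
     (\<forall>x. set x \<subseteq> S \<and> length x = n \<longrightarrow>
        real (LNST x t) \<le> run A R x \<and> run A R x \<le> (1 + \<epsilon>) * real (LNST x t))"

text \<open>
  Every \<open>R\<close>-pass algorithm with approximation factor \<open>1 + \<epsilon>\<close> on strings of length \<open>n\<close> over \<open>S\<close>
  needs at least \<open>b\<close> bits of space. The algorithm may depend on all of \<open>S\<close>, \<open>n\<close>, \<open>t\<close>, \<open>\<epsilon>\<close>, \<open>R\<close>.
\<close>

definition LNST_space_ge ::
  "'a::linorder set \<Rightarrow> nat \<Rightarrow> nat \<Rightarrow> real \<Rightarrow> nat \<Rightarrow> real \<Rightarrow> bool" where
  "LNST_space_ge S n t \<epsilon> R b \<longleftrightarrow>
     (\<forall>A s. uses_space A S s \<and> approximates_LNST A S n t \<epsilon> R \<longrightarrow> b \<le> real s)"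

end

theory Submission
  imports Defs "HOL-Library.FuncSet"
begin

text \<open>
  The inputs are \<open>M \<times> B\<close> arrays of cells. The blocks are read one after the other, each in \<open>q\<close>
  columns, and different rows use different symbols (in a suitable order), so that a long
  sorted subsequence essentially has to stay in one row. The columns belonging to a cell
  are correlated: the symbols that its row contributes to a block are worth the same for every
  content of the cell.

  If the memory is small, then many arrays have the same transcript of memory contents at the
  column boundaries, and all ways of combining columns of such arrays lead to the same answer.
  By counting, some row takes many contents in at least half of its blocks. Combining the best columns
  for this row lengthens the subsequence beyond the factor \<open>1 + \<epsilon>\<close>, a contradiction.

  For constant \<open>\<epsilon>\<close> a cell holds one symbol in one of its \<open>q\<close> columns, and a combination may hold one in
  each of them. For unbounded threshold and small \<open>\<epsilon>\<close> a cell distributes \<open>d \<approx> 1 / \<surd>\<epsilon>\<close> copies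
  of a symbol to two columns. For a threshold of order \<open>1 / \<epsilon>\<close> a cell uses three symbols,
  the middle one of which is limited by the threshold.
\<close>

section \<open>Admissible subsequences\<close>

text \<open>A transcript has \<open>q * B + 1\<close> memory states per pass and an array has
  \<open>M * B\<close> cells, so both sides of the count grow linearly in \<open>B\<close>. Hence
  \<open>B\<close> cancels from the space bound, which is of order
  \<open>M * log 2 (card Y / L) / (q * R)\<close>, and it can be chosen freely. This freedom meets
  the main obstacle: a sorted subsequence may climb from row to row and collect additional symbols
  at each change. The number of changes is bounded by the range of the row keys, whereas the gain
  from mixing is linear in \<open>B\<close>, so many blocks make the changes harmless. The price is
  length, and also alphabet wherever the threshold forces different blocks to use different symbols.
  For a threshold of order \<open>1 / \<epsilon>\<close> every block needs fresh symbols in every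
  row, so the alphabet has size of order \<open>M * B\<close> at least, and \<open>B\<close> can
  hardly exceed \<open>M\<close>. There the gain from climbing has to be cancelled instead of
  outweighed. With \<open>B = M\<close> the alphabet has order \<open>M ^ 2\<close>, which is where
  the square root in the third bound comes from.\<close>

definition admissible :: "nat \<Rightarrow> 'a::linorder list \<Rightarrow> bool" where
  "admissible t y \<longleftrightarrow> sorted y \<and> (\<forall>a. count_list y a \<le> t)"

lemma count_list_subseq_le: "subseq ys xs \<Longrightarrow> count_list ys a \<le> count_list xs a"
  by (induction rule: list_emb.induct) auto

lemma count_list_replicate: "count_list (replicate n v) a = (if a = v then n else 0)"
  by (induction n) auto

lemma subseq_replicate_iff: "subseq (replicate n v) xs \<longleftrightarrow> n \<le> count_list xs v"
proof
  assume "subseq (replicate n v) xs"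
  from count_list_subseq_le[OF this, of v] show "n \<le> count_list xs v"
    by (simp add: count_list_replicate)
next
  have *: "subseq (replicate (count_list xs v) v) xs"
    by (induction xs) auto
  assume "n \<le> count_list xs v"
  then have "replicate (count_list xs v) v = replicate n v @ replicate (count_list xs v - n) v"
    by (simp add: replicate_add[symmetric])
  then have "subseq (replicate n v) (replicate (count_list xs v) v)"
    by (metis subseq_rev_drop_many subseq_order.refl)
  with * show "subseq (replicate n v) xs"
    by (rule subseq_order.order_trans[rotated])
qed

lemma subseq_set_subset: "subseq ys xs \<Longrightarrow> set ys \<subseteq> set xs"
  by (induction rule: list_emb.induct) auto

lemma subseq_sorted: "subseq ys xs \<Longrightarrow> sorted xs \<Longrightarrow> sorted ys"
  by (metis sorted_wrt_append subseq_conv_nths sorted_nths)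

lemma admissible_subseq: "subseq z y \<Longrightarrow> admissible t y \<Longrightarrow> admissible t z"
  unfolding admissible_def
  by (meson count_list_subseq_le le_trans subseq_sorted)

lemma admissible_appendD:
  assumes "admissible t (xs @ ys)"
  shows "admissible t xs" "admissible t ys" "\<And>u v. u \<in> set xs \<Longrightarrow> v \<in> set ys \<Longrightarrow> u \<le> v"
  using assms
  by (auto simp: admissible_def sorted_append intro: le_trans[OF le_add1] le_trans[OF le_add2])

lemma admissible_append:
  assumes "admissible t xs" "admissible t ys" "\<And>u v. u \<in> set xs \<Longrightarrow> v \<in> set ys \<Longrightarrow> u < v"
  shows "admissible t (xs @ ys)"
proof -
  have "count_list xs a + count_list ys a \<le> t" for a
  proof (cases "a \<in> set xs")
    case True
    then have "a \<notin> set ys" using assms(3) by blast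
    then show ?thesis using assms(1) by (simp add: count_list_0_iff admissible_def)
  next
    case False
    then have "count_list xs a = 0" by (simp add: count_list_0_iff)
    then show ?thesis using assms(2) by (simp add: admissible_def)
  qed
  then show ?thesis
    using assms by (auto simp: admissible_def sorted_append intro: less_imp_le)
qed

lemma admissible_concat:
  assumes "\<And>b. b < B \<Longrightarrow> admissible t (f b)"
    and "\<And>b b' u v. b < b' \<Longrightarrow> b' < B \<Longrightarrow> u \<in> set (f b) \<Longrightarrow> v \<in> set (f b') \<Longrightarrow> u < v"
  shows "admissible t (concat (map f [0..<B]))"
  using assms
proof (induction B)
  case 0
  then show ?case by (simp add: admissible_def)
next
  case (Suc B)
  have "admissible t (concat (map f [0..<B]) @ f B)"
    by (rule admissible_append) (use Suc in \<open>auto\<close>)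
  then show ?case by simp
qed

lemma admissible_constant:
  assumes "set xs \<subseteq> {a}" "length xs \<le> t"
  shows "admissible t xs"
proof -
  have "sorted xs" using assms(1) by (induction xs) auto
  moreover have "count_list xs b \<le> t" for b
    using count_le_length[of xs b] assms(2) by linarith
  ultimately show ?thesis by (simp add: admissible_def)
qed

lemma LNST_le:
  assumes "\<And>y. subseq y x \<Longrightarrow> admissible t y \<Longrightarrow> length y \<le> h"
  shows "LNST x t \<le> h"
proof -
  let ?A = "{length y | y. subseq y x \<and> sorted y \<and> (\<forall>a. count_list y a \<le> t)}"
  have "?A \<subseteq> {..h}" using assms by (auto simp: admissible_def)
  moreover have "length [] \<in> ?A"
    by (intro CollectI exI[of _ "[]"]) auto
  then have "?A \<noteq> {}" by blast
  ultimately show ?thesis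
    unfolding LNST_def by (meson Max.boundedI atMost_iff finite_atMost finite_subset subsetD)
qed

lemma LNST_ge:
  assumes "subseq y x" "admissible t y"
  shows "length y \<le> LNST x t"
proof -
  let ?A = "{length y | y. subseq y x \<and> sorted y \<and> (\<forall>a. count_list y a \<le> t)}"
  have "?A \<subseteq> {..length x}" by (auto simp: list_emb_length)
  then show ?thesis
    unfolding LNST_def
    by (intro Max_ge finite_subset[of ?A "{..length x}"]) (use assms in \<open>auto simp: admissible_def\<close>)
qed

section \<open>Concatenations, and sorted sequences along the rows of a key\<close>

lemma subseq_concat_map:
  assumes "\<And>c. c \<in> set l \<Longrightarrow> subseq (f c) (g c)"
  shows "subseq (concat (map f l)) (concat (map g l))"
  using assms by (induction l) (auto intro: list_emb_append_mono)

lemma concat_map_upt_mult: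
  "concat (map f [0..<q * B]) = concat (map (\<lambda>b. concat (map (\<lambda>i. f (b * q + i)) [0..<q])) [0..<B])"
proof (induction B)
  case (Suc B)
  have "[0..<q * Suc B] = [0..<q * B] @ map (\<lambda>i. B * q + i) [0..<q]"
    using upt_add_eq_append[of 0 "q * B" q] map_add_upt[of "B * q" q]
    by (simp add: add.commute mult.commute)
  then show ?case by (simp add: Suc comp_def)
qed simp

lemma length_filter_concat_map_upt:
  "length (filter P (concat (map f [0..<k]))) = (\<Sum>i<k. length (filter P (f i)))"
  by (induction k) auto

lemma length_concat_map_upt: "length (concat (map f [0..<k])) = (\<Sum>i<k. length (f i))"
  by (induction k) auto

lemma count_list_concat_map_upt:
  "count_list (concat (map f [0..<k])) a = (\<Sum>i<k. count_list (f i) a)"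
  by (induction k) auto

text \<open>On \<open>y\<close> a monotone key only takes values from \<open>r (hd y)\<close> to
  \<open>r (last y)\<close>, and each of them accounts for at most \<open>h\<close> entries. The
  additive form avoids truncated subtraction and telescopes when blocks are joined.\<close>

lemma length_le_rows:
  fixes r :: "'a::linorder \<Rightarrow> nat"
  assumes r: "mono r" and y: "sorted y" "y \<noteq> []"
    and h: "\<And>\<rho>. length (filter (\<lambda>v. r v = \<rho>) y) \<le> h"
  shows "length y + h * r (hd y) \<le> h * (1 + r (last y))"
proof -
  have hd_last: "r (hd y) \<le> r v \<and> r v \<le> r (last y)" if "v \<in> set y" for v
  proof -
    have "hd y \<le> v" using that y by (cases y) auto
    moreover have "v \<le> last y" using that y
      by (metis append_butlast_last_id in_set_conv_decomp_last insertE list.simps(15) order_refl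
          rotate1.simps(2) set_rotate1 sorted_append list.set_intros(1))
    ultimately show ?thesis using r by (simp add: monoD)
  qed
  have "length (filter (\<lambda>v. r v \<in> A) y) = (\<Sum>\<rho>\<in>A. length (filter (\<lambda>v. r v = \<rho>) y))"
    if "finite A" for A
    using that
  proof (induction A)
    case (insert \<rho> A)
    have "length (filter (\<lambda>v. r v \<in> insert \<rho> A) ys)
        = length (filter (\<lambda>v. r v = \<rho>) ys) + length (filter (\<lambda>v. r v \<in> A) ys)" for ys
      using insert by (induction ys) auto
    then show ?case using insert by simp
  qed simp
  from this[of "{r (hd y)..r (last y)}"]
  have "length (filter (\<lambda>v. r v \<in> {r (hd y)..r (last y)}) y)
      \<le> (\<Sum>\<rho>\<in>{r (hd y)..r (last y)}. h)"
    by (simp only: finite_atLeastAtMost) (rule sum_mono, rule h)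
  moreover have "filter (\<lambda>v. r v \<in> {r (hd y)..r (last y)}) y = y"
    using hd_last by (auto simp: filter_id_conv)
  ultimately have "length y \<le> (Suc (r (last y)) - r (hd y)) * h" by simp
  moreover have "r (hd y) \<le> r (last y)" using hd_last y by simp
  ultimately show ?thesis
    by (auto simp: algebra_simps le_iff_add)
qed

text \<open>
  Rows are the level sets of the monotone key \<open>r\<close>. Along a sorted sequence the key never decreases,
  so over all blocks together a sequence changes its row at most \<open>r (last y) - r (hd y)\<close> times.
\<close>

lemma length_le_rows_blocks:
  fixes r :: "'a::linorder \<Rightarrow> nat"
  assumes r: "mono r"
    and "\<And>w \<rho> y. w \<in> set ws \<Longrightarrow> subseq y (filter (\<lambda>v. r v = \<rho>) w) \<Longrightarrow> admissible t y \<Longrightarrow> length y \<le> h"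
    and "subseq y (concat ws)" "admissible t y" "y \<noteq> []"
  shows "length y + h * r (hd y) \<le> h * (length ws + r (last y))"
  using assms(2-)
proof (induction ws arbitrary: y)
  case (Cons w ws)
  from Cons.prems(2) obtain y1 y2 where y: "y = y1 @ y2" "subseq y1 w" "subseq y2 (concat ws)"
    by (auto elim: subseq_appendE)
  note ad = admissible_appendD[OF Cons.prems(3)[unfolded y(1)]]
  have 1: "length y1 + h * r (hd y1) \<le> h * (1 + r (last y1))" if "y1 \<noteq> []"
  proof (rule length_le_rows[OF r _ that])
    show "sorted y1" using ad(1) by (simp add: admissible_def)
    show "length (filter (\<lambda>v. r v = \<rho>) y1) \<le> h" for \<rho>
      by (rule Cons.prems(1)[of w])
        (use y(2) ad(1) in \<open>auto intro: subseq_filter admissible_subseq[OF subseq_filter_left]\<close>)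
  qed
  have 2: "length y2 + h * r (hd y2) \<le> h * (length ws + r (last y2))" if "y2 \<noteq> []"
    by (rule Cons.IH) (use Cons.prems(1) y(3) ad(2) that in auto)
  consider "y1 = []" "y2 \<noteq> []" | "y1 \<noteq> []" "y2 = []" | "y1 \<noteq> []" "y2 \<noteq> []"
    using Cons.prems(4) y(1) by auto
  then show ?case
  proof cases
    case 1
    then show ?thesis using 2 y(1) by (simp add: algebra_simps)
  next
    case 2
    then show ?thesis using 1 y(1) by (simp add: algebra_simps)
  next
    case 3
    have "r (last y1) \<le> r (hd y2)"
      using ad(3)[of "last y1" "hd y2"] 3 r by (simp add: monoD)
    then have "h * r (last y1) \<le> h * r (hd y2)" by (rule mult_le_mono2)
    moreover have "length y = length y1 + length y2" "hd y = hd y1" "last y = last y2"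
      "length (w # ws) = 1 + length ws"
      using 3 y(1) by auto
    ultimately show ?thesis
      using 1[OF 3(1)] 2[OF 3(2)] by (simp only: distrib_left)
  qed
qed simp

text \<open>The symbols decrease, so a sorted subsequence can only use one of them.\<close>

definition padding :: "nat \<Rightarrow> nat \<Rightarrow> nat \<Rightarrow> nat \<Rightarrow> nat list" where
  "padding v J m l = take l (concat (map (\<lambda>i. replicate m (v + i)) (rev [0..<J])))"

lemma length_padding: "l \<le> J * m \<Longrightarrow> length (padding v J m l) = l"
proof -
  have "length (concat (map (\<lambda>i. replicate m (v + i)) (rev [0..<J]))) = J * m"
    by (induction J) auto
  then show "l \<le> J * m \<Longrightarrow> length (padding v J m l) = l" by (simp add: padding_def)
qed

lemma set_padding: "set (padding v J m l) \<subseteq> {v..<v + J}"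
  unfolding padding_def by (rule order_trans[OF set_take_subset]) auto

lemma subseq_padding: "subseq (padding v J m l) (concat (map (\<lambda>i. replicate m (v + i)) (rev [0..<J])))"
  unfolding padding_def
  by (metis append_take_drop_id subseq_rev_drop_many subseq_order.refl)

text \<open>After an entry from a higher row, an entry from a lower row would break sortedness. This
  serves the padding, with single symbols as rows, and the additional cells in
  \<open>tilted_space_ge\<close>.\<close>

lemma subseq_decreasing_rows:
  fixes r :: "'a::linorder \<Rightarrow> nat"
  assumes r: "mono r" and f: "\<And>\<rho> v. \<rho> < M \<Longrightarrow> v \<in> set (f \<rho>) \<Longrightarrow> r v = \<rho>"
    and y: "subseq y (concat (map f (rev [0..<M])))" "sorted y" "y \<noteq> []"
  shows "\<exists>\<rho><M. subseq y (f \<rho>)"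
  using f y
proof (induction M arbitrary: y)
  case (Suc M)
  from Suc.prems(2) obtain y1 y2 where
    y: "y = y1 @ y2" "subseq y1 (f M)" "subseq y2 (concat (map f (rev [0..<M])))"
    by (auto elim: subseq_appendE)
  show ?case
  proof (cases "y2 = []")
    case True
    then show ?thesis using y by auto
  next
    case False
    then have v: "hd y2 \<in> set y2" by simp
    with subseq_set_subset[OF y(3)] obtain \<rho> where "\<rho> < M" "hd y2 \<in> set (f \<rho>)" by auto
    then have *: "r (hd y2) < M" using Suc.prems(1)[of \<rho>] by simp
    have "y1 = []"
    proof (rule ccontr)
      assume "y1 \<noteq> []"
      then have "hd y1 \<in> set y1" by simp
      then have "r (hd y1) = M" using subseq_set_subset[OF y(2)] Suc.prems(1) by auto
      moreover have "hd y1 \<le> hd y2"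
        using Suc.prems(3) y(1) v \<open>hd y1 \<in> set y1\<close> by (auto simp: sorted_append)
      ultimately show False using * r by (metis monoD not_le)
    qed
    moreover have "\<exists>\<rho><M. subseq y2 (f \<rho>)"
      by (rule Suc.IH) (use Suc.prems y False \<open>y1 = []\<close> in auto)
    ultimately show ?thesis using y(1) less_Suc_eq by auto
  qed
qed simp

text \<open>The padding comes first and its symbols exceed all of \<open>x\<close>, so a sorted
  subsequence lies entirely in one of the two. Inside the padding it uses a single symbol, hence has
  length at most \<open>m\<close> and at most \<open>t\<close>. So inputs can be filled up to length
  \<open>n\<close> without raising the bound \<open>h\<close>.\<close>

lemma length_le_padding:
  assumes y: "subseq y (padding v J m l @ x)" "admissible t y"
    and x: "\<And>a. a \<in> set x \<Longrightarrow> a < v"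
    and h: "m \<le> h \<or> t \<le> h"
    and bound: "\<And>y. subseq y x \<Longrightarrow> admissible t y \<Longrightarrow> length y \<le> h"
  shows "length y \<le> h"
proof -
  from y(1) obtain y1 y2 where y12: "y = y1 @ y2" "subseq y1 (padding v J m l)" "subseq y2 x"
    by (auto elim: subseq_appendE)
  note ad = admissible_appendD[OF y(2)[unfolded y12(1)]]
  show ?thesis
  proof (cases "y1 = []")
    case True
    then show ?thesis using bound y12 ad by simp
  next
    case False
    then have hd: "hd y1 \<in> set y1" by simp
    then have "v \<le> hd y1" using subseq_set_subset[OF y12(2)] set_padding[of v J m l] by force
    then have "y2 = []"
      using ad(3)[OF hd, of "hd y2"] x[of "hd y2"] subseq_set_subset[OF y12(3)]
      by (cases y2) force+
    have "\<exists>i<J. subseq y1 (replicate m (v + i))"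
    proof (rule subseq_decreasing_rows[of "\<lambda>a. a - v"])
      show "mono (\<lambda>a. a - v)" by (simp add: monoI diff_le_mono)
      show "subseq y1 (concat (map (\<lambda>i. replicate m (v + i)) (rev [0..<J])))"
        using y12(2) subseq_padding subseq_order.order_trans by blast
    qed (use ad(1) False in \<open>auto simp: admissible_def\<close>)
    then obtain i where i: "subseq y1 (replicate m (v + i))" by blast
    then have "length y1 \<le> m" using list_emb_length by fastforce
    moreover have "length y1 \<le> t"
    proof -
      have "set y1 \<subseteq> {v + i}" using subseq_set_subset[OF i] by auto
      then have "length y1 = count_list y1 (v + i)"
        using sum_count_set[of y1 "{v + i}"] by simp
      then show ?thesis using ad(1) by (simp add: admissible_def)
    qed
    ultimately show ?thesis using h y12(1) \<open>y2 = []\<close> by auto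
  qed
qed

section \<open>Mixing inputs with equal transcripts\<close>

text \<open>A constant \<open>z\<close> gives the genuine encoding of one array; any other
  \<open>z\<close> combines columns of several arrays.\<close>

definition mix :: "'a list \<Rightarrow> (nat \<Rightarrow> 'x \<Rightarrow> 'a list) \<Rightarrow> 'a list \<Rightarrow> nat \<Rightarrow> (nat \<Rightarrow> 'x) \<Rightarrow> 'a list" where
  "mix pre col suf k z = pre @ concat (map (\<lambda>c. col c (z c)) [0..<k]) @ suf"

lemma set_mix_subset:
  assumes "set pre \<subseteq> S" "set suf \<subseteq> S" "\<And>c. c < k \<Longrightarrow> set (col c (z c)) \<subseteq> S"
  shows "set (mix pre col suf k z) \<subseteq> S"
  using assms by (simp add: mix_def UN_subset_iff)

lemma length_foldl_read_symbol:
  assumes "uses_space A S s" "set x \<subseteq> S" "length m = s"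
  shows "length (foldl (read_symbol A) m x) = s"
  using assms(2,3)
proof (induction x arbitrary: m)
  case (Cons a x)
  then have "length (read_symbol A m a) = s" using assms(1) by (simp add: uses_space_def)
  then show ?case using Cons by simp
qed simp

lemma length_run_pass:
  assumes "uses_space A S s" "set x \<subseteq> S" "length m = s"
  shows "length (run_pass A x m) = s"
  using length_foldl_read_symbol[OF assms] assms(1) by (simp add: run_pass_def uses_space_def)

lemma length_run_passes:
  assumes "uses_space A S s" "set x \<subseteq> S"
  shows "length ((run_pass A x ^^ r) (start A)) = s"
proof (induction r)
  case 0
  then show ?case using assms(1) by (simp add: uses_space_def)
next
  case (Suc r)
  then show ?case using length_run_pass[OF assms] by simp
qed

text \<open>
  The transcript of an input consists of the memory contents at all column boundaries in all
  passes. If all inputs in \<open>T\<close> have the same transcript, then so has every input whose columns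
  are taken from members of \<open>T\<close>.
\<close>

lemma mixing:
  fixes A :: "'a streaming_alg" and X :: "'x set"
  assumes A: "uses_space A S s" and X: "finite X" "X \<noteq> {}"
    and S: "set pre \<subseteq> S" "set suf \<subseteq> S" "\<And>c x. c < k \<Longrightarrow> x \<in> X \<Longrightarrow> set (col c x) \<subseteq> S"
  shows "\<exists>T v. T \<subseteq> X \<and> T \<noteq> {} \<and> card X \<le> card T * 2 ^ (s * (k + 1) * R) \<and>
    (\<forall>z. (\<forall>c<k. z c \<in> T) \<longrightarrow> run A R (mix pre col suf k z) = v)"
proof -
  let ?m = "mix pre col suf k"
  define part where "part z c = pre @ concat (map (\<lambda>c. col c (z c)) [0..<c])" for z c
  define mem where "mem z r = (run_pass A (?m z) ^^ r) (start A)" for z r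
  define st where "st z r c = foldl (read_symbol A) (mem z r) (part z c)" for z r c
  define tr where "tr x = (\<lambda>(r, c) \<in> {..<R} \<times> {..k}. st (\<lambda>_. x) r c)" for x
  let ?V = "{m :: bool list. length m = s}"
  let ?B = "PiE ({..<R} \<times> {..k}) (\<lambda>_. ?V)"
  have V: "finite ?V" "card ?V = 2 ^ s"
    using finite_lists_length_eq[of "UNIV :: bool set" s] card_lists_length_eq[of "UNIV :: bool set" s]
    by auto
  have sets: "set (part z c) \<subseteq> S" "set (?m z) \<subseteq> S" if "c \<le> k" "\<And>c. c < k \<Longrightarrow> z c \<in> X" for z c
    using S that by (simp_all add: part_def UN_subset_iff set_mix_subset)
  have tr: "tr \<in> X \<rightarrow> ?B"
  proof
    fix x assume "x \<in> X"
    then have "length (st (\<lambda>_. x) r c) = s" if "c \<le> k" for r c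
      unfolding st_def mem_def
      by (intro length_foldl_read_symbol[OF A] length_run_passes[OF A] sets that) auto
    then show "tr x \<in> ?B" by (auto simp: tr_def)
  qed
  have "finite ?B" using V by (intro finite_PiE) auto
  moreover have "card ?B = 2 ^ (s * (k + 1) * R)"
    by (simp add: card_PiE V power_mult[symmetric] algebra_simps)
  ultimately have "\<exists>u\<in>?B. card X \<le> card (tr -` {u} \<inter> X) * 2 ^ (s * (k + 1) * R)"
    using pigeonhole_card[OF tr X(1)] by fastforce
  then obtain u where u: "card X \<le> card (tr -` {u} \<inter> X) * 2 ^ (s * (k + 1) * R)" by blast
  define T where "T = tr -` {u} \<inter> X"
  have "T \<noteq> {}" using u X by (auto simp: T_def[symmetric])
  then obtain x0 where x0: "x0 \<in> T" by blast
  have eq: "st (\<lambda>_. x) r c = st (\<lambda>_. x0) r c" if "x \<in> T" "r < R" "c \<le> k" for x r c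
  proof -
    have "tr x = tr x0" using that x0 by (auto simp: T_def)
    from fun_cong[OF this, of "(r, c)"] show ?thesis using that by (simp add: tr_def)
  qed
  have step: "st z r (Suc c) = foldl (read_symbol A) (st z r c) (col c (z c))" for z r c
    by (simp add: st_def part_def)
  have mem_Suc: "mem z (Suc r) = end_pass A (foldl (read_symbol A) (st z r k) suf)" for z r
    by (simp add: mem_def st_def part_def run_pass_def mix_def)
  have "run A R (?m z) = run A R (?m (\<lambda>_. x0))" if z: "\<forall>c<k. z c \<in> T" for z
  proof -
    have st: "st z r c = st (\<lambda>_. x0) r c" if m: "mem z r = mem (\<lambda>_. x0) r" "r < R" "c \<le> k" for r c
      using m(3)
    proof (induction c)
      case 0
      then show ?case using m by (simp add: st_def part_def)
    next
      case (Suc c)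
      then have zc: "z c \<in> T" using z by simp
      \<comment> \<open>Before column \<open>c\<close> the memory agrees with the run on the single
        array \<open>z c\<close>, hence also after reading this column, and there all members of
        \<open>T\<close> agree again.\<close>
      have "st z r (Suc c) = foldl (read_symbol A) (st (\<lambda>_. z c) r c) (col c (z c))"
        using Suc eq[OF zc m(2), of c] by (simp add: step)
      also have "\<dots> = st (\<lambda>_. z c) r (Suc c)" by (simp add: step)
      finally show ?case using eq[OF zc m(2) Suc.prems] by simp
    qed
    have "mem z r = mem (\<lambda>_. x0) r" if "r \<le> R" for r
      using that
    proof (induction r)
      case 0
      then show ?case by (simp add: mem_def)
    next
      case (Suc r)
      then show ?case using st[of r k] by (simp add: mem_Suc)
    qed
    then show ?thesis by (simp add: run_def mem_def)
  qed
  then show ?thesis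
    using u \<open>T \<noteq> {}\<close> by (intro exI[of _ T] exI[of _ "run A R (?m (\<lambda>_. x0))"]) (auto simp: T_def)
qed

section \<open>Counting: a row with many contents in half of its blocks\<close>

lemma card_le_prod_image:
  assumes "T \<subseteq> PiE I (\<lambda>_. Y)" "finite I" "finite Y"
  shows "card T \<le> (\<Prod>i\<in>I. card ((\<lambda>x. x i) ` T))"
proof -
  have "(\<lambda>x. x i) ` T \<subseteq> Y" if "i \<in> I" for i using assms(1) that by (auto simp: PiE_def Pi_def)
  then have "finite (PiE I (\<lambda>i. (\<lambda>x. x i) ` T))"
    using assms(2,3) by (intro finite_PiE) (auto intro: finite_subset)
  moreover have "T \<subseteq> PiE I (\<lambda>i. (\<lambda>x. x i) ` T)"
    using assms(1) by (auto simp: PiE_def)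
  ultimately show ?thesis
    using card_mono card_PiE[OF assms(2)] by metis
qed

definition rich_blocks :: "nat \<Rightarrow> nat \<Rightarrow> nat \<Rightarrow> (nat \<times> nat \<Rightarrow> 'y) set \<Rightarrow> nat set" where
  "rich_blocks B L \<rho> T = {b. b < B \<and> L < card ((\<lambda>x. x (\<rho>, b)) ` T)}"

text \<open>Otherwise each row has at most half of its blocks rich, and its projections multiply to
  at most \<open>card Y\<close> for each rich block and \<open>L\<close> for each other one.
  Squaring avoids halves: the square of the product is at most \<open>(card Y * L) ^ B\<close> per
  row. As \<open>T\<close> lies in the product of its projections, this makes \<open>T\<close> too
  small for the pigeonhole bound \<open>card\<close>.\<close>

lemma rich_row:
  fixes Y :: "'y set"
  assumes Y: "finite Y" "L \<le> card Y" and L: "1 \<le> L" and B: "1 \<le> B"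
    and T: "T \<subseteq> PiE ({..<M} \<times> {..<B}) (\<lambda>_. Y)" "T \<noteq> {}"
    and card: "card Y ^ (M * B) \<le> card T * 2 ^ (s * (q * B + 1) * R)"
    and large: "2 * real (q + 1) * real R * real s < real M * log 2 (real (card Y) / real L)"
  shows "\<exists>\<rho><M. B < 2 * card (rich_blocks B L \<rho> T)"
proof (rule ccontr)
  assume "\<not> ?thesis"
  then have few: "2 * card (rich_blocks B L \<rho> T) \<le> B" if "\<rho> < M" for \<rho> using that by force
  let ?a = "\<lambda>i. card ((\<lambda>x. x i) ` T)"
  have aY: "?a i \<le> card Y" if "i \<in> {..<M} \<times> {..<B}" for i
    using T(1) that by (intro card_mono Y) (auto simp: PiE_def Pi_def)
  have row: "(\<Prod>b<B. ?a (\<rho>, b))\<^sup>2 \<le> (card Y * L) ^ B" if \<rho>: "\<rho> < M" for \<rho>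
  proof -
    let ?r = "rich_blocks B L \<rho> T"
    have r: "?r \<subseteq> {..<B}" "finite ?r" by (auto simp: rich_blocks_def)
    have "(\<Prod>b<B. ?a (\<rho>, b)) = (\<Prod>b\<in>{..<B} - ?r. ?a (\<rho>, b)) * (\<Prod>b\<in>?r. ?a (\<rho>, b))"
      using r by (intro prod.subset_diff) auto
    also have "\<dots> \<le> (\<Prod>b\<in>{..<B} - ?r. L) * (\<Prod>b\<in>?r. card Y)"
      using \<rho> r by (intro mult_le_mono prod_mono conjI aY) (auto simp: rich_blocks_def)
    also have "\<dots> = L ^ (B - card ?r) * card Y ^ card ?r"
      using r by (simp add: card_Diff_subset)
    finally have "(\<Prod>b<B. ?a (\<rho>, b))\<^sup>2 \<le> (L ^ (B - card ?r) * card Y ^ card ?r)\<^sup>2"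
      by (rule power_mono) simp
    also have "\<dots> = L ^ B * L ^ (B - 2 * card ?r) * card Y ^ (2 * card ?r)"
    proof -
      have "2 * (B - card ?r) = B + (B - 2 * card ?r)" using few[OF \<rho>] by simp
      then show ?thesis
        by (simp add: power_mult_distrib power_add[symmetric] power_mult[symmetric] mult.commute)
    qed
    \<comment> \<open>The surplus factors \<open>L\<close> are raised to \<open>card Y\<close>,
      which leaves the extreme case of exactly one half rich blocks.\<close>
    also have "\<dots> \<le> L ^ B * card Y ^ (B - 2 * card ?r) * card Y ^ (2 * card ?r)"
      using Y(2) by (intro mult_le_mono power_mono) auto
    also have "\<dots> = (card Y * L) ^ B"
      using few[OF \<rho>] by (simp add: power_mult_distrib power_add[symmetric])
    finally show ?thesis .
  qed
  have "(card T)\<^sup>2 \<le> (\<Prod>i\<in>{..<M} \<times> {..<B}. ?a i)\<^sup>2"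
    using card_le_prod_image[OF T(1)] Y(1) by (intro power_mono) auto
  also have "\<dots> = (\<Prod>\<rho><M. (\<Prod>b<B. ?a (\<rho>, b))\<^sup>2)"
    by (simp add: prod.cartesian_product prod_power_distrib case_prod_unfold)
  also have "\<dots> \<le> (\<Prod>\<rho><M. (card Y * L) ^ B)"
    using row by (intro prod_mono) auto
  also have "\<dots> = (card Y * L) ^ (M * B)"
    by (simp add: power_mult[symmetric] mult.commute)
  finally have T2: "(card T)\<^sup>2 \<le> (card Y * L) ^ (M * B)" .
  let ?e = "s * (q * B + 1) * R"
  have Y0: "0 < card Y" using Y(2) L by linarith
  have "(card Y ^ (M * B))\<^sup>2 \<le> (card T * 2 ^ ?e)\<^sup>2"
    using card by (rule power_mono) simp
  also have "\<dots> \<le> (card Y * L) ^ (M * B) * (2 ^ ?e)\<^sup>2"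
    using T2 by (simp add: power_mult_distrib)
  finally have "card Y ^ (M * B) * card Y ^ (M * B) \<le> card Y ^ (M * B) * (L ^ (M * B) * (2 ^ ?e)\<^sup>2)"
    by (simp add: power2_eq_square power_mult_distrib mult.assoc)
  then have "card Y ^ (M * B) \<le> L ^ (M * B) * (2 ^ ?e)\<^sup>2"
    using Y0 by simp
  then have "real (card Y ^ (M * B)) \<le> real (L ^ (M * B) * (2 ^ ?e)\<^sup>2)" by (rule of_nat_mono)
  then have "(real (card Y) / real L) ^ (M * B) \<le> 2 ^ (2 * ?e)"
    using L by (simp add: power_divide field_simps power_mult[symmetric])
  then have "log 2 ((real (card Y) / real L) ^ (M * B)) \<le> log 2 (2 ^ (2 * ?e))"
    using Y0 L by (subst log_le_cancel_iff) auto
  then have "real (M * B) * log 2 (real (card Y) / real L) \<le> real (2 * ?e)"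
    using Y0 L by (simp add: log_nat_power)
  moreover have "real (2 * ?e) \<le> real B * (2 * real (q + 1) * real R * real s)"
  proof -
    \<comment> \<open>The one state per pass that belongs to no column is charged to the blocks, so
      that \<open>B\<close> cancels.\<close>
    have "q * B + 1 \<le> (q + 1) * B" using B by simp
    then have "2 * ?e \<le> 2 * (s * ((q + 1) * B) * R)" by (intro mult_le_mono) auto
    then have "real (2 * ?e) \<le> real (2 * (s * ((q + 1) * B) * R))" by (rule of_nat_mono)
    then show ?thesis by (simp add: algebra_simps)
  qed
  ultimately have "real B * (real M * log 2 (real (card Y) / real L))
      \<le> real B * (2 * real (q + 1) * real R * real s)"
    by (simp add: algebra_simps)
  then show False using large B by simp
qed

text \<open>
  \<open>Y\<close> is the set of contents of a cell of an \<open>M \<times> B\<close> array, and block \<open>b\<close> of the array is read in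
  the \<open>q\<close> columns \<open>b * q, \<dots>, b * q + q - 1\<close>.
\<close>

lemma space_ge_if_rich_gap:
  fixes Y :: "'y set" and col :: "nat \<Rightarrow> (nat \<times> nat \<Rightarrow> 'y) \<Rightarrow> 'a::linorder list"
  assumes Y: "finite Y" "L \<le> card Y" and L: "1 \<le> L" and B: "1 \<le> B" and R: "1 \<le> R"
    and eps: "0 < \<epsilon>"
    and S: "set pre \<subseteq> S" "set suf \<subseteq> S"
      "\<And>c x. c < q * B \<Longrightarrow> x \<in> PiE ({..<M} \<times> {..<B}) (\<lambda>_. Y) \<Longrightarrow> set (col c x) \<subseteq> S"
    and n: "\<And>z. (\<And>c. c < q * B \<Longrightarrow> z c \<in> PiE ({..<M} \<times> {..<B}) (\<lambda>_. Y)) \<Longrightarrow>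
      length (mix pre col suf (q * B) z) = n"
    and no: "\<And>x. x \<in> PiE ({..<M} \<times> {..<B}) (\<lambda>_. Y) \<Longrightarrow>
      LNST (mix pre col suf (q * B) (\<lambda>_. x)) t \<le> l"
    and yes: "\<And>\<rho> T. \<rho> < M \<Longrightarrow> T \<subseteq> PiE ({..<M} \<times> {..<B}) (\<lambda>_. Y) \<Longrightarrow> T \<noteq> {} \<Longrightarrow>
      B < 2 * card (rich_blocks B L \<rho> T) \<Longrightarrow>
      \<exists>z. (\<forall>c<q * B. z c \<in> T) \<and> l' \<le> real (LNST (mix pre col suf (q * B) z) t)"
    and gap: "(1 + \<epsilon>) * real l < l'"
  shows "LNST_space_ge S n t \<epsilon> R (real M * log 2 (real (card Y) / real L) / (2 * real (q + 1) * real R))"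
  unfolding LNST_space_ge_def
proof (intro allI impI, elim conjE)
  fix A s assume A: "uses_space A S s" "approximates_LNST A S n t \<epsilon> R"
  let ?X = "PiE ({..<M} \<times> {..<B}) (\<lambda>_. Y)"
  let ?m = "mix pre col suf (q * B)"
  show "real M * log 2 (real (card Y) / real L) / (2 * real (q + 1) * real R) \<le> real s"
  proof (rule ccontr)
    assume "\<not> ?thesis"
    then have large: "2 * real (q + 1) * real R * real s < real M * log 2 (real (card Y) / real L)"
      using R mult_pos_pos[of "2 * real (q + 1)" "real R"] by (simp add: pos_divide_le_eq mult.commute)
    have "card Y \<noteq> 0" using Y(2) L by linarith
    then have X: "finite ?X" "?X \<noteq> {}"
      using Y(1) by (auto intro: finite_PiE simp: PiE_eq_empty_iff)
    have "\<exists>T v. T \<subseteq> ?X \<and> T \<noteq> {} \<and> card ?X \<le> card T * 2 ^ (s * (q * B + 1) * R) \<and>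
        (\<forall>z. (\<forall>c<q * B. z c \<in> T) \<longrightarrow> run A R (?m z) = v)"
      by (rule mixing[OF A(1) X S(1,2)]) (rule S(3))
    then obtain T v where T: "T \<subseteq> ?X" "T \<noteq> {}" "card ?X \<le> card T * 2 ^ (s * (q * B + 1) * R)"
      and v: "\<And>z. (\<forall>c<q * B. z c \<in> T) \<Longrightarrow> run A R (?m z) = v"
      by (elim exE conjE) (rule that, auto)
    have "card ?X = card Y ^ (M * B)" by (simp add: card_PiE)
    then obtain \<rho> where \<rho>: "\<rho> < M" "B < 2 * card (rich_blocks B L \<rho> T)"
      using rich_row[OF Y L B T(1,2) _ large] T(3) by auto
    from yes[OF \<rho>(1) T(1,2) \<rho>(2)] obtain z where
      z: "\<forall>c<q * B. z c \<in> T" "l' \<le> real (LNST (?m z) t)" by blast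
    have S': "set (?m z) \<subseteq> S" if "\<forall>c<q * B. z c \<in> ?X" for z
      using S that by (intro set_mix_subset) auto
    \<comment> \<open>One member of \<open>T\<close> used in all columns bounds the common answer
      \<open>v\<close> from above, and the mixed input bounds it from below.\<close>
    obtain x where x: "x \<in> T" using T by blast
    have "v \<le> (1 + \<epsilon>) * real (LNST (?m (\<lambda>_. x)) t)"
      using A(2) n[of "\<lambda>_. x"] S'[of "\<lambda>_. x"] v[of "\<lambda>_. x"] x T(1)
      unfolding approximates_LNST_def by auto
    also have "\<dots> \<le> (1 + \<epsilon>) * real l"
      using no x T(1) eps by (intro mult_left_mono) auto
    also have "\<dots> < l'" by (rule gap)
    also have "\<dots> \<le> real (LNST (?m z) t)" by (rule z)
    also have "\<dots> \<le> v"
    proof -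
      have "\<forall>c<q * B. z c \<in> ?X" using z T(1) by blast
      then show ?thesis
        using A(2) n[of z] S'[of z] v[OF z(1)] unfolding approximates_LNST_def by auto
    qed
    finally show False by simp
  qed
qed

section \<open>Renaming the alphabet\<close>

lemma admissible_map_iff:
  assumes "strict_mono_on A e" "set y \<subseteq> A"
  shows "admissible t (map e y) \<longleftrightarrow> admissible t y"
proof -
  have inj: "inj_on e A" using assms(1) by (rule strict_mono_on_imp_inj_on)
  have "sorted (map e y) \<longleftrightarrow> sorted y"
    using assms(2) by (induction y) (auto simp: strict_mono_on_less_eq[OF assms(1)] subset_iff)
  moreover have count: "count_list (map e y) (e a) = count_list y a" if "a \<in> A" for a
    using assms(2) that inj by (induction y) (auto simp: inj_on_def)
  have "(\<forall>a. count_list (map e y) a \<le> t) \<longleftrightarrow> (\<forall>a. count_list y a \<le> t)"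
  proof (intro iffI allI)
    fix a assume *: "\<forall>a. count_list (map e y) a \<le> t"
    show "count_list y a \<le> t"
    proof (cases "a \<in> set y")
      case True
      then show ?thesis using count[of a] * assms(2) by (metis subsetD)
    qed (simp add: count_list_0_iff)
  next
    fix a assume *: "\<forall>a. count_list y a \<le> t"
    show "count_list (map e y) a \<le> t"
    proof (cases "a \<in> e ` set y")
      case True
      then show ?thesis using count * assms(2) by (metis imageE subsetD)
    qed (simp add: count_list_0_iff)
  qed
  ultimately show ?thesis by (simp add: admissible_def)
qed

lemma LNST_map:
  assumes "strict_mono_on A e" "set x \<subseteq> A"
  shows "LNST (map e x) t = LNST x t"
proof (rule antisym)
  show "LNST (map e x) t \<le> LNST x t"
  proof (rule LNST_le)
    fix y assume y: "subseq y (map e x)" "admissible t y"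
    then obtain N where N: "y = map e (nths x N)" by (auto simp: subseq_conv_nths nths_map)
    have sub: "subseq (nths x N) x" by (auto simp: subseq_conv_nths)
    then have "set (nths x N) \<subseteq> A" using assms(2) subseq_set_subset by blast
    then have "admissible t (nths x N)" using y N admissible_map_iff[OF assms(1)] by simp
    from LNST_ge[OF sub this] show "length y \<le> LNST x t" using N by simp
  qed
  show "LNST x t \<le> LNST (map e x) t"
  proof (rule LNST_le)
    fix y assume y: "subseq y x" "admissible t y"
    then have "subseq (map e y) (map e x)" by (auto simp: subseq_conv_nths nths_map)
    moreover have "admissible t (map e y)"
      using y(2) admissible_map_iff[OF assms(1) order_trans[OF subseq_set_subset[OF y(1)] assms(2)]]
      by simp
    ultimately show "length y \<le> LNST (map e x) t" using LNST_ge by fastforce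
  qed
qed

text \<open>Reading the rank \<open>i\<close> as the element of \<open>S\<close> with that rank
  turns an algorithm for \<open>S\<close> into one for ranks with the same memory, because the
  translation happens within a single step. So initial segments of the naturals suffice.\<close>

lemma space_ge_of_nat_alphabet:
  fixes S :: "'a::linorder set"
  assumes S: "finite S" and space: "LNST_space_ge {..<card S} n t \<epsilon> R b"
  shows "LNST_space_ge S n t \<epsilon> R b"
  unfolding LNST_space_ge_def
proof (intro allI impI, elim conjE)
  fix A s assume A: "uses_space A S s" "approximates_LNST A S n t \<epsilon> R"
  define e where "e i = sorted_list_of_set S ! i" for i
  have mono: "strict_mono_on {..<card S} e"
    unfolding e_def
    by (rule strict_mono_onI) (use S in \<open>auto intro: sorted_wrt_nth_less[OF strict_sorted_list_of_set]\<close>)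
  have eS: "e i \<in> S" if "i < card S" for i
    using that S nth_mem[of i "sorted_list_of_set S"] by (simp add: e_def)
  define A' where "A' = \<lparr>start = start A, read_symbol = (\<lambda>m i. read_symbol A m (e i)),
    end_pass = end_pass A, answer = answer A\<rparr>"
  have foldl: "foldl (read_symbol A') m x = foldl (read_symbol A) m (map e x)" for m x
    by (induction x arbitrary: m) (auto simp: A'_def)
  have "run_pass A' x = run_pass A (map e x)" for x
    by (rule ext) (simp add: run_pass_def foldl, simp add: A'_def)
  then have run: "run A' R x = run A R (map e x)" for x
    by (simp add: run_def, simp add: A'_def)
  have "uses_space A' {..<card S} s"
    using A(1) eS by (auto simp: uses_space_def A'_def)
  moreover have "approximates_LNST A' {..<card S} n t \<epsilon> R"
    unfolding approximates_LNST_def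
  proof (intro allI impI)
    fix x :: "nat list" assume x: "set x \<subseteq> {..<card S} \<and> length x = n"
    then have "set (map e x) \<subseteq> S" "length (map e x) = n" using eS by auto
    then show "real (LNST x t) \<le> run A' R x \<and> run A' R x \<le> (1 + \<epsilon>) * real (LNST x t)"
      using A(2) x LNST_map[OF mono, of x t] unfolding approximates_LNST_def run by metis
  qed
  ultimately show "b \<le> real s" using space unfolding LNST_space_ge_def by blast
qed

lemma space_ge_mono: "LNST_space_ge S n t \<epsilon> R b \<Longrightarrow> b' \<le> b \<Longrightarrow> LNST_space_ge S n t \<epsilon> R b'"
  unfolding LNST_space_ge_def by force

section \<open>Arrays with additive cells\<close>

text \<open>
  In the cell of row \<open>\<rho>\<close> and block \<open>b\<close> with content \<open>y\<close>, column \<open>b * q + i\<close> has \<open>g y i\<close> copies of a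
  symbol of the main row \<open>\<rho> * (q + 1) + q\<close>, and is filled up to length \<open>D\<close> with a symbol of the
  row \<open>\<rho> * (q + 1) + i\<close>, which occurs nowhere else in that block.
\<close>

definition array_col ::
  "nat \<Rightarrow> nat \<Rightarrow> nat \<Rightarrow> ('y \<Rightarrow> nat \<Rightarrow> nat) \<Rightarrow> (nat \<Rightarrow> nat \<Rightarrow> nat) \<Rightarrow> nat \<Rightarrow> (nat \<times> nat \<Rightarrow> 'y) \<Rightarrow> nat list"
  where
  "array_col q M D g smb c x = concat (map (\<lambda>\<rho>.
     replicate (g (x (\<rho>, c div q)) (c mod q)) (smb (\<rho> * (q + 1) + q) c) @
     replicate (D - g (x (\<rho>, c div q)) (c mod q)) (smb (\<rho> * (q + 1) + c mod q) c)) [0..<M])"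

text \<open>Within a block, a level of \<open>r\<close> meets at most one main row, which
  contributes the sum of \<open>g y i\<close> over the columns, or one filler row, which occurs in a
  single column. The offset \<open>\<beta>\<close> allows rows to move up from block to
  block.\<close>

lemma array_col_row_le:
  fixes r :: "nat \<Rightarrow> nat"
  assumes q: "1 \<le> q" and b: "b < B"
    and g: "\<And>y i. y \<in> Y \<Longrightarrow> i < q \<Longrightarrow> g y i \<le> D" "\<And>y. y \<in> Y \<Longrightarrow> (\<Sum>i<q. g y i) \<le> D"
    and r: "\<And>i c. i < M * (q + 1) \<Longrightarrow> c < q * B \<Longrightarrow> r (smb i c) = i + \<beta> (c div q)"
    and x: "\<And>\<rho> b. \<rho> < M \<Longrightarrow> b < B \<Longrightarrow> x (\<rho>, b) \<in> Y"
  shows "length (filter (\<lambda>v. r v = j) (concat (map (\<lambda>i. array_col q M D g smb (b * q + i) x) [0..<q]))) \<le> D"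
proof -
  \<comment> \<open>The level \<open>j\<close> belongs to array row \<open>\<rho>0\<close>, as its
    main row if \<open>i0 = q\<close> and as the filler row of column \<open>i0\<close> otherwise.
    The guard \<open>\<beta> b \<le> j\<close> below makes the truncated subtraction exact.\<close>
  define \<rho>0 where "\<rho>0 = (j - \<beta> b) div (q + 1)"
  define i0 where "i0 = (j - \<beta> b) mod (q + 1)"
  let ?G = "\<lambda>\<rho> i. g (x (\<rho>, b)) i"
  have row: "\<rho> * (q + 1) + i + \<beta> b = j \<longleftrightarrow> \<beta> b \<le> j \<and> \<rho> = \<rho>0 \<and> i = i0" if "i < q + 1" for \<rho> i
  proof
    assume *: "\<rho> * (q + 1) + i + \<beta> b = j"
    then have "j - \<beta> b = i + \<rho> * (q + 1)" by simp
    then have "\<rho> = \<rho>0" "i = i0" using that unfolding \<rho>0_def i0_def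
      by (simp_all only: div_mult_self1 mod_mult_self1 div_less mod_less add_0_right)
    then show "\<beta> b \<le> j \<and> \<rho> = \<rho>0 \<and> i = i0" using * by auto
  next
    assume *: "\<beta> b \<le> j \<and> \<rho> = \<rho>0 \<and> i = i0"
    then have "\<rho> * (q + 1) + i = j - \<beta> b"
      using div_mult_mod_eq[of "j - \<beta> b" "q + 1"] unfolding \<rho>0_def i0_def by metis
    then show "\<rho> * (q + 1) + i + \<beta> b = j" using * by linarith
  qed
  have sum: "length (filter (\<lambda>v. r v = j) (concat (map (\<lambda>i. array_col q M D g smb (b * q + i) x) [0..<q])))
     = (\<Sum>i<q. \<Sum>\<rho><M. (if \<beta> b \<le> j \<and> \<rho> = \<rho>0 \<and> q = i0 then ?G \<rho> i else 0)
                   + (if \<beta> b \<le> j \<and> \<rho> = \<rho>0 \<and> i = i0 then D - ?G \<rho> i else 0))"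
    unfolding length_filter_concat_map_upt
  proof (rule sum.cong[OF refl])
    fix i assume "i \<in> {..<q}"
    then have i: "i < q" by simp
    have c: "b * q + i < q * B"
    proof -
      have "b * q + i < (b + 1) * q" using i by simp
      also have "\<dots> \<le> B * q" using b by (intro mult_le_mono1) simp
      finally show ?thesis by (simp add: mult.commute)
    qed
    have dm: "(b * q + i) div q = b" "(b * q + i) mod q = i" using i by auto
    show "length (filter (\<lambda>v. r v = j) (array_col q M D g smb (b * q + i) x))
      = (\<Sum>\<rho><M. (if \<beta> b \<le> j \<and> \<rho> = \<rho>0 \<and> q = i0 then ?G \<rho> i else 0)
                   + (if \<beta> b \<le> j \<and> \<rho> = \<rho>0 \<and> i = i0 then D - ?G \<rho> i else 0))"
      unfolding array_col_def length_filter_concat_map_upt dm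
    proof (rule sum.cong[OF refl])
      fix \<rho> assume "\<rho> \<in> {..<M}"
      then have "\<rho> + 1 \<le> M" by simp
      then have "(\<rho> + 1) * (q + 1) \<le> M * (q + 1)" by (rule mult_le_mono1)
      then have lt: "\<rho> * (q + 1) + q < M * (q + 1)" "\<rho> * (q + 1) + i < M * (q + 1)" using i by auto
      show "length (filter (\<lambda>v. r v = j)
          (replicate (?G \<rho> i) (smb (\<rho> * (q + 1) + q) (b * q + i)) @
           replicate (D - ?G \<rho> i) (smb (\<rho> * (q + 1) + i) (b * q + i))))
        = (if \<beta> b \<le> j \<and> \<rho> = \<rho>0 \<and> q = i0 then ?G \<rho> i else 0)
          + (if \<beta> b \<le> j \<and> \<rho> = \<rho>0 \<and> i = i0 then D - ?G \<rho> i else 0)"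
        using row[of q \<rho>] row[of i \<rho>] i
        by (simp only: filter_append length_append filter_replicate r[OF lt(1) c] r[OF lt(2) c] dm) auto
    qed
  qed
  show ?thesis
  proof (cases "\<beta> b \<le> j \<and> \<rho>0 < M")
    case False
    then show ?thesis unfolding sum by (auto intro!: le_trans[OF eq_imp_le[OF sum.neutral]])
  next
    case True
    then have Y: "x (\<rho>0, b) \<in> Y" using x b by simp
    have inner: "(\<Sum>\<rho><M. (if \<beta> b \<le> j \<and> \<rho> = \<rho>0 \<and> q = i0 then ?G \<rho> i else 0)
                   + (if \<beta> b \<le> j \<and> \<rho> = \<rho>0 \<and> i = i0 then D - ?G \<rho> i else 0))
        = (if q = i0 then ?G \<rho>0 i else 0) + (if i = i0 then D - ?G \<rho>0 i else 0)" for i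
    proof -
      have "(\<Sum>\<rho><M. (if \<beta> b \<le> j \<and> \<rho> = \<rho>0 \<and> q = i0 then ?G \<rho> i else 0)
                   + (if \<beta> b \<le> j \<and> \<rho> = \<rho>0 \<and> i = i0 then D - ?G \<rho> i else 0))
         = (\<Sum>\<rho><M. if \<rho> = \<rho>0 then (if q = i0 then ?G \<rho>0 i else 0) + (if i = i0 then D - ?G \<rho>0 i else 0) else 0)"
        using True by (intro sum.cong) auto
      then show ?thesis using True by (simp add: sum.delta)
    qed
    show ?thesis
    proof (cases "i0 = q")
      case True
      then have "i \<noteq> i0" if "i < q" for i using that by simp
      then show ?thesis unfolding sum inner using True g(2)[OF Y] by simp
    next
      case False
      then have "(\<Sum>i<q. (if q = i0 then ?G \<rho>0 i else 0) + (if i = i0 then D - ?G \<rho>0 i else 0))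
          = (\<Sum>i<q. if i = i0 then D - ?G \<rho>0 i0 else 0)"
        by (intro sum.cong) auto
      also have "\<dots> \<le> D" by (simp add: sum.delta)
      finally show ?thesis unfolding sum inner .
    qed
  qed
qed

text \<open>\<open>V\<close> bounds the key and so the number of row changes, which limits a genuine
  input to \<open>D * (B + V)\<close>. \<open>sel\<close> is the combinatorial core that an instance
  has to supply: from the contents \<open>A\<close> that \<open>T\<close> allows in a cell, one
  content per column is chosen so that a block yields \<open>d0\<close>, and \<open>d1\<close> if it
  is rich. With half of the blocks rich, \<open>gap\<close> compares the two totals.\<close>

lemma array_space_ge:
  fixes r :: "nat \<Rightarrow> nat" and Y :: "'y set" and B D V J p l m n t d0 d1 :: nat and \<epsilon> :: real
  assumes Y: "finite Y" "L \<le> card Y" and L: "1 \<le> L" and B: "1 \<le> B" and R: "1 \<le> R"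
    and q: "1 \<le> q" and eps: "0 < \<epsilon>"
    and g: "\<And>y i. y \<in> Y \<Longrightarrow> i < q \<Longrightarrow> g y i \<le> D" "\<And>y. y \<in> Y \<Longrightarrow> (\<Sum>i<q. g y i) \<le> D"
    and r: "mono r" "\<And>i c. i < M * (q + 1) \<Longrightarrow> c < q * B \<Longrightarrow> r (smb i c) = i + \<beta> (c div q)"
      "\<And>v. v < v0 \<Longrightarrow> r v \<le> V"
    and smb: "\<And>i c. i < M * (q + 1) \<Longrightarrow> c < q * B \<Longrightarrow> smb i c < v0"
      "\<And>i c c'. c \<le> c' \<Longrightarrow> c' < q * B \<Longrightarrow> smb i c \<le> smb i c'"
    and count: "\<And>i a. card {c. c < q * B \<and> smb i c = a} * D \<le> t"
    and pad: "v0 + J \<le> m" "l \<le> J * p" "p \<le> D * (B + V) \<or> t \<le> D * (B + V)"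
    and n: "n = l + q * B * (M * D)"
    and sel: "\<And>A. A \<subseteq> Y \<Longrightarrow> A \<noteq> {} \<Longrightarrow> \<exists>s. (\<forall>i<q. s i \<in> A) \<and> d0 \<le> (\<Sum>i<q. g (s i) i) \<and>
      (L < card A \<longrightarrow> d1 \<le> (\<Sum>i<q. g (s i) i))"
    and gap: "d0 \<le> d1" "(1 + \<epsilon>) * real (D * (B + V)) < real d0 * real B + (real d1 - real d0) * real B / 2"
  shows "LNST_space_ge {..<m} n t \<epsilon> R (real M * log 2 (real (card Y) / real L) / (2 * real (q + 1) * real R))"
proof (rule space_ge_if_rich_gap[where pre = "padding v0 J p l" and suf = "[]"
      and col = "array_col q M D g smb" and l = "D * (B + V)"
      and l' = "real d0 * real B + (real d1 - real d0) * real B / 2"])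
  let ?X = "PiE ({..<M} \<times> {..<B}) (\<lambda>_. Y)"
  let ?col = "array_col q M D g smb"
  have div: "c div q < B" "c mod q < q" if "c < q * B" for c
    using that q by (auto simp: less_mult_imp_div_less mult.commute)
  have row: "\<rho> * (q + 1) + i < M * (q + 1)" if "\<rho> < M" "i \<le> q" for \<rho> i
  proof -
    have "(\<rho> + 1) * (q + 1) \<le> M * (q + 1)" using that by (intro mult_le_mono1) simp
    then show ?thesis using that by simp
  qed
  have set_col: "set (?col c x) \<subseteq> {..<v0}" if "c < q * B" for c x
  proof -
    have "smb (\<rho> * (q + 1) + q) c < v0" "smb (\<rho> * (q + 1) + c mod q) c < v0" if "\<rho> < M" for \<rho>
      using div[OF \<open>c < q * B\<close>] that \<open>c < q * B\<close> by (intro smb(1) row; simp)+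
    then show ?thesis by (auto simp: array_col_def)
  qed
  show "set (padding v0 J p l) \<subseteq> {..<m}" using set_padding[of v0 J p l] pad(1) by auto
  show "set (?col c x) \<subseteq> {..<m}" if "c < q * B" for c x
    using set_col[OF that] pad(1) by fastforce
  have len_col: "length (?col c x) = M * D" if "c < q * B" "x \<in> ?X" for c x
  proof -
    have "g (x (\<rho>, c div q)) (c mod q) \<le> D" if "\<rho> < M" for \<rho>
      using that div[OF \<open>c < q * B\<close>] \<open>x \<in> ?X\<close> by (intro g) (auto simp: PiE_def Pi_def)
    then show ?thesis by (simp add: array_col_def length_concat_map_upt)
  qed
  show "length (mix (padding v0 J p l) ?col [] (q * B) z) = n" if "\<And>c. c < q * B \<Longrightarrow> z c \<in> ?X" for z
    using len_col that by (simp add: mix_def length_concat_map_upt length_padding[OF pad(2)] n)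
  show "LNST (mix (padding v0 J p l) ?col [] (q * B) (\<lambda>_. x)) t \<le> D * (B + V)" if x: "x \<in> ?X" for x
  proof (rule LNST_le)
    fix y assume y: "subseq y (mix (padding v0 J p l) ?col [] (q * B) (\<lambda>_. x))" "admissible t y"
    let ?blocks = "map (\<lambda>b. concat (map (\<lambda>i. ?col (b * q + i) x) [0..<q])) [0..<B]"
    show "length y \<le> D * (B + V)"
    proof (rule length_le_padding[OF y[unfolded mix_def]])
      show "a < v0" if "a \<in> set (concat (map (\<lambda>c. ?col c x) [0..<q * B]) @ [])" for a
        using that set_col by fastforce
      show "p \<le> D * (B + V) \<or> t \<le> D * (B + V)" by (rule pad(3))
      fix y assume "subseq y (concat (map (\<lambda>c. ?col c x) [0..<q * B]) @ [])" and ad: "admissible t y"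
      then have sub0: "subseq y (concat (map (\<lambda>c. ?col c x) [0..<q * B]))" by simp
      then have sub: "subseq y (concat ?blocks)" by (simp add: concat_map_upt_mult)
      show "length y \<le> D * (B + V)"
      proof (cases "y = []")
        case False
        have "length y + D * r (hd y) \<le> D * (length ?blocks + r (last y))"
        proof (rule length_le_rows_blocks[OF r(1) _ sub ad False])
          fix w \<rho> y assume w: "w \<in> set ?blocks" and y: "subseq y (filter (\<lambda>v. r v = \<rho>) w)"
          from w obtain b where b: "b < B" "w = concat (map (\<lambda>i. ?col (b * q + i) x) [0..<q])" by auto
          have "length (filter (\<lambda>v. r v = \<rho>) w) \<le> D"
            unfolding b(2)
            by (rule array_col_row_le[where Y = Y and \<beta> = \<beta>, OF q b(1)])
              (use g r(2) x in \<open>auto simp: PiE_def Pi_def\<close>)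
          then show "length y \<le> D" using list_emb_length[OF y] by simp
        qed
        moreover have "r (last y) \<le> V"
        proof (rule r(3))
          have "last y \<in> set y" using False by simp
          then have "last y \<in> set (concat (map (\<lambda>c. ?col c x) [0..<q * B]))"
            using subseq_set_subset[OF sub0] by blast
          then show "last y < v0" using set_col by fastforce
        qed
        then have "D * (length ?blocks + r (last y)) \<le> D * (B + V)" by (intro mult_le_mono) auto
        ultimately show ?thesis by linarith
      qed simp
    qed
  qed
  fix \<rho> T assume \<rho>: "\<rho> < M" and T: "T \<subseteq> ?X" "T \<noteq> {}" and rich: "B < 2 * card (rich_blocks B L \<rho> T)"
  let ?A = "\<lambda>b. (\<lambda>x. x (\<rho>, b)) ` T"
  have AY: "?A b \<subseteq> Y" if "b < B" for b using T(1) \<rho> that by (auto simp: PiE_def Pi_def)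
  define Q where "Q b s \<longleftrightarrow> (\<forall>i<q. s i \<in> ?A b) \<and> d0 \<le> (\<Sum>i<q. g (s i) i) \<and>
    (L < card (?A b) \<longrightarrow> d1 \<le> (\<Sum>i<q. g (s i) i))" for b s
  define s where "s b = (SOME s. Q b s)" for b
  have ex: "\<exists>s. Q b s" if "b < B" for b
    unfolding Q_def using sel[OF AY[OF that]] T(2) by simp
  have "Q b (s b)" if "b < B" for b
    unfolding s_def by (rule someI_ex[OF ex[OF that]])
  then have s: "\<And>b i. b < B \<Longrightarrow> i < q \<Longrightarrow> s b i \<in> ?A b"
      "\<And>b. b < B \<Longrightarrow> d0 \<le> (\<Sum>i<q. g (s b i) i)"
      "\<And>b. b < B \<Longrightarrow> L < card (?A b) \<Longrightarrow> d1 \<le> (\<Sum>i<q. g (s b i) i)"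
    by (auto simp: Q_def)
  \<comment> \<open>Only row \<open>\<rho>\<close> has to carry the chosen contents, so any member
    of \<open>T\<close> with the right cell will do.\<close>
  have "\<exists>x\<in>T. x (\<rho>, c div q) = s (c div q) (c mod q)" if "c < q * B" for c
    using s(1)[OF div[OF that]] by auto
  then obtain z where z: "\<And>c. c < q * B \<Longrightarrow> z c \<in> T"
      "\<And>c. c < q * B \<Longrightarrow> z c (\<rho>, c div q) = s (c div q) (c mod q)"
    by metis
  let ?i = "\<rho> * (q + 1) + q"
  let ?G = "\<lambda>c. g (s (c div q) (c mod q)) (c mod q)"
  let ?f = "\<lambda>c. replicate (?G c) (smb ?i c)"
  let ?y = "concat (map ?f [0..<q * B])"
  have "subseq ?y (concat (map (\<lambda>c. ?col c (z c)) [0..<q * B]))"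
  proof (rule subseq_concat_map)
    fix c assume "c \<in> set [0..<q * B]"
    then have c: "c < q * B" by simp
    have "[0..<M] = [0..<\<rho>] @ [\<rho>] @ [Suc \<rho>..<M]"
      using \<rho> upt_add_eq_append[of 0 \<rho> "M - \<rho>"] by (simp add: upt_conv_Cons)
    then have eq: "?col c (z c) = concat (map (\<lambda>\<rho>.
         replicate (g (z c (\<rho>, c div q)) (c mod q)) (smb (\<rho> * (q + 1) + q) c) @
         replicate (D - g (z c (\<rho>, c div q)) (c mod q)) (smb (\<rho> * (q + 1) + c mod q) c)) [0..<\<rho>])
      @ ?f c @ replicate (D - ?G c) (smb (\<rho> * (q + 1) + c mod q) c) @ concat (map (\<lambda>\<rho>.
         replicate (g (z c (\<rho>, c div q)) (c mod q)) (smb (\<rho> * (q + 1) + q) c) @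
         replicate (D - g (z c (\<rho>, c div q)) (c mod q)) (smb (\<rho> * (q + 1) + c mod q) c)) [Suc \<rho>..<M])"
      unfolding array_col_def using z(2)[OF c] by simp
    show "subseq (?f c) (?col c (z c))"
      unfolding eq by (rule subseq_drop_many, rule subseq_rev_drop_many, rule subseq_order.refl)
  qed
  then have sub: "subseq ?y (mix (padding v0 J p l) ?col [] (q * B) z)"
    by (simp add: mix_def subseq_drop_many)
  have "admissible t ?y"
    unfolding admissible_def
  proof (intro conjI allI)
    have "sorted (concat (map ?f [0..<k])) \<and> (\<forall>v\<in>set (concat (map ?f [0..<k])). \<exists>c<k. v = smb ?i c)"
      if "k \<le> q * B" for k
      using that
    proof (induction k)
      case (Suc k)
      then have "v \<le> smb ?i k" if "v \<in> set (concat (map ?f [0..<k]))" for v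
        using that smb(2)[of _ k ?i] by fastforce
      then show ?case using Suc by (auto simp: sorted_append less_Suc_eq)
    qed simp
    then show "sorted ?y" by blast
    fix a
    have "count_list ?y a = (\<Sum>c<q * B. if smb ?i c = a then ?G c else 0)"
      by (simp add: count_list_concat_map_upt count_list_replicate if_distrib eq_commute[of a])
    also have "\<dots> = (\<Sum>c | c < q * B \<and> smb ?i c = a. ?G c)"
      by (simp add: sum.inter_filter[symmetric])
    also have "\<dots> \<le> (\<Sum>c | c < q * B \<and> smb ?i c = a. D)"
    proof (rule sum_mono)
      fix c assume "c \<in> {c. c < q * B \<and> smb ?i c = a}"
      then have c: "c div q < B" "c mod q < q" using div by auto
      then show "?G c \<le> D" using s(1)[OF c] AY[OF c(1)] by (intro g(1)) blast+
    qed
    also have "\<dots> \<le> t" using count[of ?i a] by simp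
    finally show "count_list ?y a \<le> t" .
  qed
  from LNST_ge[OF sub this] have "length ?y \<le> LNST (mix (padding v0 J p l) ?col [] (q * B) z) t" .
  moreover have "real d0 * real B + (real d1 - real d0) * real B / 2 \<le> real (length ?y)"
  proof -
    have "length ?y = (\<Sum>b<B. \<Sum>i<q. g (s b i) i)"
      unfolding concat_map_upt_mult by (simp add: length_concat_map_upt)
    also have "real \<dots> \<ge> (\<Sum>b<B. real d0 + (if b \<in> rich_blocks B L \<rho> T then real d1 - real d0 else 0))"
      unfolding of_nat_sum[of _ "{..<B}"]
    proof (rule sum_mono)
      fix b assume "b \<in> {..<B}"
      then have b: "b < B" by simp
      have "real d0 \<le> real (\<Sum>i<q. g (s b i) i)" using s(2)[OF b] by (rule of_nat_mono)
      moreover have "real d1 \<le> real (\<Sum>i<q. g (s b i) i)" if "b \<in> rich_blocks B L \<rho> T"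
        using s(3)[OF b] that unfolding rich_blocks_def by (intro of_nat_mono) simp
      ultimately show "real d0 + (if b \<in> rich_blocks B L \<rho> T then real d1 - real d0 else 0)
          \<le> real (\<Sum>i<q. g (s b i) i)" by simp
    qed
    also have "(\<Sum>b<B. real d0 + (if b \<in> rich_blocks B L \<rho> T then real d1 - real d0 else 0))
        = real d0 * real B + (real d1 - real d0) * real (card (rich_blocks B L \<rho> T))"
    proof -
      have "{..<B} \<inter> rich_blocks B L \<rho> T = rich_blocks B L \<rho> T" by (auto simp: rich_blocks_def)
      then show ?thesis by (simp add: sum.distrib sum.inter_restrict[symmetric] mult.commute)
    qed
    also have "(real d1 - real d0) * real (card (rich_blocks B L \<rho> T)) \<ge> (real d1 - real d0) * (real B / 2)"
      using rich gap(1) by (intro mult_left_mono) auto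
    ultimately show ?thesis by (simp add: algebra_simps)
  qed
  ultimately show "\<exists>z. (\<forall>c<q * B. z c \<in> T) \<and> real d0 * real B + (real d1 - real d0) * real B / 2
      \<le> real (LNST (mix (padding v0 J p l) ?col [] (q * B) z) t)"
    using z(1) by (intro exI[of _ z]) force
qed (use Y L B R eps gap in auto)

text \<open>The content of a cell is the index of the one column that holds \<open>w\<close> copies
  of the main symbol; more than \<open>L\<close> of the \<open>2 * L\<close> contents fill more than
  \<open>L\<close> columns at once. Block \<open>b\<close> moves the rows up by \<open>b\<close>, so
  a row has a new symbol in every column, as the threshold demands, while rows share symbols across
  blocks: the alphabet grows with \<open>M * (2 * L + 1) + B\<close> instead of
  \<open>M * B\<close>. As \<open>M * (2 * L + 1) \<le> B\<close>, a genuine input has value at most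
  \<open>3 * w * B\<close>, against at least \<open>(L + 1) * w * B / 2\<close> after mixing; hence
  \<open>6 * (1 + \<epsilon>) \<le> L\<close>.\<close>

lemma one_hot_space_ge:
  fixes L M B w t J p l m n R :: nat and \<epsilon> :: real
  assumes L: "6 * (1 + \<epsilon>) \<le> real L" and eps: "0 < \<epsilon>" and R: "1 \<le> R"
    and B: "1 \<le> B" "M * (2 * L + 1) \<le> B" and w: "1 \<le> w" "w \<le> t"
    and pad: "4 * L * B + J \<le> m" "l \<le> J * p" "p \<le> w * B \<or> t \<le> w * B"
    and n: "n = l + 2 * L * B * (M * w)"
  shows "LNST_space_ge {..<m} n t \<epsilon> R (real M / (2 * real (2 * L + 1) * real R))"
proof -
  have "1 \<le> real L" using L eps by argo
  then have L1: "1 \<le> L" by simp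
  let ?V = "M * (2 * L + 1) + B"
  have "LNST_space_ge {..<m} n t \<epsilon> R
    (real M * log 2 (real (card {..<2 * L}) / real L) / (2 * real (2 * L + 1) * real R))"
  proof (rule array_space_ge[where g = "\<lambda>y i. if y = i then w else 0" and D = w
        and smb = "\<lambda>i c. 2 * L * i + c" and r = "\<lambda>v. v div (2 * L)" and \<beta> = "\<lambda>b. b"
        and V = ?V and ?v0.0 = "2 * L * ?V" and ?d0.0 = 0 and ?d1.0 = "(L + 1) * w" and q = "2 * L"
        and B = B and J = J and p = p and l = l])
    show "(\<Sum>i<2 * L. if y = i then w else 0) \<le> w" if "y \<in> {..<2 * L}" for y
      by (simp add: sum.delta)
    show "mono (\<lambda>v. v div (2 * L))" by (simp add: monoI div_le_mono)
    show "(2 * L * i + c) div (2 * L) = i + c div (2 * L)" for i c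
      using L1 by simp
    show "v div (2 * L) \<le> ?V" if "v < 2 * L * ?V" for v
      using that by (metis less_mult_imp_div_less mult.commute less_imp_le)
    show "2 * L * i + c < 2 * L * ?V" if "i < M * (2 * L + 1)" "c < 2 * L * B" for i c
    proof -
      have "2 * L * i + c < 2 * L * i + 2 * L * B" using that by simp
      also have "\<dots> = 2 * L * (i + B)" by (simp add: algebra_simps)
      also have "\<dots> \<le> 2 * L * ?V" using that by (intro mult_le_mono2) simp
      finally show ?thesis .
    qed
    show "card {c. c < 2 * L * B \<and> 2 * L * i + c = a} * w \<le> t" for i a
    proof -
      have "card {c. c < 2 * L * B \<and> 2 * L * i + c = a} \<le> card {a - 2 * L * i}"
        by (rule card_mono) auto
      then have "card {c. c < 2 * L * B \<and> 2 * L * i + c = a} * w \<le> 1 * w"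
        by (intro mult_le_mono1) simp
      then show ?thesis using w by linarith
    qed
    have V: "?V \<le> 2 * B" using B by simp
    have "2 * L * ?V \<le> 2 * L * (2 * B)" using V by (intro mult_le_mono2)
    also have "\<dots> = 4 * L * B" by simp
    finally show "2 * L * ?V + J \<le> m" using pad(1) by linarith
    have "w * B \<le> w * (B + ?V)" by simp
    then show "p \<le> w * (B + ?V) \<or> t \<le> w * (B + ?V)" using pad(3) by linarith
    show "\<exists>s. (\<forall>i<2 * L. s i \<in> A) \<and> 0 \<le> (\<Sum>i<2 * L. if s i = i then w else 0) \<and>
      (L < card A \<longrightarrow> (L + 1) * w \<le> (\<Sum>i<2 * L. if s i = i then w else 0))"
      if A: "A \<subseteq> {..<2 * L}" "A \<noteq> {}" for A
    proof -
      obtain a where a: "a \<in> A" using A by blast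
      let ?s = "\<lambda>i. if i \<in> A then i else a"
      have "(L + 1) * w \<le> (\<Sum>i<2 * L. if ?s i = i then w else 0)" if "L < card A"
      proof -
        have "(L + 1) * w \<le> card A * w" using that by (intro mult_le_mono1) simp
        also have "\<dots> = (\<Sum>i\<in>A. if ?s i = i then w else 0)" by simp
        also have "\<dots> \<le> (\<Sum>i<2 * L. if ?s i = i then w else 0)"
          using A by (intro sum_mono2) auto
        finally show ?thesis .
      qed
      then show ?thesis using a by (intro exI[of _ ?s]) auto
    qed
    have "(1 + \<epsilon>) * real (w * (B + ?V)) \<le> (1 + \<epsilon>) * real (w * (3 * B))"
      using V eps by (intro mult_left_mono of_nat_mono mult_le_mono2) auto
    also have "\<dots> = 6 * (1 + \<epsilon>) * (real w * real B / 2)" by simp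
    also have "\<dots> \<le> real L * (real w * real B / 2)"
      using L by (intro mult_right_mono) auto
    also have "\<dots> < real (L + 1) * (real w * real B / 2)"
      using w B by (intro mult_strict_right_mono) auto
    also have "\<dots> = real 0 * real B + (real ((L + 1) * w) - real 0) * real B / 2" by (simp add: algebra_simps)
    finally show "(1 + \<epsilon>) * real (w * (B + ?V))
        < real 0 * real B + (real ((L + 1) * w) - real 0) * real B / 2" .
  qed (use L1 R B eps pad n in auto)
  then show ?thesis using L1 by simp
qed

text \<open>Content \<open>y\<close> puts \<open>y\<close> copies of the main symbol into the first
  column and \<open>d - y\<close> into the second. Mixing the largest with the smallest available
  content gains at least 1 if there are two of them. The \<open>8 * B\<close> blocks form eight
  phases of \<open>2 * B\<close> columns, and a row has one symbol per phase, used at most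
  \<open>2 * B * d\<close> times. So the \<open>3 * M\<close> rows need only \<open>24 * M\<close>
  symbols.\<close>

lemma two_column_space_ge:
  fixes d M B t J l m n R :: nat and \<epsilon> :: real
  assumes eps: "0 < \<epsilon>" and R: "1 \<le> R" and B: "1 \<le> B" and t: "2 * B * d \<le> t"
    and pad: "24 * M + J \<le> m" "l \<le> J * (8 * B * d)"
    and n: "n = l + 16 * B * (M * d)"
    and gap: "(1 + \<epsilon>) * real (d * (8 * B + 3 * M)) < real d * (8 * real B) + 4 * real B"
  shows "LNST_space_ge {..<m} n t \<epsilon> R (real M * log 2 (real (d + 1)) / (6 * real R))"
proof -
  have "LNST_space_ge {..<m} n t \<epsilon> R
    (real M * log 2 (real (card {..d}) / real 1) / (2 * real (2 + 1) * real R))"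
  proof (rule array_space_ge[where g = "\<lambda>y i. if i = 0 then y else d - y" and D = d
        and smb = "\<lambda>i c. 8 * i + c div (2 * B)" and r = "\<lambda>v. v div 8" and \<beta> = "\<lambda>b. 0"
        and V = "3 * M" and ?v0.0 = "24 * M" and ?d0.0 = d and ?d1.0 = "d + 1" and q = 2
        and B = "8 * B" and J = J and p = "8 * B * d" and l = l])
    have phase: "c div (2 * B) < 8" if "c < 2 * (8 * B)" for c
      using that by (intro less_mult_imp_div_less) simp
    show "(\<Sum>i<2. if i = (0::nat) then y else d - y) \<le> d" if "y \<in> {..d}" for y
      using that by (simp add: numeral_2_eq_2)
    show "mono (\<lambda>v::nat. v div 8)" by (simp add: monoI div_le_mono)
    show "(8 * i + c div (2 * B)) div 8 = i + 0" if "c < 2 * (8 * B)" for i c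
      using phase[OF that] by simp
    show "v div 8 \<le> 3 * M" if "v < 24 * M" for v
      using that by linarith
    show "8 * i + c div (2 * B) < 24 * M" if "i < M * (2 + 1)" "c < 2 * (8 * B)" for i c
    proof -
      have "i < 3 * M" using that(1) by simp
      then show ?thesis using phase[OF that(2)] by linarith
    qed
    show "8 * i + c div (2 * B) \<le> 8 * i + c' div (2 * B)" if "c \<le> c'" for i c c'
      using that by (simp add: div_le_mono)
    show "card {c. c < 2 * (8 * B) \<and> 8 * i + c div (2 * B) = a} * d \<le> t" for i a
    proof -
      let ?k = "a - 8 * i"
      have "{c. c < 2 * (8 * B) \<and> 8 * i + c div (2 * B) = a} \<subseteq> {?k * (2 * B)..<?k * (2 * B) + 2 * B}"
      proof
        fix c assume "c \<in> {c. c < 2 * (8 * B) \<and> 8 * i + c div (2 * B) = a}"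
        then have "?k = c div (2 * B)" by auto
        then show "c \<in> {?k * (2 * B)..<?k * (2 * B) + 2 * B}"
          using div_mult_mod_eq[of c "2 * B"] mod_less_divisor[of "2 * B" c] B
          by (simp only: atLeastLessThan_iff) linarith
      qed
      from card_mono[OF _ this] have "card {c. c < 2 * (8 * B) \<and> 8 * i + c div (2 * B) = a} \<le> 2 * B"
        by simp
      then have "card {c. c < 2 * (8 * B) \<and> 8 * i + c div (2 * B) = a} * d \<le> 2 * B * d"
        by (rule mult_le_mono1)
      then show ?thesis using t by linarith
    qed
    have "8 * B * d \<le> d * (8 * B + 3 * M)" by (simp add: algebra_simps)
    then show "8 * B * d \<le> d * (8 * B + 3 * M) \<or> t \<le> d * (8 * B + 3 * M)" ..
    show "\<exists>s. (\<forall>i<2. s (i::nat) \<in> A) \<and> d \<le> (\<Sum>i<2. if i = (0::nat) then s i else d - s i) \<and>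
      (1 < card A \<longrightarrow> d + 1 \<le> (\<Sum>i<2. if i = (0::nat) then s i else d - s i))"
      if A: "A \<subseteq> {..d}" "A \<noteq> {}" for A
    proof -
      have fin: "finite A" using A finite_subset by blast
      let ?s = "\<lambda>i::nat. if i = 0 then Max A else Min A"
      have in_A: "Max A \<in> A" "Min A \<in> A" using fin A by auto
      then have le: "Max A \<le> d" "Min A \<le> d" using A(1) by (auto simp del: Max_in Min_in)
      have le': "Min A \<le> Max A" using in_A fin by simp
      have "Min A < Max A" if "1 < card A"
      proof (rule ccontr)
        assume "\<not> Min A < Max A"
        then have "x = Max A" if "x \<in> A" for x
          using that fin Min_le[of A x] Max_ge[of A x] le' by linarith
        then have "A \<subseteq> {Max A}" by blast
        from card_mono[OF _ this] show False using \<open>1 < card A\<close> by simp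
      qed
      then show ?thesis using le le' in_A by (intro exI[of _ ?s]) (auto simp: numeral_2_eq_2)
    qed
    show "(1 + \<epsilon>) * real (d * (8 * B + 3 * M))
        < real d * real (8 * B) + (real (d + 1) - real d) * real (8 * B) / 2"
      using gap by simp
  qed (use R B eps pad n in auto)
  then show ?thesis by simp
qed

section \<open>Constant approximation factors\<close>

text \<open>Single copies are used, and \<open>B = M * P\<close> is just enough to outweigh the row
  changes. Then the alphabet grows like \<open>M\<close> and the length like \<open>M ^ 2\<close>,
  so \<open>M\<close> may be of order \<open>min (sqrt n) m\<close>. One padding symbol suffices,
  since only \<open>t\<close> copies of it count. Uniformity in \<open>t \<le> T0\<close> and
  \<open>\<epsilon> \<le> E\<close> is needed in
  \<open>inverse_eps_threshold_space_ge\<close>.\<close>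

lemma constant_threshold_space_ge:
  fixes T0 :: nat and E :: real
  assumes E: "0 < E"
  shows "\<exists>c>0. \<exists>N. \<forall>n m R t \<epsilon>. N \<le> n \<and> N \<le> m \<and> 1 \<le> R \<and> 1 \<le> t \<and> t \<le> T0 \<and> 0 < \<epsilon> \<and> \<epsilon> \<le> E \<longrightarrow>
    LNST_space_ge {..<m} n t \<epsilon> R (c * (min (sqrt (real n)) (real m) / real R))"
proof -
  define L where "L = nat \<lceil>6 * (1 + E)\<rceil>"
  define P where "P = 2 * L + 1"
  define K where "K = 4 * P\<^sup>2"
  have LE: "6 * (1 + E) \<le> real L" unfolding L_def by linarith
  have P: "1 \<le> P" "2 * L \<le> P" by (auto simp: P_def)
  then have K: "1 \<le> K" by (simp add: K_def)
  let ?c = "1 / (2 * real K * (2 * real P))"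
  have "LNST_space_ge {..<m} n t \<epsilon> R (?c * (min (sqrt (real n)) (real m) / real R))"
    if N: "(K * (T0 + 1))\<^sup>2 \<le> n" "(K * (T0 + 1))\<^sup>2 \<le> m" and R: "1 \<le> R" and t: "1 \<le> t" "t \<le> T0"
      and eps: "0 < \<epsilon>" "\<epsilon> \<le> E" for n m R t \<epsilon>
  proof -
    define x where "x = min (sqrt (real n)) (real m)"
    define M where "M = nat \<lfloor>x / real K\<rfloor>"
    define l where "l = n - 2 * L * (M * P) * (M * 1)"
    have "real (K * (T0 + 1)) \<le> x"
    proof -
      have "sqrt (real ((K * (T0 + 1))\<^sup>2)) \<le> sqrt (real n)"
        using N(1) by (intro real_sqrt_le_mono of_nat_mono)
      then have "real (K * (T0 + 1)) \<le> sqrt (real n)" by (simp add: real_sqrt_power)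
      moreover have "K * (T0 + 1) \<le> (K * (T0 + 1))\<^sup>2" by (simp add: power2_eq_square)
      then have "real (K * (T0 + 1)) \<le> real m" using N(2) by linarith
      ultimately show ?thesis by (simp add: x_def)
    qed
    then have xK: "real (T0 + 1) \<le> x / real K" using K by (simp add: field_simps)
    have M_le: "real M \<le> x / real K" using xK by (simp add: M_def)
    have M_ge: "x / real K < real M + 1" using xK unfolding M_def by linarith
    have TM: "T0 + 1 \<le> M" using xK unfolding M_def by (simp add: le_nat_floor)
    have KM: "real (K * M) \<le> x" using M_le K by (simp add: field_simps)
    then have "real (K * M) \<le> sqrt (real n)" by (simp add: x_def)
    then have "(real (K * M))\<^sup>2 \<le> real n" by (simp add: sqrt_ge_absD)
    then have "(K * M)\<^sup>2 \<le> n" by (metis of_nat_le_iff of_nat_power)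
    moreover have "2 * L * (M * P) * (M * 1) \<le> (K * M)\<^sup>2"
    proof -
      have "2 * L * (M * P) * (M * 1) \<le> P * (M * P) * (M * 1)" using P by (intro mult_le_mono1)
      also have "\<dots> = P\<^sup>2 * M\<^sup>2" by (simp add: power2_eq_square)
      also have "\<dots> \<le> K * M\<^sup>2" by (intro mult_le_mono1) (simp add: K_def)
      also have "\<dots> \<le> K * K * M\<^sup>2" using K by simp
      finally show ?thesis by (simp add: power2_eq_square algebra_simps)
    qed
    ultimately have "2 * L * (M * P) * (M * 1) \<le> n" by linarith
    then have n: "n = l + 2 * L * (M * P) * (M * 1)" by (simp add: l_def)
    have "real (K * M) \<le> real m" using KM by (simp add: x_def)
    then have "K * M \<le> m" by linarith
    moreover have "4 * L * (M * P) + 1 \<le> K * M"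
    proof -
      have "4 * L * (M * P) + 1 = 2 * L * (2 * (M * P)) + 1" by simp
      also have "\<dots> \<le> P * (2 * (M * P)) + 1" using P by (intro add_mono mult_le_mono1) auto
      also have "\<dots> = 2 * P\<^sup>2 * M + 1" by (simp add: power2_eq_square)
      also have "\<dots> \<le> K * M"
      proof -
        have "1 \<le> P\<^sup>2 * M" using P TM by simp
        then show ?thesis by (simp add: K_def)
      qed
      finally show ?thesis .
    qed
    ultimately have m: "4 * L * (M * P) + 1 \<le> m" by linarith
    have tM: "t \<le> M * P"
    proof -
      have "t \<le> M * 1" using t TM by simp
      also have "\<dots> \<le> M * P" using P by (intro mult_le_mono2)
      finally show ?thesis .
    qed
    have "LNST_space_ge {..<m} n t \<epsilon> R (real M / (2 * real (2 * L + 1) * real R))"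
      by (rule one_hot_space_ge[where B = "M * P" and w = 1 and J = 1 and p = l and l = l])
        (use LE eps R t P TM m n tM in \<open>auto simp: P_def\<close>)
    moreover have "?c * (x / real R) \<le> real M / (2 * real (2 * L + 1) * real R)"
    proof -
      have "x / real K \<le> 2 * real M" using M_ge TM by linarith
      then have "x / real K / 2 / (2 * real P * real R) \<le> real M / (2 * real P * real R)"
        by (intro divide_right_mono) auto
      then show ?thesis unfolding P_def[symmetric] by (simp add: algebra_simps)
    qed
    ultimately show ?thesis unfolding x_def by (rule space_ge_mono)
  qed
  then show ?thesis using K P by (intro exI[of _ ?c] conjI exI[of _ "(K * (T0 + 1))\<^sup>2"]) auto
qed

text \<open>For \<open>\<epsilon> \<le> 1\<close> one can take \<open>L = 12\<close> and
  \<open>B = 25 * M\<close>, so \<open>w\<close> copies per entry make the array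
  \<open>w * W\<close> long with \<open>W = 600 * M ^ 2\<close>. The remainder of \<open>n\<close>
  modulo \<open>W\<close> fits into \<open>24 * M\<close> padding symbols with \<open>25 * M\<close>
  copies each. The array takes \<open>4 * 12 * 25 * M = 1200 * M\<close> symbols, together
  \<open>1224 * M\<close>. The threshold allows \<open>w\<close> copies because
  \<open>m \<le> W\<close>.\<close>

lemma unbounded_threshold_space_ge:
  fixes C :: real
  assumes C: "0 < C"
  shows "\<exists>c>0. \<exists>N. \<forall>n m R t \<epsilon>. N \<le> m \<and> 1 \<le> R \<and> real n / real m \<le> real t \<and> 0 < \<epsilon> \<and> \<epsilon> \<le> 1 \<and>
      (real m)\<^sup>2 \<le> C * real n \<longrightarrow> LNST_space_ge {..<m} n t \<epsilon> R (c * (real m / real R))"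
proof -
  define K where "K = 1224 * (1 + C)"
  have K: "1224 < K" using C by (simp add: K_def)
  define N where "N = nat \<lceil>(2 * K)\<^sup>2\<rceil>"
  let ?c = "1 / (2 * K * 50)"
  have "LNST_space_ge {..<m} n t \<epsilon> R (?c * (real m / real R))"
    if N: "N \<le> m" and R: "1 \<le> R" and t: "real n / real m \<le> real t"
      and eps: "0 < \<epsilon>" "\<epsilon> \<le> 1" and mn: "(real m)\<^sup>2 \<le> C * real n" for n m R t \<epsilon>
  proof -
    have "(2 * K)\<^sup>2 \<le> real N" unfolding N_def by linarith
    then have mK: "(2 * K)\<^sup>2 \<le> real m" using N by linarith
    have "1 * K \<le> (4 * K) * K" using K by (intro mult_right_mono) auto
    then have "K \<le> real m" using mK by (simp add: power2_eq_square)
    define M where "M = nat \<lfloor>real m / K\<rfloor>"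
    have mK1: "1 \<le> real m / K" using \<open>K \<le> real m\<close> K by simp
    have M_le: "real M \<le> real m / K" using mK1 by (simp add: M_def)
    have M_ge: "real m / K < real M + 1" using mK1 unfolding M_def by linarith
    have M1: "1 \<le> M" using mK1 unfolding M_def by (simp add: le_nat_floor)
    have M2: "real m / (2 * K) \<le> real M"
    proof -
      have "real m / K \<le> 2 * real M" using M_ge M1 by linarith
      then show ?thesis using K by (simp add: field_simps)
    qed
    define W where "W = 600 * M\<^sup>2"
    have W1: "1 \<le> W" using M1 by (simp add: W_def)
    have "real W \<le> real n"
    proof -
      have "real W = 600 * (real M)\<^sup>2" by (simp add: W_def)
      also have "\<dots> \<le> 600 * (real m / K)\<^sup>2" using M_le by (intro mult_left_mono power_mono) auto
      also have "\<dots> = 600 / K\<^sup>2 * (real m)\<^sup>2" by (simp add: power_divide)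
      also have "\<dots> \<le> 600 / K\<^sup>2 * (C * real n)" using mn by (intro mult_left_mono) auto
      also have "\<dots> = 600 * C / K\<^sup>2 * real n" by simp
      also have "\<dots> \<le> 1 * real n"
      proof (rule mult_right_mono)
        have "600 * C \<le> K * 1" using C by (simp add: K_def)
        also have "\<dots> \<le> K * K" using K by (intro mult_left_mono) auto
        finally show "600 * C / K\<^sup>2 \<le> 1" using K by (simp add: power2_eq_square)
      qed simp
      finally show ?thesis by simp
    qed
    then have Wn: "W \<le> n" by linarith
    have "real m \<le> real W"
    proof -
      have "real m = real m * 1" by simp
      also have "\<dots> \<le> real m * (600 * (real m / (2 * K)\<^sup>2))"
        using mK K by (intro mult_left_mono) (auto simp: field_simps)
      also have "\<dots> = 600 * (real m / (2 * K))\<^sup>2" by (simp add: power_divide power2_eq_square)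
      also have "\<dots> \<le> 600 * (real M)\<^sup>2" using M2 K by (intro mult_left_mono power_mono) auto
      finally show ?thesis by (simp add: W_def)
    qed
    define w where "w = n div W"
    have w1: "1 \<le> w" using Wn W1 unfolding w_def
      by (metis div_greater_zero_iff less_eq_Suc_le One_nat_def)
    have "real w \<le> real n / real W" unfolding w_def by (rule of_nat_div_le_of_nat)
    also have "\<dots> \<le> real n / real m"
      using \<open>real m \<le> real W\<close> \<open>K \<le> real m\<close> K by (intro divide_left_mono) auto
    also have "\<dots> \<le> real t" by (rule t)
    finally have wt: "w \<le> t" by linarith
    have "1224 * real M \<le> K * real M" using K by (intro mult_right_mono) auto
    also have "\<dots> \<le> real m" using M_le K by (simp add: field_simps)
    finally have m: "1224 * M \<le> m" by linarith
    have "LNST_space_ge {..<m} n t \<epsilon> R (real M / (2 * real (2 * 12 + 1) * real R))"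
    proof (rule one_hot_space_ge[where B = "25 * M" and w = w and J = "24 * M" and p = "25 * M"
          and l = "n mod W"])
      show "n mod W \<le> 24 * M * (25 * M)"
        using mod_less_divisor[of W n] W1 by (simp add: W_def power2_eq_square)
      show "n = n mod W + 2 * 12 * (25 * M) * (M * w)"
      proof -
        have "2 * 12 * (25 * M) * (M * w) = n div W * W" by (simp add: W_def w_def power2_eq_square)
        then show ?thesis using div_mult_mod_eq[of n W] by linarith
      qed
    qed (use eps R M1 w1 wt m in auto)
    moreover have "?c * (real m / real R) \<le> real M / (2 * real (2 * 12 + 1) * real R)"
    proof -
      have "real m / (2 * K) / (50 * real R) \<le> real M / (50 * real R)"
        using M2 by (intro divide_right_mono) auto
      then show ?thesis by (simp add: algebra_simps)
    qed
    ultimately show ?thesis by (rule space_ge_mono)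
  qed
  then show ?thesis using K by (intro exI[of _ ?c] conjI exI[of _ N]) auto
qed

section \<open>Small \<open>\<epsilon>\<close> and unbounded threshold\<close>

text \<open>Mixing gains only 1 per rich block, so the row changes, worth \<open>3 * d * M\<close>,
  must not exceed \<open>B\<close>. As \<open>B\<close> is about \<open>n / (2 * d * m)\<close>,
  this asks for \<open>d ^ 2 * m ^ 2\<close> of order \<open>n\<close>, and the hypothesis on
  \<open>n\<close> permits \<open>d\<close> of order \<open>1 / sqrt \<epsilon>\<close>. The
  logarithm changes only by a constant factor, and \<open>d * \<epsilon>\<close> stays
  small.\<close>

lemma unbounded_threshold_small_eps_space_ge:
  fixes C :: real
  assumes C: "0 < C"
  shows "\<exists>c>0. \<exists>\<epsilon>0>0. \<exists>N. \<forall>n m R t \<epsilon>. N \<le> m \<and> 1 \<le> R \<and> real n / real m \<le> real t \<and> 0 < \<epsilon> \<and> \<epsilon> \<le> \<epsilon>0 \<and>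
      (real m)\<^sup>2 / \<epsilon> \<le> C * real n \<longrightarrow>
      LNST_space_ge {..<m} n t \<epsilon> R (c * (real m * log 2 (1 / \<epsilon>) / real R))"
proof -
  define e where "e = 1 / (4 * (1 + C))"
  have e: "0 < e" "e \<le> 1 / 4" "e * C \<le> 1" "e\<^sup>2 * C \<le> 1"
  proof -
    show e0: "0 < e" "e \<le> 1 / 4" "e * C \<le> 1" using C by (auto simp: e_def field_simps)
    have "e * (e * C) \<le> 1 * 1" using e0 C by (intro mult_mono) auto
    then show "e\<^sup>2 * C \<le> 1" by (simp add: power2_eq_square mult.assoc)
  qed
  define N where "N = nat \<lceil>48 + 4 * C\<rceil>"
  \<comment> \<open>2304 is \<open>96 * 4 * 6\<close>: \<open>m \<le> 96 * M\<close>,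
    \<open>1 / \<epsilon> \<le> (d + 1) ^ 4\<close> because \<open>\<epsilon> \<le> e ^ 4\<close>,
    and 6 from \<open>two_column_space_ge\<close>.\<close>
  have "LNST_space_ge {..<m} n t \<epsilon> R (1 / 2304 * (real m * log 2 (1 / \<epsilon>) / real R))"
    if N: "N \<le> m" and R: "1 \<le> R" and t: "real n / real m \<le> real t"
      and eps: "0 < \<epsilon>" "\<epsilon> \<le> e ^ 4" and mn: "(real m)\<^sup>2 / \<epsilon> \<le> C * real n" for n m R t \<epsilon>
  proof -
    have "48 + 4 * C \<le> real N" unfolding N_def by linarith
    then have Nm: "48 + 4 * C \<le> real m" using N by linarith
    then have m48: "48 \<le> m" using C by linarith
    have e4: "e ^ 4 \<le> e\<^sup>2" using e by (intro power_decreasing) auto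
    have e2: "e\<^sup>2 \<le> 1" using e by (simp add: power_le_one)
    have eps1: "\<epsilon> \<le> 1" "\<epsilon> \<le> e\<^sup>2" using eps e4 e2 by linarith+
    define sq where "sq = sqrt \<epsilon>"
    have sq: "0 < sq" "sq \<le> 1" "sq * sq = \<epsilon>" "sq \<le> e"
    proof -
      show "0 < sq" "sq \<le> 1" "sq * sq = \<epsilon>" using eps eps1 by (auto simp: sq_def)
      show "sq \<le> e" using eps1 e unfolding sq_def by (intro real_le_lsqrt) auto
    qed
    define d where "d = nat \<lfloor>e / sq\<rfloor>"
    have esq: "1 \<le> e / sq" using sq by simp
    have d_le: "real d \<le> e / sq" using esq by (simp add: d_def)
    have d_ge: "e / sq < real d + 1" using esq unfolding d_def by linarith
    have d1: "1 \<le> d" using esq unfolding d_def by (simp add: le_nat_floor)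
    have dsq: "real d * sq \<le> e" using d_le sq by (simp add: field_simps)
    have deps: "real d * \<epsilon> \<le> e"
    proof -
      have "real d * \<epsilon> = real d * sq * sq" using sq by (simp add: mult.assoc)
      also have "\<dots> \<le> e * 1" using dsq sq e by (intro mult_mono) auto
      finally show ?thesis by simp
    qed
    have d2eps: "(real d)\<^sup>2 * \<epsilon> \<le> e\<^sup>2"
    proof -
      have "(real d)\<^sup>2 * \<epsilon> = (real d * sq)\<^sup>2" using sq by (simp add: power2_eq_square algebra_simps)
      also have "\<dots> \<le> e\<^sup>2" using dsq sq by (intro power_mono) auto
      finally show ?thesis .
    qed
    define M where "M = m div 48"
    \<comment> \<open>The largest \<open>B\<close> with \<open>2 * B * d \<le> n / m\<close>, which
      the threshold is known to exceed or equal.\<close>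
    define B where "B = n div (2 * d * m)"
    define J where "J = m div 2"
    define l where "l = n - 16 * B * (M * d)"
    have mn': "real m * real m \<le> C * \<epsilon> * real n" using mn eps by (simp add: field_simps power2_eq_square)
    have M: "48 * M \<le> m" "m < 48 * M + 48" "1 \<le> M" using m48 unfolding M_def by linarith+
    have dm: "0 < 2 * d * m" using d1 m48 by simp
    have big: "4 * real d * real m \<le> real n"
    proof -
      have "C * \<epsilon> * (4 * real d * real m) = 4 * C * (real d * \<epsilon>) * real m" by simp
      also have "\<dots> \<le> 4 * C * e * real m" using deps C by (intro mult_right_mono mult_left_mono) auto
      also have "\<dots> \<le> 4 * real m" using e by (intro mult_right_mono) (auto simp: algebra_simps)
      also have "\<dots> \<le> real m * real m" using m48 by (intro mult_right_mono) auto
      also have "\<dots> \<le> C * \<epsilon> * real n" by (rule mn')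
      finally show ?thesis using C eps by simp
    qed
    have B_le: "2 * d * m * B \<le> n" unfolding B_def by simp
    have B_ge: "n < 2 * d * m * B + 2 * d * m"
      using div_mult_mod_eq[of n "2 * d * m"] mod_less_divisor[OF dm, of n]
      unfolding B_def by (metis add.commute add_less_cancel_right mult.commute)
    have B1: "1 \<le> B"
    proof (rule ccontr)
      assume "\<not> 1 \<le> B"
      then have "B = 0" by simp
      then have "real n < real (2 * d * m)" using B_ge by (simp only: of_nat_less_iff mult_0_right add_0)
      then show False using big dm by (simp add: algebra_simps)
    qed
    have nB: "n \<le> 4 * d * m * B"
    proof -
      have "2 * d * m * 1 \<le> 2 * d * m * B" using B1 by (rule mult_le_mono2)
      then show ?thesis using B_ge by linarith
    qed
    have dMB: "3 * d * M \<le> B"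
    proof -
      have "real m * real m \<le> C * \<epsilon> * real (4 * d * m * B)"
        using mn' nB C eps by (intro order_trans[OF mn'] mult_left_mono of_nat_mono) auto
      then have "real m * real m \<le> (4 * C * \<epsilon> * real d * real B) * real m" by (simp add: algebra_simps)
      then have "real m \<le> 4 * C * \<epsilon> * real d * real B" using m48 by (simp add: mult_le_cancel_right)
      then have "real d * real m \<le> real d * (4 * C * \<epsilon> * real d * real B)" by (rule mult_left_mono) simp
      also have "\<dots> = 4 * C * ((real d)\<^sup>2 * \<epsilon>) * real B" by (simp add: power2_eq_square)
      also have "\<dots> \<le> 4 * C * e\<^sup>2 * real B" using d2eps C by (intro mult_right_mono mult_left_mono) auto
      also have "\<dots> \<le> 4 * real B" using e by (intro mult_right_mono) (auto simp: algebra_simps)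
      finally have "d * m \<le> 4 * B" by (metis of_nat_le_iff of_nat_mult of_nat_numeral)
      moreover have "d * (48 * M) \<le> d * m" using M by (intro mult_le_mono2)
      ultimately show ?thesis by linarith
    qed
    have "LNST_space_ge {..<m} n t \<epsilon> R (real M * log 2 (real (d + 1)) / (6 * real R))"
    proof (rule two_column_space_ge[where B = B and J = J and l = l])
      have "real (2 * B * d) * real m \<le> real n"
        using B_le by (metis mult.assoc mult.commute of_nat_le_iff of_nat_mult)
      then have "real (2 * B * d) \<le> real n / real m" using m48 by (simp add: field_simps)
      then have "real (2 * B * d) \<le> real t" using t by linarith
      then show "2 * B * d \<le> t" by linarith
      show "24 * M + J \<le> m" using M unfolding J_def by linarith
      have "16 * B * (M * d) \<le> n"
      proof -
        have "16 * B * (M * d) \<le> B * d * (48 * M)" by simp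
        also have "\<dots> \<le> B * d * m" using M by (intro mult_le_mono2)
        also have "\<dots> \<le> n" using B_le by (simp add: algebra_simps)
        finally show ?thesis .
      qed
      then show "n = l + 16 * B * (M * d)" by (simp add: l_def)
      \<comment> \<open>The reason for eight phases: rounding leaves \<open>n\<close> as large as
        \<open>4 * d * m * B\<close>, and about \<open>m / 2\<close> padding symbols have to absorb
        the rest of it, each with no more copies than the value \<open>8 * B * d\<close> of a
        row.\<close>
      show "l \<le> J * (8 * B * d)"
      proof -
        have "m \<le> 2 * J + 1" unfolding J_def by linarith
        then have "4 * d * B * m \<le> 4 * d * B * (2 * J + 4 * M)" using M by (intro mult_le_mono2) linarith
        then have "n \<le> 4 * d * B * (2 * J + 4 * M)" using nB by (simp add: algebra_simps)
        then show ?thesis unfolding l_def by (simp add: algebra_simps)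
      qed
      have "3 * M \<le> 3 * d * M" using d1 by simp
      then have MB: "3 * M \<le> B" using dMB by linarith
      have "(1 + \<epsilon>) * real (d * (8 * B + 3 * M))
          = real d * (8 * real B) + real (3 * d * M) + (real d * \<epsilon>) * real (8 * B + 3 * M)"
        by (simp add: algebra_simps)
      also have "\<dots> \<le> real d * (8 * real B) + real B + 1 / 4 * real (9 * B)"
      proof (intro add_mono mult_mono)
        show "real (3 * d * M) \<le> real B" using dMB by (rule of_nat_mono)
        show "real d * \<epsilon> \<le> 1 / 4" using deps e by linarith
        show "real (8 * B + 3 * M) \<le> real (9 * B)" using MB by (intro of_nat_mono) simp
      qed auto
      also have "\<dots> < real d * (8 * real B) + 4 * real B" using B1 by simp
      finally show "(1 + \<epsilon>) * real (d * (8 * B + 3 * M)) < real d * (8 * real B) + 4 * real B" .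
    qed (use eps R B1 in auto)
    moreover have "1 / 2304 * (real m * log 2 (1 / \<epsilon>) / real R)
        \<le> real M * log 2 (real (d + 1)) / (6 * real R)"
    proof -
      have "1 / \<epsilon> \<le> e ^ 4 / \<epsilon>\<^sup>2"
        using eps by (simp add: field_simps power2_eq_square)
      also have "\<dots> = (e / sq) ^ 4"
      proof -
        have "sq ^ 4 = \<epsilon>\<^sup>2" using sq by (metis power2_eq_square power_mult[of sq 2 2] mult_2 numeral_Bit0)
        then show ?thesis by (simp add: power_divide)
      qed
      also have "\<dots> \<le> real (d + 1) ^ 4"
        using d_ge esq by (intro power_mono) auto
      finally have "log 2 (1 / \<epsilon>) \<le> log 2 (real (d + 1) ^ 4)"
        using eps by (subst log_le_cancel_iff) auto
      then have log: "log 2 (1 / \<epsilon>) \<le> 4 * log 2 (real (d + 1))"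
        by (simp add: log_nat_power del: of_nat_add of_nat_Suc)
      have "real m \<le> 96 * real M" using M by linarith
      moreover have "0 \<le> log 2 (1 / \<epsilon>)" using eps eps1 by (simp add: zero_le_log_cancel_iff)
      ultimately have "real m * log 2 (1 / \<epsilon>) \<le> 96 * real M * (4 * log 2 (real (d + 1)))"
        using log by (intro mult_mono) auto
      then have "real m * log 2 (1 / \<epsilon>) / (2304 * real R)
          \<le> 96 * real M * (4 * log 2 (real (d + 1))) / (2304 * real R)"
        by (rule divide_right_mono) simp
      also have "\<dots> = 384 * (real M * log 2 (real (d + 1))) / (384 * (6 * real R))" by simp
      also have "\<dots> = real M * log 2 (real (d + 1)) / (6 * real R)"
        by (rule mult_divide_mult_cancel_left) simp
      finally show ?thesis by simp
    qed
    ultimately show ?thesis by (rule space_ge_mono)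
  qed
  then show ?thesis
    using e by (intro exI[of _ "1 / 2304"] conjI exI[of _ "e ^ 4"] exI[of _ N]) auto
qed

text \<open>Between \<open>\<epsilon>0\<close> and 1 the logarithm is bounded, so the linear bound
  suffices; above 1 it is negative and nothing is claimed.\<close>

lemma unbounded_threshold_log_space_ge:
  fixes C :: real
  assumes C: "0 < C"
  shows "\<exists>c>0. \<exists>N. \<forall>n m R t \<epsilon>. N \<le> m \<and> 1 \<le> R \<and> real n / real m \<le> real t \<and> 0 < \<epsilon> \<and>
      (real m)\<^sup>2 / \<epsilon> \<le> C * real n \<longrightarrow>
      LNST_space_ge {..<m} n t \<epsilon> R (c * (real m * log 2 (1 / \<epsilon>) / real R))"
proof -
  from unbounded_threshold_small_eps_space_ge[OF C] obtain c1 \<epsilon>0 N1 where c1: "0 < c1" "0 < \<epsilon>0"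
    and small: "\<And>n m R t \<epsilon>. N1 \<le> m \<Longrightarrow> 1 \<le> R \<Longrightarrow> real n / real m \<le> real t \<Longrightarrow> 0 < \<epsilon> \<Longrightarrow> \<epsilon> \<le> \<epsilon>0 \<Longrightarrow>
      (real m)\<^sup>2 / \<epsilon> \<le> C * real n \<Longrightarrow>
      LNST_space_ge {..<m} n t \<epsilon> R (c1 * (real m * log 2 (1 / \<epsilon>) / real R))"
    by blast
  from unbounded_threshold_space_ge[OF C] obtain c2 N2 where c2: "0 < c2"
    and large: "\<And>n m R t \<epsilon>. N2 \<le> m \<Longrightarrow> 1 \<le> R \<Longrightarrow> real n / real m \<le> real t \<Longrightarrow> 0 < \<epsilon> \<Longrightarrow> \<epsilon> \<le> 1 \<Longrightarrow>
      (real m)\<^sup>2 \<le> C * real n \<Longrightarrow> LNST_space_ge {..<m} n t \<epsilon> R (c2 * (real m / real R))"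
    by blast
  define K where "K = max 1 (log 2 (1 / \<epsilon>0))"
  define c where "c = min c1 (c2 / K)"
  have K: "1 \<le> K" "log 2 (1 / \<epsilon>0) \<le> K" by (auto simp: K_def)
  have c: "0 < c" "c \<le> c1" "c * K \<le> c2"
  proof -
    show "0 < c" "c \<le> c1" using c1 c2 K by (auto simp: c_def)
    have "c * K \<le> c2 / K * K" using K by (intro mult_right_mono) (auto simp: c_def)
    then show "c * K \<le> c2" using K by simp
  qed
  have "LNST_space_ge {..<m} n t \<epsilon> R (c * (real m * log 2 (1 / \<epsilon>) / real R))"
    if N: "max N1 N2 \<le> m" and R: "1 \<le> R" and t: "real n / real m \<le> real t" and eps: "0 < \<epsilon>"
      and mn: "(real m)\<^sup>2 / \<epsilon> \<le> C * real n" for n m R t \<epsilon>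
  proof -
    consider "\<epsilon> \<le> min \<epsilon>0 1" | "\<epsilon>0 < \<epsilon>" "\<epsilon> \<le> 1" | "1 < \<epsilon>" by linarith
    then show ?thesis
    proof cases
      case 1
      have "0 \<le> real m * log 2 (1 / \<epsilon>) / real R" using eps 1 by (simp add: zero_le_log_cancel_iff)
      then have "c * (real m * log 2 (1 / \<epsilon>) / real R) \<le> c1 * (real m * log 2 (1 / \<epsilon>) / real R)"
        using c by (intro mult_right_mono) auto
      with small[of m R n t \<epsilon>] show ?thesis using 1 N R t eps mn by (auto intro: space_ge_mono)
    next
      case 2
      have "(real m)\<^sup>2 \<le> (real m)\<^sup>2 / \<epsilon>" using 2 eps by (simp add: field_simps mult_left_le_one_le)
      then have space: "LNST_space_ge {..<m} n t \<epsilon> R (c2 * (real m / real R))"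
        using large[of m R n t \<epsilon>] 2 N R t eps mn by auto
      have "log 2 (1 / \<epsilon>) \<le> log 2 (1 / \<epsilon>0)"
        using 2 c1 eps by (subst log_le_cancel_iff) (auto simp: field_simps)
      then have "c * log 2 (1 / \<epsilon>) \<le> c * K" using K c by (intro mult_left_mono) auto
      then have "c * log 2 (1 / \<epsilon>) \<le> c2" using c by linarith
      then have "c * log 2 (1 / \<epsilon>) * (real m / real R) \<le> c2 * (real m / real R)"
        by (rule mult_right_mono) simp
      then show ?thesis by (intro space_ge_mono[OF space]) (simp add: algebra_simps)
    next
      case 3
      then have "log 2 (1 / \<epsilon>) \<le> 0" by (simp add: log_le_zero_cancel_iff)
      then have "c * (real m * log 2 (1 / \<epsilon>) / real R) \<le> 0"
        using c by (simp add: mult_nonneg_nonpos divide_nonpos_nonneg)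
      then show ?thesis unfolding LNST_space_ge_def
        using order_trans of_nat_0_le_iff by blast
    qed
  qed
  then show ?thesis using c(1) by (intro exI[of _ c] conjI exI[of _ "max N1 N2"]) auto
qed

section \<open>Cells that exploit the threshold\<close>

text \<open>
  A cell consists of the two halves below for the same set \<open>Y\<close>, and the threshold is
  \<open>e + 2 * u * (k + 1)\<close>. A sorted subsequence leaves the symbol \<open>s\<close> in some segment \<open>i\<close> of the first
  half and enters \<open>s + 2\<close> in some segment \<open>j\<close> of the second half. For \<open>i = j\<close> the threshold can be met
  exactly, and both segments can be used completely only if \<open>i \<notin> Y\<close> in the first half and \<open>i \<in> Y\<close>
  in the second one. So combining halves for two different sets gains \<open>u\<close>, although the total
  is of the order of the threshold, and the content of a cell carries \<open>k\<close> bits.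
\<close>

definition first_half :: "nat \<Rightarrow> nat \<Rightarrow> nat \<Rightarrow> nat set \<Rightarrow> nat list" where
  "first_half u k s Y = concat (map (\<lambda>i. if i \<in> Y
     then replicate u (s + 1) @ replicate u s @ replicate u (s + 1)
     else replicate u s @ replicate (2 * u) (s + 1)) [0..<k])"

text \<open>The \<open>e\<close> leading copies absorb the remainder of the threshold modulo
  \<open>2 * u\<close>.\<close>

definition second_half :: "nat \<Rightarrow> nat \<Rightarrow> nat \<Rightarrow> nat \<Rightarrow> nat set \<Rightarrow> nat list" where
  "second_half e u k s Y = replicate e (s + 1) @ concat (map (\<lambda>i. if i \<in> Y
     then replicate (2 * u) (s + 1) @ replicate u (s + 2)
     else replicate u (s + 1) @ replicate u (s + 2) @ replicate u (s + 1)) [0..<k])"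

section \<open>Upper bounds for sorted subsequences of the two halves\<close>

lemma count_list_concat_map_const:
  assumes "\<And>x. x \<in> set l \<Longrightarrow> count_list (f x) v = c"
  shows "count_list (concat (map f l)) v = length l * c"
  using assms by (induction l) auto

text \<open>Segment \<open>i\<close> is the last one from which an \<open>a\<close> is taken, or
  segment 0. As \<open>a < b\<close>, no \<open>b\<close> is taken from an earlier segment.\<close>

lemma sorted_subseq_concat_split:
  fixes a b :: "'a::linorder"
  assumes "a < b" and "1 \<le> k" and "subseq y (concat (map f [0..<k]))" "sorted y"
  shows "\<exists>i<k. \<exists>z. subseq z (f i) \<and> sorted z \<and>
    count_list y a \<le> (\<Sum>j<i. count_list (f j) a) + count_list z a \<and>
    count_list y b \<le> count_list z b + (\<Sum>j\<in>{i<..<k}. count_list (f j) b)"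
  using assms(2-)
proof (induction k arbitrary: y)
  case (Suc k)
  from Suc.prems(2) obtain y1 y2 where
    y: "y = y1 @ y2" "subseq y1 (concat (map f [0..<k]))" "subseq y2 (f k)"
    by (auto elim: subseq_appendE)
  have sorted: "sorted y1" "sorted y2" "\<And>u v. u \<in> set y1 \<Longrightarrow> v \<in> set y2 \<Longrightarrow> u \<le> v"
    using Suc.prems(3) by (auto simp: y(1) sorted_append)
  have count: "count_list y2 b \<le> count_list (f k) b"
    "count_list y1 a \<le> (\<Sum>j<k. count_list (f j) a)"
    using count_list_subseq_le[OF y(3)] count_list_subseq_le[OF y(2)]
    by (auto simp: count_list_concat_map_upt)
  show ?case
  proof (cases "k = 0 \<or> a \<in> set y2")
    case True
    then have "b \<notin> set y1"
    proof
      assume "k = 0"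
      then show ?thesis using y(2) by (auto dest: list_emb_Nil2)
    next
      assume "a \<in> set y2"
      then show ?thesis using sorted(3) assms(1) by force
    qed
    then have "count_list y1 b = 0" by (simp add: count_list_0_iff)
    then show ?thesis using y sorted count by (intro exI[of _ k] conjI exI[of _ y2]) auto
  next
    case False
    then have "count_list y2 a = 0" by (simp add: count_list_0_iff)
    moreover obtain i z where "i < k" "subseq z (f i)" "sorted z"
      "count_list y1 a \<le> (\<Sum>j<i. count_list (f j) a) + count_list z a"
      "count_list y1 b \<le> count_list z b + (\<Sum>j\<in>{i<..<k}. count_list (f j) b)"
      using Suc.IH[OF _ y(2) sorted(1)] False by force
    moreover from \<open>i < k\<close> have "{i<..<Suc k} = insert k {i<..<k}" by auto
    ultimately show ?thesis using y(1) count by (intro exI[of _ i] conjI exI[of _ z]) auto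
  qed
qed simp

text \<open>An \<open>a\<close> from the middle excludes every \<open>b\<close> in front of
  it.\<close>

lemma sorted_subseq_bab:
  fixes a b :: "'a::linorder"
  assumes "a < b" "sorted z" "subseq z (replicate u b @ replicate u a @ replicate u b)"
  shows "count_list z a = 0 \<or> count_list z b \<le> u"
proof -
  from assms(3) obtain z1 z2 z3 where z: "z = z1 @ z2 @ z3" "subseq z1 (replicate u b)"
    "subseq z2 (replicate u a)" "subseq z3 (replicate u b)"
    by (metis subseq_appendE)
  have set: "set z1 \<subseteq> {b}" "set z2 \<subseteq> {a}" "set z3 \<subseteq> {b}"
    using z(2-4)[THEN subseq_set_subset] by auto
  have c: "count_list z1 a = 0" "count_list z2 b = 0" "count_list z3 a = 0"
    using set assms(1) by (auto simp: count_list_0_iff)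
  have "count_list z3 b \<le> u"
    using count_list_subseq_le[OF z(4), of b] by (simp add: count_list_replicate)
  moreover have "count_list z1 b = 0" if "count_list z2 a \<noteq> 0"
  proof -
    from that have "a \<in> set z2" by (simp add: count_list_0_iff)
    then have "b \<le> a" if "b \<in> set z1" using assms(2) z(1) that by (simp add: sorted_append)
    then have "b \<notin> set z1" using assms(1) by auto
    then show ?thesis by (simp add: count_list_0_iff)
  qed
  ultimately show ?thesis using c by (cases "count_list z2 a = 0") (auto simp: z(1))
qed

lemma sorted_subseq_aba:
  fixes a b :: "'a::linorder"
  assumes "a < b" "sorted z" "subseq z (replicate u a @ replicate u b @ replicate u a)"
  shows "count_list z b = 0 \<or> count_list z a \<le> u"
proof -
  from assms(3) obtain z1 z2 z3 where z: "z = z1 @ z2 @ z3" "subseq z1 (replicate u a)"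
    "subseq z2 (replicate u b)" "subseq z3 (replicate u a)"
    by (metis subseq_appendE)
  have set: "set z1 \<subseteq> {a}" "set z2 \<subseteq> {b}" "set z3 \<subseteq> {a}"
    using z(2-4)[THEN subseq_set_subset] by auto
  have c: "count_list z1 b = 0" "count_list z2 a = 0" "count_list z3 b = 0"
    using set assms(1) by (auto simp: count_list_0_iff)
  have "count_list z1 a \<le> u"
    using count_list_subseq_le[OF z(2), of a] by (simp add: count_list_replicate)
  moreover have "count_list z3 a = 0" if "count_list z2 b \<noteq> 0"
  proof -
    from that have "b \<in> set z2" by (simp add: count_list_0_iff)
    then have "b \<le> a" if "a \<in> set z3" using assms(2) z(1) that by (simp add: sorted_append)
    then have "a \<notin> set z3" using assms(1) by auto
    then show ?thesis by (simp add: count_list_0_iff)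
  qed
  ultimately show ?thesis using c by (cases "count_list z2 b = 0") (auto simp: z(1))
qed

lemma length_two_letters:
  assumes "set y \<subseteq> {a, b}" "a \<noteq> b"
  shows "length y = count_list y a + count_list y b"
  using sum_count_set[OF assms(1)] assms(2) by simp

text \<open>\<open>p\<close> and \<open>c\<close> count the \<open>s\<close> and
  \<open>s + 1\<close> taken from segment \<open>i\<close>, in which the subsequence changes its
  symbol. Only this segment feels \<open>Y\<close>: for \<open>i \<in> Y\<close> its pattern is that
  of \<open>sorted_subseq_bab\<close>.\<close>

lemma sorted_subseq_first_half:
  assumes "1 \<le> k" "subseq y (first_half u k s Y)" "sorted y"
  shows "\<exists>i i' p c. k = i + 1 + i' \<and> length y \<le> (u * i + p) + (2 * u * i' + c) \<and>
    count_list y s \<le> u * i + p \<and> count_list y (s + 1) \<le> 2 * u * i' + c \<and>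
    p \<le> u \<and> c \<le> 2 * u \<and> (i \<in> Y \<longrightarrow> p = 0 \<or> c \<le> u)"
proof -
  let ?f = "\<lambda>i. if i \<in> Y then replicate u (s + 1) @ replicate u s @ replicate u (s + 1)
     else replicate u s @ replicate (2 * u) (s + 1)"
  have count: "count_list (?f i) s = u" "count_list (?f i) (s + 1) = 2 * u" for i
    by (auto simp: count_list_replicate)
  from sorted_subseq_concat_split[of s "s + 1" k y ?f] assms obtain i z where
    i: "i < k" "subseq z (?f i)" "sorted z"
    "count_list y s \<le> (\<Sum>j<i. count_list (?f j) s) + count_list z s"
    "count_list y (s + 1) \<le> count_list z (s + 1) + (\<Sum>j\<in>{i<..<k}. count_list (?f j) (s + 1))"
    unfolding first_half_def by auto
  have y: "count_list y s \<le> u * i + count_list z s"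
    "count_list y (s + 1) \<le> 2 * u * (k - Suc i) + count_list z (s + 1)"
    using i(4,5) unfolding count by (simp_all add: mult.commute)
  have "set y \<subseteq> {s, s + 1}"
    using subseq_set_subset[OF assms(2)] by (auto simp: first_half_def split: if_splits)
  then have "length y = count_list y s + count_list y (s + 1)"
    by (intro length_two_letters) auto
  moreover have "count_list z s \<le> u" "count_list z (s + 1) \<le> 2 * u"
    using count_list_subseq_le[OF i(2), of s] count_list_subseq_le[OF i(2), of "s + 1"]
    unfolding count by auto
  moreover have "count_list z s = 0 \<or> count_list z (s + 1) \<le> u" if "i \<in> Y"
    using sorted_subseq_bab[of s "s + 1" z u] i(2,3) that by simp
  ultimately show ?thesis using i(1) y
    by (intro exI[of _ i] exI[of _ "k - Suc i"] exI[of _ "count_list z s"]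
        exI[of _ "count_list z (s + 1)"]) auto
qed

text \<open>The mirror image, with roles of \<open>Y\<close> and its complement exchanged. The first
  length bound counts the supply; the second keeps the actual number of \<open>s + 1\<close>, to
  which the threshold can be applied later.\<close>

lemma sorted_subseq_second_half:
  assumes "1 \<le> k" "subseq y (second_half e u k s Y)" "sorted y"
  shows "\<exists>j j' c p e'. k = j + 1 + j' \<and> e' \<le> e \<and>
    length y \<le> e' + (2 * u * j + c) + (u * j' + p) \<and>
    length y \<le> count_list y (s + 1) + (u * j' + p) \<and>
    c \<le> 2 * u \<and> p \<le> u \<and> (j \<notin> Y \<longrightarrow> p = 0 \<or> c \<le> u)"
proof -
  let ?f = "\<lambda>i. if i \<in> Y then replicate (2 * u) (s + 1) @ replicate u (s + 2)
     else replicate u (s + 1) @ replicate u (s + 2) @ replicate u (s + 1)"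
  have count: "count_list (?f i) (s + 1) = 2 * u" "count_list (?f i) (s + 2) = u" for i
    by (auto simp: count_list_replicate)
  from assms(2) obtain y0 y1 where
    y01: "y = y0 @ y1" "subseq y0 (replicate e (s + 1))" "subseq y1 (concat (map ?f [0..<k]))"
    unfolding second_half_def by (auto elim: subseq_appendE)
  have "sorted y1" using assms(3) y01(1) by (simp add: sorted_append)
  with sorted_subseq_concat_split[of "s + 1" "s + 2" k y1 ?f] assms(1) y01(3) obtain j z where
    j: "j < k" "subseq z (?f j)" "sorted z"
    "count_list y1 (s + 1) \<le> (\<Sum>i<j. count_list (?f i) (s + 1)) + count_list z (s + 1)"
    "count_list y1 (s + 2) \<le> count_list z (s + 2) + (\<Sum>i\<in>{j<..<k}. count_list (?f i) (s + 2))"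
    by auto
  have y1: "count_list y1 (s + 1) \<le> 2 * u * j + count_list z (s + 1)"
    "count_list y1 (s + 2) \<le> u * (k - Suc j) + count_list z (s + 2)"
    using j(4,5) unfolding count by (simp_all add: mult.commute)
  have set: "set y0 \<subseteq> {s + 1}" "set y1 \<subseteq> {s + 1, s + 2}"
    using subseq_set_subset[OF y01(2)] subseq_set_subset[OF y01(3)] by (auto split: if_splits)
  have "length y1 = count_list y1 (s + 1) + count_list y1 (s + 2)"
    using set(2) by (intro length_two_letters) auto
  moreover have "length y0 = count_list y0 (s + 1)"
    using sum_count_set[OF set(1)] by simp
  moreover have "length y0 \<le> e" using list_emb_length[OF y01(2)] by simp
  moreover have "count_list z (s + 1) \<le> 2 * u" "count_list z (s + 2) \<le> u"
    using count_list_subseq_le[OF j(2), of "s + 1"] count_list_subseq_le[OF j(2), of "s + 2"]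
    unfolding count by auto
  moreover have "count_list z (s + 2) = 0 \<or> count_list z (s + 1) \<le> u" if "j \<notin> Y"
    using sorted_subseq_aba[of "s + 1" "s + 2" z u] j(2,3) that by simp
  moreover have "length y = length y0 + length y1"
    "count_list y (s + 1) = count_list y0 (s + 1) + count_list y1 (s + 1)"
    by (simp_all add: y01(1))
  moreover have "k = j + 1 + (k - Suc j)" using j(1) by simp
  ultimately show ?thesis using y1
    by (intro exI[of _ j] exI[of _ "k - Suc j"] exI[of _ "count_list z (s + 1)"]
        exI[of _ "count_list z (s + 2)"] exI[of _ "length y0"]) (intro conjI impI; linarith)
qed

text \<open>
  If the two splitting positions satisfy \<open>j < i\<close>, or if one of the two segments cannot be used
  completely, then the number of available symbols gives the bound. Otherwise the threshold on
  the middle symbol does.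
\<close>

lemma cell_length_le:
  assumes k: "1 \<le> k" and y: "subseq y (first_half u k s Y @ second_half e u k s Y)"
    and ad: "admissible (e + 2 * u * (k + 1)) y"
  shows "length y \<le> e + 3 * u * k + 2 * u"
proof -
  from y obtain y1 y2 where
    y12: "y = y1 @ y2" "subseq y1 (first_half u k s Y)" "subseq y2 (second_half e u k s Y)"
    by (auto elim: subseq_appendE)
  have sorted: "sorted y1" "sorted y2" using ad by (auto simp: y12(1) admissible_def sorted_append)
  obtain i i' p c where 1: "k = i + 1 + i'" "length y1 \<le> (u * i + p) + (2 * u * i' + c)"
    "count_list y1 s \<le> u * i + p" "p \<le> u" "c \<le> 2 * u" "i \<in> Y \<Longrightarrow> p = 0 \<or> c \<le> u"
    using sorted_subseq_first_half[OF k y12(2) sorted(1)] by blast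
  obtain j j' c' p' e' where 2: "k = j + 1 + j'" "e' \<le> e"
    "length y2 \<le> e' + (2 * u * j + c') + (u * j' + p')"
    "length y2 \<le> count_list y2 (s + 1) + (u * j' + p')" "c' \<le> 2 * u" "p' \<le> u"
    "j \<notin> Y \<Longrightarrow> p' = 0 \<or> c' \<le> u"
    using sorted_subseq_second_half[OF k y12(3) sorted(2)] by blast
  have "set y1 \<subseteq> {s, s + 1}"
    using subseq_set_subset[OF y12(2)] by (auto simp: first_half_def split: if_splits)
  then have "length y1 = count_list y1 s + count_list y1 (s + 1)"
    by (intro length_two_letters) auto
  moreover have "count_list y1 (s + 1) + count_list y2 (s + 1) \<le> e + 2 * u * (k + 1)"
    using ad by (simp add: admissible_def y12(1))
  ultimately have thr: "length y \<le> e + 2 * (u * k) + 2 * u + (u * i + p) + (u * j' + p')"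
    using 1(3) 2(4) by (simp add: y12(1) algebra_simps)
  have all: "length y \<le> e + (u * i + p) + (2 * (u * i') + c) + (2 * (u * j) + c') + (u * j' + p')"
    using 1(2) 2(2,3) by (simp add: y12(1) algebra_simps)
  have uk: "u * k = u * i + u + u * i'" "u * k = u * j + u + u * j'"
    using arg_cong[OF 1(1), of "(*) u"] arg_cong[OF 2(1), of "(*) u"]
    unfolding distrib_left by simp_all
  consider "j < i" | "i < j" | "i = j" by linarith
  then have "length y \<le> e + 3 * (u * k) + 2 * u"
  proof cases
    case 1
    then have "u * (j + 1) \<le> u * i" by (intro mult_le_mono2) simp
    then have "u * j + u \<le> u * i" by simp
    then show ?thesis
      using all uk \<open>p \<le> u\<close> \<open>c \<le> 2 * u\<close> \<open>c' \<le> 2 * u\<close> \<open>p' \<le> u\<close> by linarith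
  next
    case 2
    then have "u * (i + 1) \<le> u * j" by (intro mult_le_mono2) simp
    then have "u * i + u \<le> u * j" by simp
    then show ?thesis using thr uk \<open>p \<le> u\<close> \<open>p' \<le> u\<close> by linarith
  next
    \<comment> \<open>Here supply and threshold alone would each allow \<open>u\<close> too many.
      The excess vanishes if \<open>p\<close> or \<open>p'\<close> is 0, and otherwise because
      \<open>Y\<close> spoils the segment \<open>i\<close> in one of the two halves.\<close>
    case 3
    then have ij: "u * i = u * j" by simp
    consider "p = 0" | "p' = 0" | "p \<noteq> 0" "p' \<noteq> 0" by blast
    then show ?thesis
    proof cases
      case 1
      then show ?thesis using thr uk ij \<open>p' \<le> u\<close> by linarith
    next
      case 2
      then show ?thesis using thr uk ij \<open>p \<le> u\<close> by linarith
    next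
      case 3
      then have "c \<le> u \<or> c' \<le> u" using \<open>i = j\<close> 1(6) 2(7) by blast
      then show ?thesis
        using all uk ij \<open>p \<le> u\<close> \<open>c \<le> 2 * u\<close> \<open>c' \<le> 2 * u\<close> \<open>p' \<le> u\<close> by linarith
    qed
  qed
  then show ?thesis by simp
qed

section \<open>Subsequences attained in single and mixed cells\<close>

lemma subseq_first_half:
  assumes "i < k" "i \<notin> Y"
  shows "subseq (replicate (u * (i + 1)) s @ replicate (2 * u * (k - i)) (s + 1)) (first_half u k s Y)"
proof -
  let ?f = "\<lambda>i. if i \<in> Y then replicate u (s + 1) @ replicate u s @ replicate u (s + 1)
     else replicate u s @ replicate (2 * u) (s + 1)"
  have count: "count_list (?f i) s = u" "count_list (?f i) (s + 1) = 2 * u" for i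
    by (auto simp: count_list_replicate)
  have "[0..<k] = [0..<i] @ i # [Suc i..<k]"
    using assms(1) upt_add_eq_append[of 0 i "k - i"] by (simp add: upt_conv_Cons)
  then have eq: "first_half u k s Y = (concat (map ?f [0..<i]) @ replicate u s) @
      (replicate (2 * u) (s + 1) @ concat (map ?f [Suc i..<k]))"
    unfolding first_half_def using assms(2) by simp
  have "count_list (concat (map ?f [0..<i])) s = i * u"
    "count_list (concat (map ?f [Suc i..<k])) (s + 1) = (k - Suc i) * (2 * u)"
    using count_list_concat_map_const[of "[0..<i]" ?f s u, OF count(1)]
      count_list_concat_map_const[of "[Suc i..<k]" ?f "s + 1" "2 * u", OF count(2)] by simp_all
  moreover have "2 * u * (k - i) = 2 * u + (k - Suc i) * (2 * u)"
    using assms(1) by (simp add: Suc_diff_Suc[symmetric])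
  ultimately show ?thesis
    unfolding eq by (intro list_emb_append_mono) (auto simp: subseq_replicate_iff count_list_replicate)
qed

lemma subseq_first_half_all: "subseq (replicate (2 * u * k) (s + 1)) (first_half u k s Y)"
proof -
  have "count_list (first_half u k s Y) (s + 1) = length [0..<k] * (2 * u)"
    unfolding first_half_def by (rule count_list_concat_map_const) (auto simp: count_list_replicate)
  then show ?thesis by (simp add: subseq_replicate_iff)
qed

lemma subseq_second_half:
  assumes "i < k" "i \<in> Y"
  shows "subseq (replicate (e + 2 * u * (i + 1)) (s + 1) @ replicate (u * (k - i)) (s + 2))
    (second_half e u k s Y)"
proof -
  let ?f = "\<lambda>i. if i \<in> Y then replicate (2 * u) (s + 1) @ replicate u (s + 2)
     else replicate u (s + 1) @ replicate u (s + 2) @ replicate u (s + 1)"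
  have count: "count_list (?f i) (s + 1) = 2 * u" "count_list (?f i) (s + 2) = u" for i
    by (auto simp: count_list_replicate)
  have "[0..<k] = [0..<i] @ i # [Suc i..<k]"
    using assms(1) upt_add_eq_append[of 0 i "k - i"] by (simp add: upt_conv_Cons)
  then have eq: "second_half e u k s Y =
      (replicate e (s + 1) @ concat (map ?f [0..<i]) @ replicate (2 * u) (s + 1)) @
      (replicate u (s + 2) @ concat (map ?f [Suc i..<k]))"
    unfolding second_half_def using assms(2) by simp
  have "count_list (concat (map ?f [0..<i])) (s + 1) = i * (2 * u)"
    "count_list (concat (map ?f [Suc i..<k])) (s + 2) = (k - Suc i) * u"
    using count_list_concat_map_const[of "[0..<i]" ?f "s + 1" "2 * u", OF count(1)]
      count_list_concat_map_const[of "[Suc i..<k]" ?f "s + 2" u, OF count(2)] by simp_all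
  moreover have "u * (k - i) = u + (k - Suc i) * u"
    using assms(1) by (simp add: Suc_diff_Suc[symmetric])
  ultimately show ?thesis
    unfolding eq by (intro list_emb_append_mono) (auto simp: subseq_replicate_iff count_list_replicate)
qed

lemma subseq_second_half_all:
  assumes "1 \<le> k" "0 \<notin> Y"
  shows "subseq (replicate (e + u) (s + 1) @ replicate (u * k) (s + 2)) (second_half e u k s Y)"
proof -
  let ?f = "\<lambda>i. if i \<in> Y then replicate (2 * u) (s + 1) @ replicate u (s + 2)
     else replicate u (s + 1) @ replicate u (s + 2) @ replicate u (s + 1)"
  have count: "count_list (?f i) (s + 2) = u" for i by (auto simp: count_list_replicate)
  have "[0..<k] = 0 # [1..<k]" using assms(1) by (simp add: upt_conv_Cons)
  then have eq: "second_half e u k s Y = (replicate e (s + 1) @ replicate u (s + 1)) @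
      (replicate u (s + 2) @ replicate u (s + 1) @ concat (map ?f [1..<k]))"
    unfolding second_half_def using assms(2) by simp
  have "count_list (concat (map ?f [1..<k])) (s + 2) = (k - 1) * u"
    using count_list_concat_map_const[of "[1..<k]" ?f "s + 2" u, OF count] by simp
  moreover have "u * k = u + (k - 1) * u" using assms(1) by (cases k) auto
  ultimately show ?thesis
    unfolding eq by (intro list_emb_append_mono) (auto simp: subseq_replicate_iff count_list_replicate)
qed

lemma admissible_three_letters:
  fixes s :: nat
  assumes "a \<le> t" "c + c' \<le> t" "b \<le> t"
  shows "admissible t ((replicate a s @ replicate c (s + 1)) @ (replicate c' (s + 1) @ replicate b (s + 2)))"
    (is "admissible t ?y")
proof -
  have "?y = replicate a s @ (replicate c (s + 1) @ replicate c' (s + 1)) @ replicate b (s + 2)"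
    by simp
  also have "admissible t \<dots>"
  proof (rule admissible_append)
    show "admissible t (replicate a s)"
      by (rule admissible_constant[where a = s]) (use assms in auto)
    show "admissible t ((replicate c (s + 1) @ replicate c' (s + 1)) @ replicate b (s + 2))"
    proof (rule admissible_append)
      show "admissible t (replicate c (s + 1) @ replicate c' (s + 1))"
        by (rule admissible_constant[where a = "s + 1"]) (use assms in auto)
      show "admissible t (replicate b (s + 2))"
        by (rule admissible_constant[where a = "s + 2"]) (use assms in auto)
    qed auto
  qed auto
  finally show ?thesis .
qed

text \<open>Distinct sets differ at some \<open>i\<close>. If \<open>i\<close> is missing in the
  first and present in the second, changing symbols at \<open>i\<close> in both halves uses exactly
  \<open>t\<close> copies of the middle symbol and gives length \<open>t + u * k + u\<close>. A
  single set gives \<open>t + u * k\<close> through segment 0, so the bound of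
  \<open>cell_length_le\<close> is attained for every content.\<close>

lemma cell_mix:
  assumes k: "1 \<le> k" and A: "A \<subseteq> Pow {..<k}" "A \<noteq> {}" and t: "t = e + 2 * u * (k + 1)"
  shows "\<exists>Y1\<in>A. \<exists>Y2\<in>A. \<forall>s. \<exists>p1 p2. subseq p1 (first_half u k s Y1) \<and>
    subseq p2 (second_half e u k s Y2) \<and> admissible t (p1 @ p2) \<and> set (p1 @ p2) \<subseteq> {s..s + 2} \<and>
    t + u * k + (if 1 < card A then u else 0) \<le> length (p1 @ p2)"
proof -
  have ex: "\<exists>p1 p2. subseq p1 (first_half u k s Y1) \<and>
    subseq p2 (second_half e u k s Y2) \<and> admissible t (p1 @ p2) \<and> set (p1 @ p2) \<subseteq> {s..s + 2} \<and>
    g \<le> length (p1 @ p2)"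
    if "subseq (replicate a s @ replicate c (s + 1)) (first_half u k s Y1)"
      "subseq (replicate c' (s + 1) @ replicate b (s + 2)) (second_half e u k s Y2)"
      "a \<le> t" "c + c' \<le> t" "b \<le> t" "g \<le> a + c + c' + b" for s Y1 Y2 g a b c c'
    using that admissible_three_letters[of a t c c' b s]
    by (intro exI[of _ "replicate a s @ replicate c (s + 1)"]
        exI[of _ "replicate c' (s + 1) @ replicate b (s + 2)"]) auto
  have ukt: "u * (k + 1) \<le> t" "u * k \<le> t" by (auto simp: t)
  show ?thesis
  proof (cases "1 < card A")
    case True
    have "\<exists>Y Y' i. Y \<in> A \<and> Y' \<in> A \<and> i \<notin> Y \<and> i \<in> Y' \<and> i < k"
    proof -
      have "\<exists>Y\<in>A. \<exists>Y'\<in>A. Y \<noteq> Y'"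
      proof (rule ccontr)
        assume *: "\<not> ?thesis"
        obtain Y where "Y \<in> A" using A(2) by blast
        then have "A \<subseteq> {Y}" using * by blast
        from card_mono[OF _ this] show False using True by simp
      qed
      then obtain Y Y' where Y: "Y \<in> A" "Y' \<in> A" "Y \<noteq> Y'" by blast
      then obtain i where "i \<in> Y \<and> i \<notin> Y' \<or> i \<in> Y' \<and> i \<notin> Y" by blast
      then show ?thesis using Y A(1) by blast
    qed
    then obtain Y Y' i where Y: "Y \<in> A" "Y' \<in> A" "i \<notin> Y" "i \<in> Y'" "i < k" by blast
    obtain j where j: "k = i + j" using le_Suc_ex[of i k] Y(5) by auto
    have "\<exists>p1 p2. subseq p1 (first_half u k s Y) \<and>
        subseq p2 (second_half e u k s Y') \<and> admissible t (p1 @ p2) \<and> set (p1 @ p2) \<subseteq> {s..s + 2} \<and>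
        t + u * k + (if 1 < card A then u else 0) \<le> length (p1 @ p2)" for s
    proof (rule ex[OF subseq_first_half[OF Y(5,3)] subseq_second_half[OF Y(5,4)]])
      show "u * (i + 1) \<le> t" using ukt(1) Y(5)
        by (meson add_le_cancel_right le_trans less_imp_le mult_le_mono2)
      show "u * (k - i) \<le> t" using ukt(2) by (meson diff_le_self le_trans mult_le_mono2)
    qed (auto simp: t j algebra_simps)
    then show ?thesis using Y(1,2) by blast
  next
    case False
    obtain Y where Y: "Y \<in> A" using A(2) by blast
    have "\<exists>p1 p2. subseq p1 (first_half u k s Y) \<and>
        subseq p2 (second_half e u k s Y) \<and> admissible t (p1 @ p2) \<and> set (p1 @ p2) \<subseteq> {s..s + 2} \<and>
        t + u * k + (if 1 < card A then u else 0) \<le> length (p1 @ p2)" for s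
    proof (cases "0 \<in> Y")
      case True
      have "subseq (replicate 0 s @ replicate (2 * u * k) (s + 1)) (first_half u k s Y)"
        using subseq_first_half_all by simp
      from ex[OF this subseq_second_half[of 0 k Y e u s]] show ?thesis
        using True k False ukt by (auto simp: t algebra_simps)
    next
      case F: False
      from ex[OF subseq_first_half[of 0 k Y u s] subseq_second_half_all[of k Y e u s]] show ?thesis
        using F k False ukt by (auto simp: t algebra_simps)
    qed
    then show ?thesis using Y by blast
  qed
qed

section \<open>Threshold of order \<open>1 / \<epsilon>\<close>\<close>

lemma filter_rows:
  fixes r :: "'a \<Rightarrow> nat"
  assumes "\<And>\<rho> v. \<rho> < M \<Longrightarrow> v \<in> set (f \<rho>) \<Longrightarrow> r v = \<rho>"
  shows "filter (\<lambda>v. r v = j) (concat (map f [0..<M])) = (if j < M then f j else [])"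
  using assms
proof (induction M)
  case (Suc M)
  have "filter (\<lambda>v. r v = j) (f M) = (if j = M then f M else [])"
    using Suc.prems[of M] by (auto simp: filter_empty_conv filter_id_conv)
  then show ?case using Suc by (auto simp: less_Suc_eq)
qed simp

lemma subseq_member_concat: "x \<in> set l \<Longrightarrow> subseq (f x) (concat (map f l))"
  by (induction l) (auto intro: subseq_drop_many subseq_rev_drop_many)

lemma length_first_half: "length (first_half u k s Y) = 3 * u * k"
proof -
  have "length (concat (map f [0..<k])) = 3 * u * k" if "\<And>i. length (f i) = 3 * u" for f :: "nat \<Rightarrow> nat list"
    using that by (simp add: length_concat_map_upt)
  then show ?thesis unfolding first_half_def by simp
qed

lemma length_second_half: "length (second_half e u k s Y) = e + 3 * u * k"
proof -
  have "length (concat (map f [0..<k])) = 3 * u * k" if "\<And>i. length (f i) = 3 * u" for f :: "nat \<Rightarrow> nat list"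
    using that by (simp add: length_concat_map_upt)
  then show ?thesis unfolding second_half_def by simp
qed

lemma set_halves: "set (first_half u k s Y) \<subseteq> {s..s + 2}" "set (second_half e u k s Y) \<subseteq> {s..s + 2}"
  by (auto simp: first_half_def second_half_def split: if_splits)

text \<open>
  Row \<open>\<rho>\<close> is preceded by \<open>\<rho>\<close> and followed by \<open>M - 1 - \<rho>\<close> additional cells, each of which holds a
  sorted sequence of the length \<open>H\<close> of a cell. Moving up by one row gains at most \<open>H\<close>
  inside a block, and this gain is offset by the loss of one additional cell.
\<close>

lemma tilted_space_ge:
  fixes u k e M B t m n l R :: nat and \<epsilon> :: real
  assumes k: "1 \<le> k" and M: "1 \<le> M" and B: "1 \<le> B" and R: "1 \<le> R" and eps: "0 < \<epsilon>"
    and t: "t = e + 2 * u * (k + 1)" and H: "H = t + u * k"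
    and m: "3 * (M * (2 * M + B)) + 1 \<le> m"
    and n: "n = l + M * (M - 1) * H + M * B * (e + 6 * u * k)"
    and gap: "\<epsilon> * real (H * (B + M - 1)) < real u * real B / 2"
  shows "LNST_space_ge {..<m} n t \<epsilon> R (real M * real k / (6 * real R))"
proof -
  \<comment> \<open>Every row has \<open>W\<close> positions with three symbols of its own each:
    those below \<open>M\<close> for the cells in front, the next \<open>B\<close> for the blocks,
    and the rest for the cells behind. No symbol is shared between positions, so the threshold acts
    on each cell separately.\<close>
  define W where "W = 2 * M + B"
  define sb where "sb \<rho> i = 3 * (\<rho> * W + i)" for \<rho> i
  define r where "r v = v div (3 * W)" for v
  define v0 where "v0 = 3 * (M * W)"
  define bonus where "bonus \<rho> i = replicate (u * k) (sb \<rho> i) @ replicate t (sb \<rho> i + 1)" for \<rho> i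
  define pre where "pre \<rho> = concat (map (\<lambda>i. bonus \<rho> i) [0..<\<rho>])" for \<rho>
  define suf where "suf \<rho> = concat (map (\<lambda>i. bonus \<rho> (M + B + i)) [0..<M - 1 - \<rho>])" for \<rho>
  define half where "half i = (if i = (0::nat) then first_half u k else second_half e u k)" for i
  define col where "col c x = concat (map (\<lambda>\<rho>. half (c mod 2) (sb \<rho> (M + c div 2)) (x (\<rho>, c div 2))) [0..<M])"
    for c and x :: "nat \<times> nat \<Rightarrow> nat set"
  \<comment> \<open>The rows come in decreasing order, so a sorted subsequence can use the
    additional cells of only one row in front, and likewise behind.\<close>
  let ?pre = "padding v0 1 l l @ concat (map pre (rev [0..<M]))"
  let ?suf = "concat (map suf (rev [0..<M]))"
  let ?X = "PiE ({..<M} \<times> {..<B}) (\<lambda>_. Pow {..<k})"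
  let ?h = "H * (B + M - 1)"
  have [simp]: "Suc (b * 2) mod 2 = 1" "Suc (b * 2) div 2 = b" for b by presburger+
  have upt2: "[0..<2] = [0, Suc 0]" by (simp add: upt_rec)
  have W: "1 \<le> W" using B by (simp add: W_def)
  have mono_r: "mono r" by (simp add: monoI div_le_mono r_def)
  have r_cell: "r v = \<rho>" if "v \<in> {sb \<rho> i..sb \<rho> i + 2}" "i < W" for v \<rho> i
  proof -
    define j where "j = v - sb \<rho> i"
    have j: "v = sb \<rho> i + j" "j \<le> 2" using that(1) by (auto simp: j_def)
    then have "v = (3 * i + j) + \<rho> * (3 * W)" by (simp add: sb_def algebra_simps)
    moreover have "3 * i + j < 3 * W" using j that(2) by linarith
    ultimately show ?thesis using W unfolding r_def by (simp only: div_mult_self1) simp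
  qed
  have lt_cell: "u < v" if "u \<in> {sb \<rho> i..sb \<rho> i + 2}" "v \<in> {sb \<rho> j..sb \<rho> j + 2}" "i < j" for u v \<rho> i j
    using that by (simp add: sb_def)
  have v0: "v < v0" if "v \<in> {sb \<rho> i..sb \<rho> i + 2}" "i < W" "\<rho> < M" for v \<rho> i
  proof -
    have "(\<rho> + 1) * W \<le> M * W" using that(3) by (intro mult_le_mono1) simp
    then show ?thesis using that by (simp add: sb_def v0_def)
  qed
  have rows: "\<rho> < M" if "v < v0" "r v = \<rho>" for v \<rho>
    using that less_mult_imp_div_less[of v M "3 * W"] by (simp add: r_def v0_def algebra_simps)
  have set_bonus: "set (bonus \<rho> i) \<subseteq> {sb \<rho> i..sb \<rho> i + 2}" for \<rho> i by (auto simp: bonus_def)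
  have set_pre: "\<exists>i<W. v \<in> {sb \<rho> i..sb \<rho> i + 2}" if "v \<in> set (pre \<rho>)" "\<rho> < M" for v \<rho>
  proof -
    from that obtain i where "i < \<rho>" "v \<in> set (bonus \<rho> i)" by (auto simp: pre_def)
    moreover from \<open>i < \<rho>\<close> have "i < W" using that(2) by (simp add: W_def)
    ultimately show ?thesis using set_bonus by blast
  qed
  have set_suf: "\<exists>i<W. v \<in> {sb \<rho> i..sb \<rho> i + 2}" if "v \<in> set (suf \<rho>)" "\<rho> < M" for v \<rho>
  proof -
    from that obtain i where "i < M - 1 - \<rho>" "v \<in> set (bonus \<rho> (M + B + i))" by (auto simp: suf_def)
    moreover from \<open>i < M - 1 - \<rho>\<close> have "M + B + i < W" by (simp add: W_def)
    ultimately show ?thesis using set_bonus by blast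
  qed
  have set_half: "set (half i s Y) \<subseteq> {s..s + 2}" for i s Y
    using set_halves by (auto simp: half_def)
  have set_col: "set (col c x) \<subseteq> {..<v0}" if "c < 2 * B" for c x
  proof
    fix v assume "v \<in> set (col c x)"
    then obtain \<rho> where \<rho>: "\<rho> < M" "v \<in> set (half (c mod 2) (sb \<rho> (M + c div 2)) (x (\<rho>, c div 2)))"
      by (auto simp: col_def)
    have "M + c div 2 < W" using that by (auto simp: W_def)
    with \<rho> show "v \<in> {..<v0}" using set_half v0 by blast
  qed
  have set_pre': "v < v0" if "v \<in> set (concat (map pre (rev [0..<M])))" for v
  proof -
    from that obtain \<rho> where "\<rho> < M" "v \<in> set (pre \<rho>)" by auto
    then show ?thesis using set_pre v0 by blast
  qed
  have set_suf': "v < v0" if "v \<in> set ?suf" for v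
  proof -
    from that obtain \<rho> where "\<rho> < M" "v \<in> set (suf \<rho>)" by auto
    then show ?thesis using set_suf v0 by blast
  qed
  have len_bonus: "length (bonus \<rho> i) = H" for \<rho> i by (simp add: bonus_def H)
  have len_pre: "length (pre \<rho>) = \<rho> * H" for \<rho>
    by (simp add: pre_def length_concat_map_upt len_bonus)
  have len_suf: "length (suf \<rho>) = (M - 1 - \<rho>) * H" for \<rho>
    by (simp add: suf_def length_concat_map_upt len_bonus)
  have len_bonuses: "length (concat (map pre (rev [0..<M]))) + length ?suf = M * (M - 1) * H"
  proof -
    have rev: "length (concat (map f (rev [0..<M]))) = (\<Sum>\<rho><M. length (f \<rho>))" for f :: "nat \<Rightarrow> nat list"
      by (induction M) auto
    have "(\<Sum>\<rho><M. \<rho> * H) + (\<Sum>\<rho><M. (M - 1 - \<rho>) * H) = (\<Sum>\<rho><M. (M - 1) * H)"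
      unfolding sum.distrib[symmetric] by (intro sum.cong) (auto simp: add_mult_distrib[symmetric])
    then show ?thesis by (simp add: rev len_pre len_suf)
  qed
  have len_cols: "length (concat (map (\<lambda>c. col c (z c)) [0..<2 * B])) = M * B * (e + 6 * u * k)" for z
  proof -
    have len_col: "length (col (b * 2) x) = M * (3 * u * k)" "length (col (Suc (b * 2)) x) = M * (e + 3 * u * k)" for b x
      by (simp_all add: col_def half_def length_concat_map_upt length_first_half length_second_half)
    show ?thesis
      unfolding concat_map_upt_mult by (simp add: length_concat_map_upt len_col upt2 algebra_simps)
  qed
  have "LNST_space_ge {..<m} n t \<epsilon> R
    (real M * log 2 (real (card (Pow {..<k})) / real 1) / (2 * real (2 + 1) * real R))"
  proof (rule space_ge_if_rich_gap[where pre = ?pre and suf = ?suf and col = col and l = ?h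
        and l' = "real ?h + real u * real B / 2"])
    have vm: "v0 + 1 \<le> m" using m by (simp add: v0_def W_def)
    then have lt: "v < m" if "v < v0" for v using that by simp
    have "set (padding v0 1 l l) \<subseteq> {..<m}" using set_padding[of v0 1 l l] vm by auto
    moreover have "set (concat (map pre (rev [0..<M]))) \<subseteq> {..<m}" using set_pre' lt by blast
    ultimately show "set ?pre \<subseteq> {..<m}" by (simp only: set_append Un_subset_iff)
    show "set ?suf \<subseteq> {..<m}" using set_suf' lt by blast
    show "set (col c x) \<subseteq> {..<m}" if "c < 2 * B" for c x using set_col[OF that] lt by blast
    show "length (mix ?pre col ?suf (2 * B) z) = n" for z
      using len_bonuses len_cols[of z] length_padding[of l 1 l v0] by (simp add: mix_def n)
    show "LNST (mix ?pre col ?suf (2 * B) (\<lambda>_. x)) t \<le> ?h" if x: "x \<in> ?X" for x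
    proof (rule LNST_le)
      let ?main = "concat (map (\<lambda>c. col c x) [0..<2 * B])"
      fix y assume "subseq y (mix ?pre col ?suf (2 * B) (\<lambda>_. x))" and ad: "admissible t y"
      then have y: "subseq y (padding v0 1 l l @ (concat (map pre (rev [0..<M])) @ ?main @ ?suf))"
        by (simp add: mix_def)
      show "length y \<le> ?h"
      proof (rule length_le_padding[OF y ad])
        show "a < v0" if "a \<in> set (concat (map pre (rev [0..<M])) @ ?main @ ?suf)" for a
          using that set_pre' set_suf' set_col by fastforce
        have "t * 1 \<le> ?h" using M B by (intro mult_le_mono) (auto simp: H)
        then show "l \<le> ?h \<or> t \<le> ?h" by simp
        fix y assume "subseq y (concat (map pre (rev [0..<M])) @ ?main @ ?suf)" and ad: "admissible t y"
        then obtain y0 y1 y2 where y: "y = y0 @ y1 @ y2" "subseq y0 (concat (map pre (rev [0..<M])))"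
          "subseq y1 ?main" "subseq y2 ?suf"
          by (metis subseq_appendE)
        have ad: "admissible t y0" "admissible t y1" "admissible t y2"
          and le: "\<And>a b. a \<in> set y0 \<Longrightarrow> b \<in> set y1 \<Longrightarrow> r a \<le> r b"
            "\<And>a b. a \<in> set y0 \<Longrightarrow> b \<in> set y2 \<Longrightarrow> r a \<le> r b"
            "\<And>a b. a \<in> set y1 \<Longrightarrow> b \<in> set y2 \<Longrightarrow> r a \<le> r b"
          using admissible_appendD[of t y0 "y1 @ y2"] admissible_appendD[of t y1 y2] ad
          by (auto simp: y(1) intro!: monoD[OF mono_r])
        have sorted: "sorted y0" "sorted y2" using ad by (auto simp: admissible_def)
        \<comment> \<open>An empty part counts as row \<open>0\<close> in front and as row
          \<open>M - 1\<close> behind, the rows without additional cells there, so the telescoping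
          sum also covers these cases.\<close>
        have "\<exists>\<rho><M. length y0 \<le> \<rho> * H \<and> (y0 \<noteq> [] \<longrightarrow> (\<forall>v\<in>set y0. r v = \<rho>)) \<and> (y0 = [] \<longrightarrow> \<rho> = 0)"
        proof (cases "y0 = []")
          case False
          have pre_row: "r v = \<rho>" if "\<rho> < M" "v \<in> set (pre \<rho>)" for \<rho> v
            using set_pre[OF that(2,1)] r_cell by blast
          obtain \<rho> where \<rho>: "\<rho> < M" "subseq y0 (pre \<rho>)"
            using subseq_decreasing_rows[of r M pre, OF mono_r pre_row y(2) sorted(1) False] by blast
          then have "length y0 \<le> \<rho> * H" using list_emb_length[OF \<rho>(2)] by (simp add: len_pre)
          moreover have "\<forall>v\<in>set y0. r v = \<rho>" using subseq_set_subset[OF \<rho>(2)] pre_row \<rho>(1) by blast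
          ultimately show ?thesis using \<rho>(1) False by blast
        qed (use M in auto)
        then obtain \<rho>0 where \<rho>0: "\<rho>0 < M" "length y0 \<le> \<rho>0 * H" "\<And>v. v \<in> set y0 \<Longrightarrow> r v = \<rho>0" "y0 = [] \<Longrightarrow> \<rho>0 = 0"
          by (metis length_greater_0_conv length_pos_if_in_set)
        have "\<exists>\<rho><M. length y2 \<le> (M - 1 - \<rho>) * H \<and> (y2 \<noteq> [] \<longrightarrow> (\<forall>v\<in>set y2. r v = \<rho>)) \<and> (y2 = [] \<longrightarrow> \<rho> = M - 1)"
        proof (cases "y2 = []")
          case False
          have suf_row: "r v = \<rho>" if "\<rho> < M" "v \<in> set (suf \<rho>)" for \<rho> v
            using set_suf[OF that(2,1)] r_cell by blast
          obtain \<rho> where \<rho>: "\<rho> < M" "subseq y2 (suf \<rho>)"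
            using subseq_decreasing_rows[of r M suf, OF mono_r suf_row y(4) sorted(2) False] by blast
          then have "length y2 \<le> (M - 1 - \<rho>) * H" using list_emb_length[OF \<rho>(2)] by (simp add: len_suf)
          moreover have "\<forall>v\<in>set y2. r v = \<rho>" using subseq_set_subset[OF \<rho>(2)] suf_row \<rho>(1) by blast
          ultimately show ?thesis using \<rho>(1) False by blast
        qed (use M in auto)
        then obtain \<rho>2 where \<rho>2: "\<rho>2 < M" "length y2 \<le> (M - 1 - \<rho>2) * H" "\<And>v. v \<in> set y2 \<Longrightarrow> r v = \<rho>2" "y2 = [] \<Longrightarrow> \<rho>2 = M - 1"
          by (metis length_greater_0_conv length_pos_if_in_set)
        have \<rho>02: "\<rho>0 \<le> \<rho>2"
        proof (cases "y0 = [] \<or> y2 = []")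
          case True
          then show ?thesis using \<rho>0(1,4) \<rho>2(4) by auto
        next
          case False
          then show ?thesis using le(2)[of "hd y0" "hd y2"] \<rho>0(3) \<rho>2(3) by simp
        qed
        \<comment> \<open>Along \<open>y1\<close> the key climbs at most from \<open>\<rho>0\<close>
          to \<open>\<rho>2\<close>, which gains at most \<open>H\<close> per row. Adding the
          \<open>\<rho>0\<close> cells in front and the \<open>M - 1 - \<rho>2\<close> cells behind
          gives \<open>H * (B + M - 1)\<close>, whatever the climb.\<close>
        have "length y1 + H * \<rho>0 \<le> H * (B + \<rho>2)"
        proof (cases "y1 = []")
          case True
          then show ?thesis using \<rho>02 by simp
        next
          case False
          let ?blocks = "map (\<lambda>b. concat (map (\<lambda>i. col (b * 2 + i) x) [0..<2])) [0..<B]"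
          have sub: "subseq y1 (concat ?blocks)" using y(3) by (simp only: concat_map_upt_mult)
          have "length y1 + H * r (hd y1) \<le> H * (length ?blocks + r (last y1))"
          proof (rule length_le_rows_blocks[OF mono_r _ sub ad(2) False])
            fix w \<rho> y assume w: "w \<in> set ?blocks" and y: "subseq y (filter (\<lambda>v. r v = \<rho>) w)" and ad: "admissible t y"
            from w obtain b where b: "b < B" "w = concat (map (\<lambda>i. col (b * 2 + i) x) [0..<2])" by auto
            have w': "w = col (b * 2) x @ col (Suc (b * 2)) x" using b(2) by (simp add: upt2)
            let ?cell = "\<lambda>\<rho> i. half i (sb \<rho> (M + b)) (x (\<rho>, b))"
            have "M + b < W" using b(1) by (simp add: W_def)
            then have row: "r v = \<rho>" if "v \<in> set (?cell \<rho> i)" for v \<rho> i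
              using that set_half r_cell by blast
            have "filter (\<lambda>v. r v = \<rho>) w = (if \<rho> < M then ?cell \<rho> 0 @ ?cell \<rho> 1 else [])"
              unfolding w' col_def using filter_rows[of M "\<lambda>\<rho>. ?cell \<rho> 0" r \<rho>, OF row]
                filter_rows[of M "\<lambda>\<rho>. ?cell \<rho> 1" r \<rho>, OF row] by simp
            then have "\<rho> < M \<Longrightarrow> subseq y (first_half u k (sb \<rho> (M + b)) (x (\<rho>, b)) @ second_half e u k (sb \<rho> (M + b)) (x (\<rho>, b)))"
              "\<not> \<rho> < M \<Longrightarrow> y = []"
              using y by (auto simp: half_def dest: list_emb_Nil2)
            then have "length y \<le> e + 3 * u * k + 2 * u"
              using cell_length_le[OF k] ad t by (cases "\<rho> < M") auto
            then show "length y \<le> H" by (simp add: H t algebra_simps)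
          qed
          moreover have "\<rho>0 \<le> r (hd y1)"
          proof (cases "y0 = []")
            case False
            then show ?thesis using \<open>y1 \<noteq> []\<close> le(1)[of "hd y0" "hd y1"] \<rho>0(3)[of "hd y0"] by simp
          qed (simp add: \<rho>0(4))
          then have "H * \<rho>0 \<le> H * r (hd y1)" by (rule mult_le_mono2)
          moreover have "r (last y1) \<le> \<rho>2"
          proof (cases "y2 = []")
            case True
            have "last y1 \<in> set ?main" using False subseq_set_subset[OF y(3)] last_in_set by blast
            then have "last y1 < v0" using set_col by fastforce
            then have "r (last y1) < M" using rows by blast
            then show ?thesis using \<rho>2(4)[OF True] by simp
          next
            case False
            then show ?thesis using \<open>y1 \<noteq> []\<close> le(3)[of "last y1" "hd y2"] \<rho>2(3)[of "hd y2"] by simp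
          qed
          then have "H * (length ?blocks + r (last y1)) \<le> H * (B + \<rho>2)"
            by (intro mult_le_mono2) simp
          ultimately show ?thesis by linarith
        qed
        moreover have "?h = H * (B + \<rho>2) + (M - 1 - \<rho>2) * H"
        proof -
          have "B + M - 1 = (B + \<rho>2) + (M - 1 - \<rho>2)" using \<rho>2(1) by simp
          then show ?thesis by (simp only: distrib_left mult.commute)
        qed
        moreover have "length y = length y0 + length y1 + length y2" by (simp add: y(1))
        ultimately show "length y \<le> ?h" using \<rho>0(2) \<rho>2(2) by (simp add: mult.commute)
      qed
    qed
    fix \<rho> T assume \<rho>: "\<rho> < M" and T: "T \<subseteq> ?X" "T \<noteq> {}" and rich: "B < 2 * card (rich_blocks B 1 \<rho> T)"
    let ?A = "\<lambda>b. (\<lambda>x. x (\<rho>, b)) ` T"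
    let ?s = "\<lambda>b. sb \<rho> (M + b)"
    define Q where "Q b q \<longleftrightarrow> (case q of (x1, x2, p1, p2) \<Rightarrow> x1 \<in> T \<and> x2 \<in> T \<and>
      subseq p1 (first_half u k (?s b) (x1 (\<rho>, b))) \<and> subseq p2 (second_half e u k (?s b) (x2 (\<rho>, b))) \<and>
      admissible t (p1 @ p2) \<and> set (p1 @ p2) \<subseteq> {?s b..?s b + 2} \<and>
      H + (if b \<in> rich_blocks B 1 \<rho> T then u else 0) \<le> length (p1 @ p2))" for b q
    have ex: "\<exists>q. Q b q" if b: "b < B" for b
    proof -
      have "?A b \<subseteq> Pow {..<k}" using T(1) \<rho> b by (force simp: PiE_def Pi_def)
      moreover have "?A b \<noteq> {}" using T(2) by simp
      ultimately obtain Y1 Y2 where Y: "Y1 \<in> ?A b" "Y2 \<in> ?A b" and "\<And>s. \<exists>p1 p2. subseq p1 (first_half u k s Y1) \<and>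
        subseq p2 (second_half e u k s Y2) \<and> admissible t (p1 @ p2) \<and> set (p1 @ p2) \<subseteq> {s..s + 2} \<and>
        t + u * k + (if 1 < card (?A b) then u else 0) \<le> length (p1 @ p2)"
        using cell_mix[OF k, of "?A b" t e u] t by blast
      then obtain p1 p2 where p: "subseq p1 (first_half u k (?s b) Y1)" "subseq p2 (second_half e u k (?s b) Y2)"
        "admissible t (p1 @ p2)" "set (p1 @ p2) \<subseteq> {?s b..?s b + 2}"
        "t + u * k + (if 1 < card (?A b) then u else 0) \<le> length (p1 @ p2)" by blast
      obtain x1 x2 where x: "x1 \<in> T" "Y1 = x1 (\<rho>, b)" "x2 \<in> T" "Y2 = x2 (\<rho>, b)" using Y by blast
      have "Q b (x1, x2, p1, p2)" using x p b by (simp add: Q_def H rich_blocks_def)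
      then show ?thesis ..
    qed
    define q where "q b = (SOME q. Q b q)" for b
    have q: "Q b (q b)" if "b < B" for b unfolding q_def by (rule someI_ex[OF ex[OF that]])
    define p1 where "p1 b = fst (snd (snd (q b)))" for b
    define p2 where "p2 b = snd (snd (snd (q b)))" for b
    \<comment> \<open>Even columns hold first halves and odd columns second halves, so the two
      halves of a cell may come from different arrays.\<close>
    define z where "z c = (if c mod 2 = 0 then fst (q (c div 2)) else fst (snd (q (c div 2))))" for c
    have z: "z (b * 2) \<in> T" "z (Suc (b * 2)) \<in> T"
      "subseq (p1 b) (half 0 (?s b) (z (b * 2) (\<rho>, b)))" "subseq (p2 b) (half 1 (?s b) (z (Suc (b * 2)) (\<rho>, b)))"
      "admissible t (p1 b @ p2 b)" "set (p1 b @ p2 b) \<subseteq> {?s b..?s b + 2}"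
      "H + (if b \<in> rich_blocks B 1 \<rho> T then u else 0) \<le> length (p1 b @ p2 b)" if "b < B" for b
      using q[OF that] by (auto simp: Q_def z_def p1_def p2_def half_def case_prod_unfold)
    have zT: "\<forall>c<2 * B. z c \<in> T"
    proof (intro allI impI)
      fix c assume "c < 2 * B"
      then have "c div 2 < B" by auto
      then show "z c \<in> T" using q[of "c div 2"] by (auto simp: Q_def z_def case_prod_unfold)
    qed
    let ?path = "concat (map (\<lambda>b. p1 b @ p2 b) [0..<B])"
    have "subseq (pre \<rho>) (concat (map pre (rev [0..<M])))" using \<rho> by (intro subseq_member_concat) simp
    moreover have "subseq (suf \<rho>) ?suf" using \<rho> by (intro subseq_member_concat) simp
    moreover have "subseq ?path (concat (map (\<lambda>c. col c (z c)) [0..<2 * B]))"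
      unfolding concat_map_upt_mult
    proof (rule subseq_concat_map)
      fix b assume "b \<in> set [0..<B]"
      then have b: "b < B" by simp
      have "subseq (half i (?s b) (z' (\<rho>, b))) (concat (map (\<lambda>\<rho>. half i (sb \<rho> (M + b)) (z' (\<rho>, b))) [0..<M]))" for i z'
        using \<rho> by (intro subseq_member_concat[where f = "\<lambda>\<rho>. half i (sb \<rho> (M + b)) (z' (\<rho>, b))"]) simp
      then have "subseq (p1 b) (col (b * 2) (z (b * 2)))" "subseq (p2 b) (col (Suc (b * 2)) (z (Suc (b * 2))))"
        using z(3,4)[OF b] unfolding col_def by (auto intro: subseq_order.order_trans)
      then have "subseq (p1 b @ p2 b) (col (b * 2) (z (b * 2)) @ col (Suc (b * 2)) (z (Suc (b * 2))))"
        by (rule list_emb_append_mono)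
      then show "subseq (p1 b @ p2 b) (concat (map (\<lambda>i. col (b * 2 + i) (z (b * 2 + i))) [0..<2]))"
        by (simp add: upt2)
    qed
    ultimately have "subseq (pre \<rho> @ ?path @ suf \<rho>) (mix ?pre col ?suf (2 * B) z)"
      unfolding mix_def by (simp only: append_assoc) (intro subseq_drop_many list_emb_append_mono)
    moreover have "admissible t (pre \<rho> @ ?path @ suf \<rho>)"
    proof -
      have bonus: "admissible t (bonus \<rho> i)" for i
        unfolding bonus_def
        by (intro admissible_append admissible_constant[where a = "sb \<rho> i"] admissible_constant[where a = "sb \<rho> i + 1"])
          (auto simp: t)
      have in_pre: "\<exists>i<M. v \<in> {sb \<rho> i..sb \<rho> i + 2}" if "v \<in> set (pre \<rho>)" for v
      proof -
        from that obtain i where "i < \<rho>" "v \<in> set (bonus \<rho> i)" by (auto simp: pre_def)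
        then show ?thesis using set_bonus[of \<rho> i] \<rho> by (intro exI[of _ i]) auto
      qed
      have in_path: "\<exists>i. M \<le> i \<and> i < M + B \<and> v \<in> {sb \<rho> i..sb \<rho> i + 2}" if "v \<in> set ?path" for v
      proof -
        from that obtain b where "b < B" "v \<in> set (p1 b @ p2 b)" by auto
        then have "v \<in> {?s b..?s b + 2}" using z(6) by blast
        then show ?thesis using \<open>b < B\<close> by (intro exI[of _ "M + b"]) simp
      qed
      have in_suf: "\<exists>i. M + B \<le> i \<and> v \<in> {sb \<rho> i..sb \<rho> i + 2}" if "v \<in> set (suf \<rho>)" for v
      proof -
        from that obtain i where "v \<in> set (bonus \<rho> (M + B + i))" by (auto simp: suf_def)
        then show ?thesis using set_bonus[of \<rho> "M + B + i"] by (intro exI[of _ "M + B + i"]) auto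
      qed
      have "admissible t (pre \<rho>)" unfolding pre_def
      proof (rule admissible_concat[OF bonus])
        fix i j a b assume "i < j" "a \<in> set (bonus \<rho> i)" "b \<in> set (bonus \<rho> j)"
        then show "a < b" using set_bonus by (intro lt_cell[of a \<rho> i b j]) blast+
      qed
      moreover have "admissible t ?path"
      proof (rule admissible_concat[OF z(5)])
        fix i j a b assume ij: "i < j" "j < B" "a \<in> set (p1 i @ p2 i)" "b \<in> set (p1 j @ p2 j)"
        then have "a \<in> {?s i..?s i + 2}" "b \<in> {?s j..?s j + 2}" using z(6)[of i] z(6)[of j] by auto
        then show "a < b" by (rule lt_cell) (use ij in simp)
      qed
      moreover have "admissible t (suf \<rho>)" unfolding suf_def
      proof (rule admissible_concat[OF bonus])
        fix i j a b assume "i < j" "a \<in> set (bonus \<rho> (M + B + i))" "b \<in> set (bonus \<rho> (M + B + j))"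
        then show "a < b" using set_bonus by (intro lt_cell[of a \<rho> "M + B + i" b "M + B + j"]) (blast | simp)+
      qed
      moreover have "a < b" if a: "a \<in> set (pre \<rho>)" and b: "b \<in> set (?path @ suf \<rho>)" for a b
      proof -
        obtain i where i: "i < M" "a \<in> {sb \<rho> i..sb \<rho> i + 2}" using in_pre[OF a] by blast
        obtain j where j: "M \<le> j" "b \<in> {sb \<rho> j..sb \<rho> j + 2}"
          using b in_path in_suf by (metis Un_iff le_add1 le_trans set_append)
        show ?thesis using lt_cell[OF i(2) j(2)] i(1) j(1) by simp
      qed
      moreover have "a < b" if a: "a \<in> set ?path" and b: "b \<in> set (suf \<rho>)" for a b
      proof -
        obtain i where i: "i < M + B" "a \<in> {sb \<rho> i..sb \<rho> i + 2}" using in_path[OF a] by blast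
        obtain j where j: "M + B \<le> j" "b \<in> {sb \<rho> j..sb \<rho> j + 2}" using in_suf[OF b] by blast
        show ?thesis using lt_cell[OF i(2) j(2)] i(1) j(1) by simp
      qed
      ultimately show ?thesis by (intro admissible_append)
    qed
    ultimately have "length (pre \<rho> @ ?path @ suf \<rho>) \<le> LNST (mix ?pre col ?suf (2 * B) z) t"
      by (rule LNST_ge)
    moreover have "real ?h + real u * real B / 2 \<le> real (length (pre \<rho> @ ?path @ suf \<rho>))"
    proof -
      have "(\<Sum>b<B. H + (if b \<in> rich_blocks B 1 \<rho> T then u else 0)) \<le> length ?path"
        unfolding length_concat_map_upt using z(7) by (intro sum_mono) simp
      moreover have "(\<Sum>b<B. H + (if b \<in> rich_blocks B 1 \<rho> T then u else 0))
          = H * B + card (rich_blocks B 1 \<rho> T) * u"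
      proof -
        have "{..<B} \<inter> rich_blocks B 1 \<rho> T = rich_blocks B 1 \<rho> T" by (auto simp: rich_blocks_def)
        then show ?thesis by (simp add: sum.distrib sum.inter_restrict[symmetric])
      qed
      moreover have "?h = \<rho> * H + H * B + (M - 1 - \<rho>) * H"
      proof -
        have "B + M - 1 = \<rho> + B + (M - 1 - \<rho>)" using \<rho> by simp
        then show ?thesis by (simp only: distrib_left mult.commute)
      qed
      ultimately have "?h + card (rich_blocks B 1 \<rho> T) * u \<le> length (pre \<rho> @ ?path @ suf \<rho>)"
        by (simp add: len_pre len_suf)
      then have "real (?h + card (rich_blocks B 1 \<rho> T) * u) \<le> real (length (pre \<rho> @ ?path @ suf \<rho>))"
        by (rule of_nat_mono)
      moreover have "real u * (real B / 2) \<le> real u * real (card (rich_blocks B 1 \<rho> T))"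
        using rich by (intro mult_left_mono) auto
      ultimately show ?thesis by (simp add: mult.commute)
    qed
    ultimately show "\<exists>z. (\<forall>c<2 * B. z c \<in> T) \<and>
        real ?h + real u * real B / 2 \<le> real (LNST (mix ?pre col ?suf (2 * B) z) t)"
      using zT by (intro exI[of _ z]) force
  qed (use B R eps gap in \<open>auto simp: algebra_simps card_Pow\<close>)
  then show ?thesis by (simp add: card_Pow log_nat_power)
qed

text \<open>The error term is at most \<open>\<epsilon> * (2 * t) * (2 * M)\<close>, hence at most
  \<open>4 * b * M\<close>, and a constant \<open>u\<close> with \<open>8 * b \<le> u\<close> lets
  the gain \<open>u * M / 2\<close> exceed it. So \<open>k\<close> remains of order
  \<open>t / u\<close>, that is \<open>1 / \<epsilon>\<close>. With \<open>B = M\<close> the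
  alphabet needs \<open>9 * M ^ 2 + 1\<close> symbols and the length is at most
  \<open>5 * M ^ 2 * t\<close>; \<open>K\<close> is chosen to fit both. The 96 is
  \<open>2 * 8 * 6\<close>.\<close>

lemma inverse_eps_threshold_large:
  fixes C a b :: real
  assumes C: "0 < C" and a: "0 < a" and b: "0 < b" and u: "8 * b \<le> real u" "1 \<le> u"
  shows "\<exists>c>0. \<exists>N. \<forall>n m R t \<epsilon>. N \<le> m \<and> 1 \<le> R \<and> 0 < \<epsilon> \<and> 8 * u \<le> t \<and> a / \<epsilon> \<le> real t \<and>
      real t \<le> b / \<epsilon> \<and> real m / \<epsilon> \<le> C * real n \<longrightarrow>
      LNST_space_ge {..<m} n t \<epsilon> R (c * (sqrt (real m) / \<epsilon> / real R))"
proof -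
  define K where "K = 4 + 5 * b * C"
  have K: "4 \<le> K" "5 * b * C \<le> K" using b C by (auto simp: K_def)
  let ?c = "a / (96 * K * real u)"
  define N where "N = nat \<lceil>K\<^sup>2\<rceil>"
  have "LNST_space_ge {..<m} n t \<epsilon> R (?c * (sqrt (real m) / \<epsilon> / real R))"
    if N: "N \<le> m" and R: "1 \<le> R" and eps: "0 < \<epsilon>" and t8: "8 * u \<le> t" and t: "a / \<epsilon> \<le> real t" "real t \<le> b / \<epsilon>"
      and mn: "real m / \<epsilon> \<le> C * real n" for n m R t \<epsilon>
  proof -
    have "K\<^sup>2 \<le> real N" unfolding N_def by linarith
    then have mK: "K\<^sup>2 \<le> real m" using N by linarith
    then have sqrtK: "K \<le> sqrt (real m)" using K by (intro real_le_rsqrt) auto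
    define M where "M = nat \<lfloor>sqrt (real m) / K\<rfloor>"
    have q1: "1 \<le> sqrt (real m) / K" using sqrtK K by simp
    have M_le: "real M \<le> sqrt (real m) / K" using q1 by (simp add: M_def)
    have M1: "1 \<le> M" using q1 unfolding M_def by (simp add: le_nat_floor)
    have M_ge: "sqrt (real m) / (2 * K) \<le> real M"
    proof -
      have "sqrt (real m) / K < real M + 1" using q1 unfolding M_def by linarith
      then have "sqrt (real m) / K \<le> 2 * real M" using M1 by linarith
      then show ?thesis using K by (simp add: field_simps)
    qed
    have M2: "(real M)\<^sup>2 * K\<^sup>2 \<le> real m"
    proof -
      have "real M * K \<le> sqrt (real m)" using M_le K by (simp add: field_simps)
      then have "(real M * K)\<^sup>2 \<le> (sqrt (real m))\<^sup>2" using K by (intro power_mono) auto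
      then show ?thesis by (simp add: power_mult_distrib)
    qed
    have K2: "16 \<le> K\<^sup>2" "5 * b * C \<le> K\<^sup>2"
    proof -
      have "4\<^sup>2 \<le> K\<^sup>2" using K by (intro power_mono) auto
      then show "16 \<le> K\<^sup>2" by simp
      have "K * 1 \<le> K * K" using K by (intro mult_left_mono) auto
      then show "5 * b * C \<le> K\<^sup>2" using K(2) unfolding power2_eq_square by linarith
    qed
    define k where "k = t div (2 * u) - 1"
    define e where "e = t mod (2 * u)"
    define H where "H = t + u * k"
    have d4: "4 \<le> t div (2 * u)"
    proof -
      have "8 * u div (2 * u) \<le> t div (2 * u)" using t8 by (rule div_le_mono)
      moreover have "8 * u div (2 * u) = 4" using u(2) by simp
      ultimately show ?thesis by simp
    qed
    then have k: "1 \<le> k" "t div (2 * u) = k + 1" by (auto simp: k_def)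
    have te: "t = e + 2 * u * (k + 1)"
      using div_mult_mod_eq[of t "2 * u"] unfolding e_def k(2) by (simp add: mult.commute)
    then have te': "t = e + 2 * (u * k) + 2 * u" by simp
    then have uk: "2 * (u * k) + e \<le> t" by linarith
    have ek: "t \<le> 8 * (u * k)"
    proof -
      have "e < 2 * u" using u(2) by (simp add: e_def)
      moreover have "u * 1 \<le> u * k" using k(1) by (rule mult_le_mono2)
      ultimately show ?thesis using te' by linarith
    qed
    define len where "len = M * (M - 1) * H + M * M * (e + 6 * u * k)"
    have len: "len \<le> 5 * M\<^sup>2 * t"
    proof -
      have "len \<le> M * M * (2 * t) + M * M * (3 * t)"
        unfolding len_def using uk by (intro add_mono mult_le_mono) (auto simp: H_def)
      then show ?thesis by (simp add: power2_eq_square)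
    qed
    have "real len \<le> real n"
    proof -
      have "real len \<le> 5 * (real M)\<^sup>2 * real t"
        using of_nat_mono[OF len, where ?'a = real] by simp
      also have "\<dots> \<le> 5 * (real M)\<^sup>2 * (b / \<epsilon>)" using t by (intro mult_left_mono) auto
      finally have 1: "real len \<le> 5 * (real M)\<^sup>2 * (b / \<epsilon>)" .
      have "K\<^sup>2 * real len \<le> K\<^sup>2 * (5 * (real M)\<^sup>2 * (b / \<epsilon>))" using 1 by (intro mult_left_mono) auto
      also have "\<dots> = (real M)\<^sup>2 * K\<^sup>2 * (5 * b / \<epsilon>)" by simp
      also have "\<dots> \<le> real m * (5 * b / \<epsilon>)" using M2 b eps by (intro mult_right_mono) auto
      also have "\<dots> = 5 * b * (real m / \<epsilon>)" by simp
      also have "\<dots> \<le> 5 * b * (C * real n)" using mn b by (intro mult_left_mono) auto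
      also have "\<dots> = 5 * b * C * real n" by simp
      also have "\<dots> \<le> K\<^sup>2 * real n" using K2 by (intro mult_right_mono) auto
      finally show ?thesis by (rule mult_left_le_imp_le) (use K2 in linarith)
    qed
    then have "len \<le> n" by simp
    have "LNST_space_ge {..<m} n t \<epsilon> R (real M * real k / (6 * real R))"
    proof (rule tilted_space_ge[where B = M and l = "n - len"])
      show "n = n - len + M * (M - 1) * H + M * M * (e + 6 * u * k)"
        using \<open>len \<le> n\<close> by (simp add: len_def)
      have "real (9 * M\<^sup>2 + 1) \<le> real m"
      proof -
        have "(real M)\<^sup>2 * 16 \<le> (real M)\<^sup>2 * K\<^sup>2" using K2 by (intro mult_left_mono) auto
        then have "16 * (real M)\<^sup>2 \<le> real m" using M2 by simp
        moreover have "1 \<le> (real M)\<^sup>2" using M1 by simp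
        ultimately show ?thesis by simp
      qed
      then have "9 * M\<^sup>2 + 1 \<le> m" by (simp only: of_nat_le_iff)
      then show "3 * (M * (2 * M + M)) + 1 \<le> m" by (simp add: power2_eq_square)
      have "real H \<le> 2 * real t"
      proof -
        have "H \<le> 2 * t" using uk by (simp add: H_def)
        then show ?thesis by linarith
      qed
      then have "\<epsilon> * real H \<le> \<epsilon> * (2 * real t)" using eps by simp
      also have "\<dots> \<le> \<epsilon> * (2 * (b / \<epsilon>))" using t(2) eps by (intro mult_left_mono) auto
      also have "\<dots> = 2 * b" using eps by simp
      finally have "\<epsilon> * real H * real (M + M - 1) \<le> 2 * b * real (M + M - 1)"
        by (rule mult_right_mono) simp
      also have "\<dots> < 2 * b * (2 * real M)" using b M1 by (intro mult_strict_left_mono) auto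
      also have "\<dots> = 8 * b * (real M / 2)" by simp
      also have "\<dots> \<le> real u * (real M / 2)" using u by (intro mult_right_mono) auto
      finally show "\<epsilon> * real (H * (M + M - 1)) < real u * real M / 2" by simp
    qed (use k(1) M1 R eps te H_def in auto)
    moreover have "?c * (sqrt (real m) / \<epsilon> / real R) \<le> real M * real k / (6 * real R)"
    proof -
      have "a / \<epsilon> \<le> 8 * (real u * real k)"
        using t(1) of_nat_mono[OF ek, where ?'a = real] by simp
      then have "a / (8 * real u * \<epsilon>) \<le> real k" using u(2) eps by (simp add: field_simps)
      then have "sqrt (real m) / (2 * K) * (a / (8 * real u * \<epsilon>)) \<le> real M * real k"
        using M_ge a eps by (intro mult_mono) auto
      then have "sqrt (real m) / (2 * K) * (a / (8 * real u * \<epsilon>)) / (6 * real R) \<le> real M * real k / (6 * real R)"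
        by (intro divide_right_mono) auto
      moreover have "?c * (sqrt (real m) / \<epsilon> / real R) = sqrt (real m) / (2 * K) * (a / (8 * real u * \<epsilon>)) / (6 * real R)"
        by (simp add: mult_ac)
      ultimately show ?thesis by simp
    qed
    ultimately show ?thesis by (rule space_ge_mono)
  qed
  then show ?thesis using K a u by (intro exI[of _ ?c] conjI exI[of _ N]) auto
qed

text \<open>A threshold below \<open>8 * u\<close> is too small for the cells. Then \<open>t\<close>
  is bounded, so \<open>\<epsilon>\<close> lies between positive constants and the claim is only of
  order \<open>sqrt m\<close>. This follows from the bound for constant thresholds, because
  \<open>m \<le> C * b * n\<close>.\<close>

lemma inverse_eps_threshold_space_ge:
  fixes C a b :: real
  assumes C: "0 < C" and a: "0 < a" and b: "0 < b"
  shows "\<exists>c>0. \<exists>N. \<forall>n m R t \<epsilon>. N \<le> n \<and> N \<le> m \<and> 1 \<le> R \<and> 0 < \<epsilon> \<and> a / \<epsilon> \<le> real t \<and>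
      real t \<le> b / \<epsilon> \<and> real m / \<epsilon> \<le> C * real n \<longrightarrow>
      LNST_space_ge {..<m} n t \<epsilon> R (c * (sqrt (real m) / \<epsilon> / real R))"
proof -
  define u where "u = nat \<lceil>8 * b\<rceil>"
  have u: "8 * b \<le> real u" unfolding u_def by linarith
  then have u1: "1 \<le> u" using b by (cases u) auto
  from inverse_eps_threshold_large[OF C a b u u1] obtain c1 N1 where c1: "0 < c1"
    and large: "\<And>n m R t \<epsilon>. N1 \<le> m \<Longrightarrow> 1 \<le> R \<Longrightarrow> 0 < \<epsilon> \<Longrightarrow> 8 * u \<le> t \<Longrightarrow> a / \<epsilon> \<le> real t \<Longrightarrow>
      real t \<le> b / \<epsilon> \<Longrightarrow> real m / \<epsilon> \<le> C * real n \<Longrightarrow>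
      LNST_space_ge {..<m} n t \<epsilon> R (c1 * (sqrt (real m) / \<epsilon> / real R))"
    by blast
  from constant_threshold_space_ge[OF b, of "8 * u"] obtain c2 N2 where c2: "0 < c2"
    and small: "\<And>n m R t \<epsilon>. N2 \<le> n \<Longrightarrow> N2 \<le> m \<Longrightarrow> 1 \<le> R \<Longrightarrow> 1 \<le> t \<Longrightarrow> t \<le> 8 * u \<Longrightarrow> 0 < \<epsilon> \<Longrightarrow> \<epsilon> \<le> b \<Longrightarrow>
      LNST_space_ge {..<m} n t \<epsilon> R (c2 * (min (sqrt (real n)) (real m) / real R))"
    by blast
  define g where "g = min 1 (1 / sqrt (C * b))"
  have g: "0 < g" "g \<le> 1" "g \<le> 1 / sqrt (C * b)" using C b by (auto simp: g_def)
  define c where "c = min c1 (c2 * g * (a / (8 * real u)))"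
  have c: "0 < c" "c \<le> c1" "c \<le> c2 * g * (a / (8 * real u))"
    using c1 c2 g a u1 by (auto simp: c_def)
  have "LNST_space_ge {..<m} n t \<epsilon> R (c * (sqrt (real m) / \<epsilon> / real R))"
    if N: "max N1 (max N2 1) \<le> n" "max N1 (max N2 1) \<le> m" and R: "1 \<le> R" and eps: "0 < \<epsilon>"
      and t: "a / \<epsilon> \<le> real t" "real t \<le> b / \<epsilon>" and mn: "real m / \<epsilon> \<le> C * real n" for n m R t \<epsilon>
  proof (cases "8 * u \<le> t")
    case True
    have "c * (sqrt (real m) / \<epsilon> / real R) \<le> c1 * (sqrt (real m) / \<epsilon> / real R)"
      using c eps by (intro mult_right_mono) auto
    with large[of m R \<epsilon> t n] show ?thesis using True N R eps t mn by (auto intro: space_ge_mono)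
  next
    case False
    have "0 < real t" using t(1) a eps by (meson divide_pos_pos less_le_trans)
    then have t1: "1 \<le> t" by simp
    have "\<epsilon> * 1 \<le> \<epsilon> * real t" using t1 eps by (intro mult_left_mono) auto
    also have "\<dots> \<le> b" using t(2) eps by (simp add: field_simps)
    finally have eb: "\<epsilon> \<le> b" by simp
    have space: "LNST_space_ge {..<m} n t \<epsilon> R (c2 * (min (sqrt (real n)) (real m) / real R))"
      using N R eps t1 False eb by (intro small) auto
    have "g * sqrt (real m) \<le> sqrt (real n)"
    proof -
      have "real m \<le> C * real n * \<epsilon>" using mn eps by (simp add: field_simps)
      also have "\<dots> \<le> C * real n * b" using eb C by (intro mult_left_mono) auto
      finally have "sqrt (real m) \<le> sqrt (C * b * real n)" by (simp add: algebra_simps)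
      then have "sqrt (real m) / sqrt (C * b) \<le> sqrt (real n)"
        using C b by (simp add: real_sqrt_mult field_simps)
      moreover have "g * sqrt (real m) \<le> 1 / sqrt (C * b) * sqrt (real m)"
        using g by (intro mult_right_mono) auto
      ultimately show ?thesis by simp
    qed
    moreover have "g * sqrt (real m) \<le> real m"
    proof -
      have "sqrt (real m) \<le> real m" using N(2) by (intro real_le_lsqrt) (auto simp: power2_eq_square)
      moreover have "g * sqrt (real m) \<le> 1 * sqrt (real m)" using g by (intro mult_right_mono) auto
      ultimately show ?thesis by simp
    qed
    ultimately have min: "g * sqrt (real m) \<le> min (sqrt (real n)) (real m)" by simp
    have "a / \<epsilon> \<le> 8 * real u" using t(1) False by linarith
    then have "a / (8 * real u) * (1 / \<epsilon>) \<le> 1" using u1 eps by (simp add: field_simps)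
    then have "c2 * g * (a / (8 * real u) * (1 / \<epsilon>)) \<le> c2 * g * 1"
      using c2 g by (intro mult_left_mono) auto
    moreover have "c * (1 / \<epsilon>) \<le> c2 * g * (a / (8 * real u)) * (1 / \<epsilon>)"
      using c eps by (intro mult_right_mono) auto
    ultimately have "c * (1 / \<epsilon>) \<le> c2 * g" by simp
    then have "c * (1 / \<epsilon>) * sqrt (real m) \<le> c2 * g * sqrt (real m)" by (rule mult_right_mono) simp
    also have "\<dots> \<le> c2 * min (sqrt (real n)) (real m)"
      using min c2 by (simp add: mult.assoc)
    finally have "c * (1 / \<epsilon>) * sqrt (real m) / real R \<le> c2 * min (sqrt (real n)) (real m) / real R"
      by (rule divide_right_mono) simp
    then show ?thesis by (intro space_ge_mono[OF space]) simp
  qed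
  then show ?thesis using c(1) by (intro exI[of _ c] conjI exI[of _ "max N1 (max N2 1)"]) auto
qed

theorem theorem1p6:
  "(\<forall>t::nat. \<forall>\<epsilon>::real. 1 \<le> t \<and> 0 < \<epsilon> \<longrightarrow>
      (\<exists>c>0. \<exists>N. \<forall>n. \<forall>S::'a::linorder set. \<forall>R::nat.
         N \<le> n \<and> finite S \<and> N \<le> card S \<and> 1 \<le> R \<and> t \<le> n \<longrightarrow>
         LNST_space_ge S n t \<epsilon> R (c * (min (sqrt (real n)) (real (card S)) / real R))))
   \<and>
   (\<forall>C::real. 0 < C \<longrightarrow>
      (\<exists>c>0. \<exists>N. \<forall>n. \<forall>S::'a set. \<forall>R::nat. \<forall>t::nat. \<forall>\<epsilon>::real.
         N \<le> n \<and> finite S \<and> N \<le> card S \<and> 1 \<le> R \<and> 0 < \<epsilon> \<and>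
         real n / real (card S) \<le> real t \<and> t \<le> n \<and>
         (real (card S))\<^sup>2 / \<epsilon> \<le> C * real n \<longrightarrow>
         LNST_space_ge S n t \<epsilon> R (c * (real (card S) * log 2 (1 / \<epsilon>) / real R))))
   \<and>
   (\<forall>C a b::real. 0 < C \<and> 0 < a \<and> 0 < b \<longrightarrow>
      (\<exists>c>0. \<exists>N. \<forall>n. \<forall>S::'a set. \<forall>R::nat. \<forall>t::nat. \<forall>\<epsilon>::real.
         N \<le> n \<and> finite S \<and> N \<le> card S \<and> 1 \<le> R \<and> 0 < \<epsilon> \<and>
         a / \<epsilon> \<le> real t \<and> real t \<le> b / \<epsilon> \<and> t \<le> n \<and>
         real (card S) / \<epsilon> \<le> C * real n \<longrightarrow>
         LNST_space_ge S n t \<epsilon> R (c * (sqrt (real (card S)) / \<epsilon> / real R))))"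
proof (intro conjI allI impI)
  fix t :: nat and \<epsilon> :: real assume "1 \<le> t \<and> 0 < \<epsilon>"
  then have t: "1 \<le> t" and eps: "0 < \<epsilon>" by auto
  from constant_threshold_space_ge[OF eps, of t] obtain c N where c: "0 < c"
    and sp: "\<And>n m R. N \<le> n \<Longrightarrow> N \<le> m \<Longrightarrow> 1 \<le> R \<Longrightarrow>
      LNST_space_ge {..<m} n t \<epsilon> R (c * (min (sqrt (real n)) (real m) / real R))"
    using t eps by (metis order_refl)
  show "\<exists>c>0. \<exists>N. \<forall>n. \<forall>S::'a set. \<forall>R::nat.
         N \<le> n \<and> finite S \<and> N \<le> card S \<and> 1 \<le> R \<and> t \<le> n \<longrightarrow>
         LNST_space_ge S n t \<epsilon> R (c * (min (sqrt (real n)) (real (card S)) / real R))"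
    by (intro exI[of _ c] conjI exI[of _ N] allI impI c) (elim conjE, rule space_ge_of_nat_alphabet, assumption, rule sp, assumption+)
next
  fix C :: real assume C: "0 < C"
  from unbounded_threshold_log_space_ge[OF C] obtain c N where c: "0 < c"
    and sp: "\<And>n m R t \<epsilon>. N \<le> m \<Longrightarrow> 1 \<le> R \<Longrightarrow> real n / real m \<le> real t \<Longrightarrow> 0 < \<epsilon> \<Longrightarrow>
      (real m)\<^sup>2 / \<epsilon> \<le> C * real n \<Longrightarrow>
      LNST_space_ge {..<m} n t \<epsilon> R (c * (real m * log 2 (1 / \<epsilon>) / real R))"
    by blast
  show "\<exists>c>0. \<exists>N. \<forall>n. \<forall>S::'a set. \<forall>R::nat. \<forall>t::nat. \<forall>\<epsilon>::real.
         N \<le> n \<and> finite S \<and> N \<le> card S \<and> 1 \<le> R \<and> 0 < \<epsilon> \<and>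
         real n / real (card S) \<le> real t \<and> t \<le> n \<and>
         (real (card S))\<^sup>2 / \<epsilon> \<le> C * real n \<longrightarrow>
         LNST_space_ge S n t \<epsilon> R (c * (real (card S) * log 2 (1 / \<epsilon>) / real R))"
    by (intro exI[of _ c] conjI exI[of _ N] allI impI c) (elim conjE, rule space_ge_of_nat_alphabet, assumption, rule sp, assumption+)
next
  fix C a b :: real assume "0 < C \<and> 0 < a \<and> 0 < b"
  then obtain c N where c: "0 < c"
    and sp: "\<And>n m R t \<epsilon>. N \<le> n \<Longrightarrow> N \<le> m \<Longrightarrow> 1 \<le> R \<Longrightarrow> 0 < \<epsilon> \<Longrightarrow> a / \<epsilon> \<le> real t \<Longrightarrow>
      real t \<le> b / \<epsilon> \<Longrightarrow> real m / \<epsilon> \<le> C * real n \<Longrightarrow>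
      LNST_space_ge {..<m} n t \<epsilon> R (c * (sqrt (real m) / \<epsilon> / real R))"
    using inverse_eps_threshold_space_ge[of C a b] by blast
  show "\<exists>c>0. \<exists>N. \<forall>n. \<forall>S::'a set. \<forall>R::nat. \<forall>t::nat. \<forall>\<epsilon>::real.
         N \<le> n \<and> finite S \<and> N \<le> card S \<and> 1 \<le> R \<and> 0 < \<epsilon> \<and>
         a / \<epsilon> \<le> real t \<and> real t \<le> b / \<epsilon> \<and> t \<le> n \<and>
         real (card S) / \<epsilon> \<le> C * real n \<longrightarrow>
         LNST_space_ge S n t \<epsilon> R (c * (sqrt (real (card S)) / \<epsilon> / real R))"
    by (intro exI[of _ c] conjI exI[of _ N] allI impI c) (elim conjE, rule space_ge_of_nat_alphabet, assumption, rule sp, assumption+)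
qed

end
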